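(* Let $G$ be an amenable group acting freely (by simplicial automorphisms) on a simply connected simplicial complex $\tilde X$ with compact quotient $X=\tilde X/G$. Let $n\ge 1$ and assume that $H_n(\tilde X,\mathbb Z)=0$. Let $(H_i)$ be a Farber chain in $G$ and let $Y_i=\tilde X/H_i$ be the corresponding covering space of $X$. Then \[ \lim_{i\to\infty}\frac{\log T_n(Y_i)}{[G:H_i]}=0, \] where $T_n(Y_i)$ denotes the order of the torsion subgroup of $H_n(Y_i,\mathbb Z)$.
   Context: A chain in $G$ is a sequence $(H_i)_{i\in\mathbb N}$ of finite index subgroups of $G$ that is descending for inclusion ($H_{i+1}\le H_i$). Let $\Omega=\varprojlim G/H_i$ be the associated profinite space of left cosets, with the probability measure $\mu$ induced by the normalized counting measures on the finite sets $G/H_i$; $G$ acts on $\Omega$ by measure preserving homeomorphisms. The chain $(H_i)$ is called Farber if this action is essentially free, i.e. $\mathrm{Stab}_G(x)=1$ for all $x\in\Omega$ outside a null set. Equivalently, for every $g\in G\setminus\{1\}$, \[ \lim_{i\to\infty}\frac{|\{x\in G/H_i : gx=x\}|}{[G:H_i]}=0. \] *)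

theory Defs
  imports "HOL-Analysis.Analysis" "HOL-Homology.Homology" "HOL-Algebra.Left_Coset" "HOL-Algebra.Group_Action"
begin

text \<open>Amenability of a discrete group, via invariant means.\<close>

definition amenable_group :: "('g, 'b) monoid_scheme \<Rightarrow> bool" where
  "amenable_group G \<longleftrightarrow> group G \<and>
     (\<exists>m :: 'g set \<Rightarrow> real.
        (\<forall>A. A \<subseteq> carrier G \<longrightarrow> 0 \<le> m A) \<and>
        m (carrier G) = 1 \<and>
        (\<forall>A B. A \<subseteq> carrier G \<and> B \<subseteq> carrier G \<and> A \<inter> B = {} \<longrightarrow> m (A \<union> B) = m A + m B) \<and>
        (\<forall>g\<in>carrier G. \<forall>A. A \<subseteq> carrier G \<longrightarrow> m (g <#\<^bsub>G\<^esub> A) = m A))"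

definition subgroup_chain :: "('g, 'b) monoid_scheme \<Rightarrow> (nat \<Rightarrow> 'g set) \<Rightarrow> bool" where
  "subgroup_chain G H \<longleftrightarrow>
     (\<forall>i. subgroup (H i) G \<and> finite (lcosets\<^bsub>G\<^esub> (H i)) \<and> H (Suc i) \<subseteq> H i)"

definition subgroup_index :: "('g, 'b) monoid_scheme \<Rightarrow> 'g set \<Rightarrow> nat" where
  "subgroup_index G H = card (lcosets\<^bsub>G\<^esub> H)"

text \<open>The inverse limit of the coset spaces. The bonding map from the cosets of \<open>H (Suc i)\<close> to
  those of \<open>H i\<close> sends a coset to the unique coset containing it, so compatibility of a sequence
  of cosets amounts to inclusion.\<close>

definition coset_limit :: "('g, 'b) monoid_scheme \<Rightarrow> (nat \<Rightarrow> 'g set) \<Rightarrow> (nat \<Rightarrow> 'g set) set" where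
  "coset_limit G H = {x. \<forall>i. x i \<in> lcosets\<^bsub>G\<^esub> (H i) \<and> x (Suc i) \<subseteq> x i}"

definition coset_limit_topology ::
    "('g, 'b) monoid_scheme \<Rightarrow> (nat \<Rightarrow> 'g set) \<Rightarrow> (nat \<Rightarrow> 'g set) topology" where
  "coset_limit_topology G H =
     subtopology (product_topology (\<lambda>i. discrete_topology (lcosets\<^bsub>G\<^esub> (H i))) UNIV)
       (coset_limit G H)"

definition coset_limit_action ::
    "('g, 'b) monoid_scheme \<Rightarrow> 'g \<Rightarrow> (nat \<Rightarrow> 'g set) \<Rightarrow> nat \<Rightarrow> 'g set" where
  "coset_limit_action G g x = (\<lambda>i. g <#\<^bsub>G\<^esub> x i)"

text \<open>For a subgroup chain there is exactly one such measure: the Borel measure on the inverse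
  limit whose projection to each finite coset space is the normalized counting measure.\<close>

definition induced_coset_measure ::
    "('g, 'b) monoid_scheme \<Rightarrow> (nat \<Rightarrow> 'g set) \<Rightarrow> (nat \<Rightarrow> 'g set) measure \<Rightarrow> bool" where
  "induced_coset_measure G H M \<longleftrightarrow>
     sets M = sets (sigma (coset_limit G H) {U. openin (coset_limit_topology G H) U}) \<and>
     (\<forall>i. distr M (count_space (lcosets\<^bsub>G\<^esub> (H i))) (\<lambda>x. x i)
            = uniform_count_measure (lcosets\<^bsub>G\<^esub> (H i)))"

definition farber_chain :: "('g, 'b) monoid_scheme \<Rightarrow> (nat \<Rightarrow> 'g set) \<Rightarrow> bool" where
  "farber_chain G H \<longleftrightarrow> subgroup_chain G H \<and>
     (\<exists>M. induced_coset_measure G H M \<and>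
          (AE x in M. stabilizer G (coset_limit_action G) x = {\<one>\<^bsub>G\<^esub>}))"

definition abstract_simplicial_complex :: "'v set set \<Rightarrow> bool" where
  "abstract_simplicial_complex K \<longleftrightarrow>
     (\<forall>s\<in>K. finite s \<and> s \<noteq> {} \<and> (\<forall>t. t \<subseteq> s \<and> t \<noteq> {} \<longrightarrow> t \<in> K))"

text \<open>Points are given by barycentric coordinates.\<close>

definition closed_simplex :: "'v set \<Rightarrow> ('v \<Rightarrow> real) set" where
  "closed_simplex s = {x. (\<forall>v. 0 \<le> x v) \<and> (\<forall>v. v \<notin> s \<longrightarrow> x v = 0) \<and> (\<Sum>v\<in>s. x v) = 1}"

text \<open>The weak topology: a set is open iff it meets every closed simplex in an open subset of
  that simplex. On a closed simplex, which has finitely many nonzero coordinates, the product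
  topology is the Euclidean one.\<close>

definition realization_open :: "'v set set \<Rightarrow> ('v \<Rightarrow> real) set \<Rightarrow> bool" where
  "realization_open K U \<longleftrightarrow> U \<subseteq> (\<Union>s\<in>K. closed_simplex s) \<and>
     (\<forall>s\<in>K. openin (subtopology (powertop_real UNIV) (closed_simplex s)) (U \<inter> closed_simplex s))"

definition realization :: "'v set set \<Rightarrow> ('v \<Rightarrow> real) topology" where
  "realization K = topology (realization_open K)"

lemma istopology_realization_open: "istopology (realization_open K)"
  unfolding istopology_def
proof (intro conjI allI impI)
  fix S T assume S: "realization_open K S" and T: "realization_open K T"
  have "openin (subtopology (powertop_real UNIV) (closed_simplex s)) (S \<inter> T \<inter> closed_simplex s)"
    if "s \<in> K" for s
  proof -
    have "S \<inter> T \<inter> closed_simplex s = (S \<inter> closed_simplex s) \<inter> (T \<inter> closed_simplex s)"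
      by blast
    moreover have "openin (subtopology (powertop_real UNIV) (closed_simplex s)) \<dots>"
      using S T that unfolding realization_open_def by (intro openin_Int[of _ "S \<inter> _" "T \<inter> _"]) simp_all
    ultimately show ?thesis by (simp only:)
  qed
  then show "realization_open K (S \<inter> T)"
    using S unfolding realization_open_def by blast
next
  fix \<U> assume U: "\<forall>S\<in>\<U>. realization_open K S"
  have "openin (subtopology (powertop_real UNIV) (closed_simplex s)) (\<Union>\<U> \<inter> closed_simplex s)"
    if "s \<in> K" for s
  proof -
    have "\<Union>\<U> \<inter> closed_simplex s = \<Union>((\<lambda>S. S \<inter> closed_simplex s) ` \<U>)"
      by blast
    moreover have "openin (subtopology (powertop_real UNIV) (closed_simplex s)) \<dots>"
      using U that by (intro openin_Union) (auto simp: realization_open_def)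
    ultimately show ?thesis by (simp only:)
  qed
  moreover have "\<Union>\<U> \<subseteq> (\<Union>s\<in>K. closed_simplex s)"
    using U unfolding realization_open_def by blast
  ultimately show "realization_open K (\<Union>\<U>)"
    unfolding realization_open_def by blast
qed

lemma openin_realization: "openin (realization K) U \<longleftrightarrow> realization_open K U"
  by (simp add: realization_def istopology_realization_open topology_inverse')

lemma topspace_realization: "topspace (realization K) = (\<Union>s\<in>K. closed_simplex s)"
proof
  show "topspace (realization K) \<subseteq> (\<Union>s\<in>K. closed_simplex s)"
    using openin_topspace[of "realization K"]
    unfolding openin_realization realization_open_def by blast
  have "realization_open K (\<Union>s\<in>K. closed_simplex s)"
    unfolding realization_open_def
  proof (intro conjI ballI)
    fix s assume "s \<in> K"
    then have "(\<Union>s\<in>K. closed_simplex s) \<inter> closed_simplex s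
        = topspace (subtopology (powertop_real UNIV) (closed_simplex s))"
      by auto
    then show "openin (subtopology (powertop_real UNIV) (closed_simplex s))
        ((\<Union>s\<in>K. closed_simplex s) \<inter> closed_simplex s)"
      by (simp only: openin_topspace)
  qed simp
  then show "(\<Union>s\<in>K. closed_simplex s) \<subseteq> topspace (realization K)"
    by (simp add: openin_realization openin_subset)
qed

definition simplicial_action ::
    "('g, 'b) monoid_scheme \<Rightarrow> 'v set set \<Rightarrow> ('g \<Rightarrow> 'v \<Rightarrow> 'v) \<Rightarrow> bool" where
  "simplicial_action G K \<phi> \<longleftrightarrow> group_action G (\<Union>K) \<phi> \<and>
     (\<forall>g\<in>carrier G. \<forall>s\<in>K. \<phi> g ` s \<in> K)"

text \<open>The affine extension of the vertex action: the coordinate of \<open>g \<cdot> x\<close> at the vertex \<open>g \<cdot> v\<close> is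
  the coordinate of \<open>x\<close> at \<open>v\<close>.\<close>

definition realization_action ::
    "('g, 'b) monoid_scheme \<Rightarrow> 'v set set \<Rightarrow> ('g \<Rightarrow> 'v \<Rightarrow> 'v) \<Rightarrow> 'g \<Rightarrow> ('v \<Rightarrow> real) \<Rightarrow> 'v \<Rightarrow> real" where
  "realization_action G K \<phi> g =
     (\<lambda>x\<in>topspace (realization K). \<lambda>v. if v \<in> \<Union>K then x (\<phi> (inv\<^bsub>G\<^esub> g) v) else 0)"

text \<open>Freeness refers to all points of the realization; in particular no nontrivial element
  maps a simplex to itself.\<close>

definition acts_freely ::
    "('g, 'b) monoid_scheme \<Rightarrow> 'v set set \<Rightarrow> ('g \<Rightarrow> 'v \<Rightarrow> 'v) \<Rightarrow> bool" where
  "acts_freely G K \<phi> \<longleftrightarrow>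
     (\<forall>x\<in>topspace (realization K). stabilizer G (realization_action G K \<phi>) x = {\<one>\<^bsub>G\<^esub>})"

definition quotient_topology :: "'a topology \<Rightarrow> ('a \<Rightarrow> 'c) \<Rightarrow> 'c topology" where
  "quotient_topology X q =
     topology (\<lambda>U. U \<subseteq> q ` topspace X \<and> openin X {x \<in> topspace X. q x \<in> U})"

lemma openin_quotient_topology:
  "openin (quotient_topology X q) U \<longleftrightarrow>
     U \<subseteq> q ` topspace X \<and> openin X {x \<in> topspace X. q x \<in> U}"
proof -
  have "istopology (\<lambda>U. U \<subseteq> q ` topspace X \<and> openin X {x \<in> topspace X. q x \<in> U})"
    unfolding istopology_def
  proof (intro conjI allI impI)
    fix S T
    assume S: "S \<subseteq> q ` topspace X \<and> openin X {x \<in> topspace X. q x \<in> S}"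
      and T: "T \<subseteq> q ` topspace X \<and> openin X {x \<in> topspace X. q x \<in> T}"
    show "S \<inter> T \<subseteq> q ` topspace X" using S by blast
    have "{x \<in> topspace X. q x \<in> S \<inter> T}
        = {x \<in> topspace X. q x \<in> S} \<inter> {x \<in> topspace X. q x \<in> T}" by blast
    moreover have "openin X \<dots>" using S T by (intro openin_Int) auto
    ultimately show "openin X {x \<in> topspace X. q x \<in> S \<inter> T}" by (simp only:)
  next
    fix \<U> assume U: "\<forall>S\<in>\<U>. S \<subseteq> q ` topspace X \<and> openin X {x \<in> topspace X. q x \<in> S}"
    then show "\<Union>\<U> \<subseteq> q ` topspace X" by blast
    have "{x \<in> topspace X. q x \<in> \<Union>\<U>} = \<Union>((\<lambda>S. {x \<in> topspace X. q x \<in> S}) ` \<U>)" by blast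
    moreover have "openin X \<dots>" using U by (intro openin_Union) auto
    ultimately show "openin X {x \<in> topspace X. q x \<in> \<Union>\<U>}" by (simp only:)
  qed
  then show ?thesis by (simp add: quotient_topology_def topology_inverse')
qed

lemma topspace_quotient_topology: "topspace (quotient_topology X q) = q ` topspace X"
proof
  show "topspace (quotient_topology X q) \<subseteq> q ` topspace X"
    using openin_topspace[of "quotient_topology X q"] unfolding openin_quotient_topology by blast
  have "{x \<in> topspace X. q x \<in> q ` topspace X} = topspace X" by blast
  then have "openin (quotient_topology X q) (q ` topspace X)"
    by (simp add: openin_quotient_topology)
  then show "q ` topspace X \<subseteq> topspace (quotient_topology X q)" by (rule openin_subset)
qed

lemma quotient_map_quotient_topology: "quotient_map X (quotient_topology X q) q"
  by (auto simp: quotient_map_def openin_quotient_topology topspace_quotient_topology)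

definition orbit_space ::
    "('g, 'b) monoid_scheme \<Rightarrow> 'v set set \<Rightarrow> ('g \<Rightarrow> 'v \<Rightarrow> 'v) \<Rightarrow> 'g set \<Rightarrow> ('v \<Rightarrow> real) set topology"
    where
  "orbit_space G K \<phi> H =
     quotient_topology (realization K)
       (orbit (G\<lparr>carrier := H\<rparr>) (realization_action G K \<phi>))"

definition simply_connected_space :: "'a topology \<Rightarrow> bool" where
  "simply_connected_space X \<longleftrightarrow> topspace X \<noteq> {} \<and> path_connected_space X \<and>
     (\<forall>p. pathin X p \<and> p 1 = p 0 \<longrightarrow>
        homotopic_with (\<lambda>q. q 0 = p 0 \<and> q 1 = p 0) (top_of_set {0..1}) X p (\<lambda>_. p 0))"

definition torsion_elements :: "('a, 'b) monoid_scheme \<Rightarrow> 'a set" where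
  "torsion_elements A = {x \<in> carrier A. \<exists>k::nat. 0 < k \<and> x [^]\<^bsub>A\<^esub> k = \<one>\<^bsub>A\<^esub>}"

definition homology_torsion :: "nat \<Rightarrow> 'a topology \<Rightarrow> nat" where
  "homology_torsion n X = card (torsion_elements (homology_group (int n) X))"

end

theory Submission
  imports Defs "HOL-Combinatorics.Transposition"
begin

text \<open>
  Let \<open>C\<close> be the complex of ordered simplicial chains of the complex \<open>K\<close>, which has finite rank
  over the group ring, and \<open>Y\<close> the quotient of its realization by a subgroup \<open>H\<close> of index \<open>N\<close>.
  Partition the \<open>n\<close>-simplices of \<open>Y\<close> into tiles that lift to the realization. A chain whose parts
  in all tiles are cycles is a boundary, because \<open>H\<^sub>n = 0\<close> upstairs. Hence the torsion of the
  homology of \<open>Y\<close> embeds into the torsion of \<open>L / B\<close>, where \<open>L\<close> is a free abelian group with a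
  basis and \<open>B\<close> is the image of the boundaries under the map recording the boundary of each
  tile part. An \<open>(n+1)\<close>-simplex with all faces in one tile contributes nothing to \<open>B\<close>, so \<open>B\<close> is
  spanned by boundedly short vectors, one for each simplex cut by the partition, and
  the torsion has order at most \<open>c ^ (number of cut simplices)\<close>.

  A partition that cuts only \<open>\<epsilon> N\<close> simplices is obtained from a Folner set \<open>F\<close>: choose a random
  linear order on the cosets of \<open>H\<close> and attach \<open>x\<close> to the least element of \<open>x F\<close>. The points \<open>x\<close>
  and \<open>x s\<close> are separated only if the minimum over \<open>x F \<union> x s F\<close> lies in the
  symmetric difference, which has small probability, or if \<open>F \<union> s F\<close> does not act injectively at
  \<open>x\<close>, which is rare along a Farber chain.

  Ordered simplicial chains are realized as affine singular simplices. Simplices lying in an open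
  star of a barycenter are replaced by affine ones, choosing at each point a vertex with maximal
  barycentric coordinate; an iterated cone construction gives the chain homotopy.
\<close>

text \<open>Two mismatches shape the argument. The homology is singular, while the count needs
  finitely many simplices. As \<open>Y\<close> need not inherit a simplicial structure from
  \<open>K\<close>, its simplices are projections of affine ones, and no isomorphism of homologies
  is established: it suffices to replace small cycles by homologous straight ones, and small
  fillings by straight fillings, compatibly with boundaries. All choices upstairs are equivariant,
  so that the result does not depend on the lift. The other mismatch is that a cycle of
  \<open>Y\<close>, lifted simplex by simplex, need not close up. A simplex with group label
  \<open>g\<close> lies in the tile \<open>g f (H g)\<close>, where \<open>f\<close> is a function
  on right cosets, and the faces of a simplex share a tile as soon as \<open>f x = s f (x s)\<close>
  for finitely many fixed \<open>s\<close>. The geometry thus meets amenability only in a finite set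
  of group elements, and inversion exchanges the left cosets of the Farber condition for right ones.
  The logarithm of the torsion is at most a constant times the number of cosets violating the
  equation, and this constant does not depend on \<open>H\<close>.\<close>

section \<open>Amenable groups and Farber chains\<close>

text \<open>Rado's argument: in a minimal family satisfying Hall's condition all sets are singletons.\<close>

lemma infinite_marriage:
  fixes A :: "'i \<Rightarrow> 'a set"
  assumes fin: "\<And>i. i \<in> I \<Longrightarrow> finite (A i)"
    and hall: "\<And>J. finite J \<Longrightarrow> J \<subseteq> I \<Longrightarrow> card J \<le> card (\<Union>(A ` J))"
  obtains f where "inj_on f I" "\<And>i. i \<in> I \<Longrightarrow> f i \<in> A i"
proof -
  \<comment> \<open>\<open>M\<close> collects deleted pairs of an index and a value, so a maximal
    good \<open>M\<close> leaves a minimal family that still satisfies Hall's condition.\<close>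
  define good where "good M \<longleftrightarrow> M \<subseteq> Sigma I A \<and>
      (\<forall>J. finite J \<longrightarrow> J \<subseteq> I \<longrightarrow> card J \<le> card ((Sigma I A - M) `` J))" for M
  have finim: "finite ((Sigma I A - M) `` J)" if "finite J" "J \<subseteq> I" for J M
  proof (rule finite_subset)
    show "(Sigma I A - M) `` J \<subseteq> \<Union>(A ` J)" by auto
    show "finite (\<Union>(A ` J))" using that fin by auto
  qed
  have "\<exists>M\<in>{M. good M}. \<forall>X\<in>{M. good M}. M \<subseteq> X \<longrightarrow> X = M"
  proof (rule subset_Zorn)
    fix C assume C: "subset.chain {M. good M} C"
    show "\<exists>U\<in>{M. good M}. \<forall>X\<in>C. X \<subseteq> U"
    proof (cases "C = {}")
      case True
      have "Sigma I A `` J = \<Union>(A ` J)" if "J \<subseteq> I" for J using that by auto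
      then have "good {}" unfolding good_def using hall by auto
      then show ?thesis using True by auto
    next
      case False
      have "good (\<Union>C)"
        unfolding good_def
      proof (intro conjI allI impI)
        show "\<Union>C \<subseteq> Sigma I A" using C unfolding subset.chain_def good_def by blast
        fix J assume J: "finite J" "J \<subseteq> I"
        \<comment> \<open>Over a finite \<open>J\<close> only finitely many pairs exist, so a single
          member of the chain already contains every pair over \<open>J\<close> that the union
          deletes.\<close>
        have "finite (\<Union>C \<inter> Sigma J A)"
          using J fin by (intro finite_Int disjI2 finite_SigmaI) auto
        then obtain X where X: "X \<in> C" "\<Union>C \<inter> Sigma J A \<subseteq> X"
          using finite_subset_Union_chain[of "\<Union>C \<inter> Sigma J A" C "{M. good M}"] False C by auto
        have "(Sigma I A - \<Union>C) `` J = (Sigma I A - X) `` J"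
          using X J by auto
        moreover have "good X" using X C unfolding subset.chain_def by auto
        ultimately show "card J \<le> card ((Sigma I A - \<Union>C) `` J)"
          using J unfolding good_def by auto
      qed
      then show ?thesis by auto
    qed
  qed
  then obtain M where M: "good M" and max: "\<And>X. good X \<Longrightarrow> M \<subseteq> X \<Longrightarrow> X = M"
    by auto
  define R where "R = Sigma I A - M"
  have RJ: "card J \<le> card (R `` J)" if "finite J" "J \<subseteq> I" for J
    using M that unfolding good_def R_def by auto
  have finR: "finite (R `` J)" if "finite J" "J \<subseteq> I" for J
    using finim that unfolding R_def by auto
  \<comment> \<open>Maximality of \<open>M\<close>: deleting one more pair over \<open>i\<close>
    breaks Hall's condition on some finite set. That set must contain \<open>i\<close>, and dropping
    \<open>i\<close> from it turns the strict violation into this inequality.\<close>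
  have remove: "\<exists>J. finite J \<and> J \<subseteq> I \<and> i \<notin> J \<and> card ((R `` {i} - {x}) \<union> R `` J) \<le> card J"
    if ix: "(i, x) \<in> R" for i x
  proof -
    have "\<not> good (insert (i, x) M)"
      using max[of "insert (i,x) M"] ix unfolding R_def by auto
    moreover have "insert (i,x) M \<subseteq> Sigma I A" using M ix unfolding good_def R_def by auto
    moreover have "Sigma I A - insert (i,x) M = R - {(i,x)}" unfolding R_def by auto
    ultimately obtain J where J: "finite J" "J \<subseteq> I" "card ((R - {(i,x)}) `` J) < card J"
      unfolding good_def by (metis not_le)
    have iJ: "i \<in> J"
    proof (rule ccontr)
      assume "i \<notin> J"
      then have "(R - {(i,x)}) `` J = R `` J" unfolding Image_def by fast
      then show False using J RJ[OF J(1,2)] by simp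
    qed
    have "(R - {(i,x)}) `` J = (R `` {i} - {x}) \<union> R `` (J - {i})" using iJ by auto
    then have "card ((R `` {i} - {x}) \<union> R `` (J - {i})) \<le> card (J - {i})"
      using J iJ by (simp add: card_Diff_singleton)
    then show ?thesis using J by (intro exI[of _ "J - {i}"]) auto
  qed
  have single: "x = y" if x: "(i, x) \<in> R" and y: "(i, y) \<in> R" for i x y
  proof (rule ccontr)
    assume ne: "x \<noteq> y"
    have iI: "i \<in> I" using x unfolding R_def by auto
    obtain J1 where J1: "finite J1" "J1 \<subseteq> I" "i \<notin> J1" "card ((R `` {i} - {x}) \<union> R `` J1) \<le> card J1"
      using remove[OF x] by auto
    obtain J2 where J2: "finite J2" "J2 \<subseteq> I" "i \<notin> J2" "card ((R `` {i} - {y}) \<union> R `` J2) \<le> card J2"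
      using remove[OF y] by auto
    let ?P = "(R `` {i} - {x}) \<union> R `` J1" and ?Q = "(R `` {i} - {y}) \<union> R `` J2"
    have fPQ: "finite ?P" "finite ?Q" using J1 J2 finR finR[of "{i}"] iI by auto
    \<comment> \<open>As \<open>x\<close> and \<open>y\<close> differ, each of \<open>?P\<close> and
      \<open>?Q\<close> recovers the value removed from the other. Hall's condition for the union
      and for the intersection gives \<open>card ?P + card ?Q > card J1 + card J2\<close>, against
      the choice of \<open>J1\<close> and \<open>J2\<close>.\<close>
    have "?P \<union> ?Q = R `` (insert i (J1 \<union> J2))" using ne by auto
    moreover have "card (insert i (J1 \<union> J2)) \<le> card (R `` (insert i (J1 \<union> J2)))"
      by (rule RJ) (use J1 J2 iI in auto)
    ultimately have 1: "card (J1 \<union> J2) + 1 \<le> card (?P \<union> ?Q)"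
      using J1 J2 by simp
    have "card (J1 \<inter> J2) \<le> card (R `` (J1 \<inter> J2))" using RJ J1 by auto
    also have "\<dots> \<le> card (?P \<inter> ?Q)" by (rule card_mono) (use fPQ in auto)
    finally have 2: "card (J1 \<inter> J2) \<le> card (?P \<inter> ?Q)" .
    have "card ?P + card ?Q = card (?P \<union> ?Q) + card (?P \<inter> ?Q)"
      by (rule card_Un_Int) (use fPQ in auto)
    moreover have "card J1 + card J2 = card (J1 \<union> J2) + card (J1 \<inter> J2)"
      by (rule card_Un_Int) (use J1 J2 in auto)
    ultimately show False using 1 2 J1 J2 by linarith
  qed
  have ex: "\<exists>x. (i, x) \<in> R" if "i \<in> I" for i
  proof (rule ccontr)
    assume "\<not> ?thesis"
    then have "R `` {i} = {}" by auto
    then show False using RJ[of "{i}"] that by simp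
  qed
  define f where "f i = (SOME x. (i, x) \<in> R)" for i
  have f: "(i, f i) \<in> R" if "i \<in> I" for i
    unfolding f_def using ex[OF that] by (rule someI_ex)
  have "inj_on f I"
  proof (rule inj_onI, rule ccontr)
    fix i j assume ij: "i \<in> I" "j \<in> I" "f i = f j" "i \<noteq> j"
    have "R `` {i, j} \<subseteq> {f i}" using single f ij by auto
    then have "card (R `` {i, j}) \<le> 1" using card_mono[of "{f i}"] by auto
    then show False using RJ[of "{i,j}"] ij by simp
  qed
  moreover have "f i \<in> A i" if "i \<in> I" for i using f[OF that] unfolding R_def by auto
  ultimately show ?thesis using that by blast
qed

text \<open>Without Folner sets some finite \<open>T\<close> satisfies \<open>2 * card F \<le> card (T F)\<close> for all finite \<open>F\<close>,
  and the marriage theorem for two copies of the group yields a paradoxical decomposition.\<close>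

lemma amenable_folner:
  fixes G (structure) and e :: real
  assumes am: "amenable_group G" and S: "finite S" "S \<subseteq> carrier G" and e: "e > 0"
  obtains F where "finite F" "F \<noteq> {}" "F \<subseteq> carrier G"
    "\<And>s. s \<in> S \<Longrightarrow> real (card ((s <#\<^bsub>G\<^esub> F) - F)) \<le> e * real (card F)"
proof (rule ccontr)
  assume "\<not> thesis"
  with that have neg: "\<exists>s\<in>S. real (card ((s <#\<^bsub>G\<^esub> F) - F)) > e * real (card F)"
    if "finite F" "F \<noteq> {}" "F \<subseteq> carrier G" for F
    using that by (meson not_le)
  interpret group G using am by (simp add: amenable_group_def)
  obtain m :: "'a set \<Rightarrow> real" where
    m: "\<forall>A. A \<subseteq> carrier G \<longrightarrow> 0 \<le> m A" "m (carrier G) = 1"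
      "\<forall>A B. A \<subseteq> carrier G \<and> B \<subseteq> carrier G \<and> A \<inter> B = {} \<longrightarrow> m (A \<union> B) = m A + m B"
      "\<forall>g\<in>carrier G. \<forall>A. A \<subseteq> carrier G \<longrightarrow> m (g <#\<^bsub>G\<^esub> A) = m A"
    using am unfolding amenable_group_def by (elim conjE exE)
  have m0: "\<And>A. A \<subseteq> carrier G \<Longrightarrow> 0 \<le> m A"
    and madd: "\<And>A B. A \<subseteq> carrier G \<Longrightarrow> B \<subseteq> carrier G \<Longrightarrow> A \<inter> B = {} \<Longrightarrow> m (A \<union> B) = m A + m B"
    and minv: "\<And>g A. g \<in> carrier G \<Longrightarrow> A \<subseteq> carrier G \<Longrightarrow> m (g <#\<^bsub>G\<^esub> A) = m A"
    using m(1,3,4) by simp_all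
  define S' where "S' = insert \<one> S"
  have S': "finite S'" "S' \<subseteq> carrier G" using S unfolding S'_def by auto
  have finmult: "finite (A <#> B)" if "finite A" "finite B" for A B
    using that by (auto simp: set_mult_def)
  \<comment> \<open>Since \<open>\<one>\<close> belongs to \<open>S'\<close>, the product
    \<open>S' <#> F\<close> contains \<open>F\<close> together with the many new points contributed
    by some \<open>s\<close>.\<close>
  have grow: "(1 + e) * real (card F) \<le> real (card (S' <#> F))" if F: "finite F" "F \<subseteq> carrier G" for F
  proof (cases "F = {}")
    case False
    obtain s where s: "s \<in> S" "real (card ((s <#\<^bsub>G\<^esub> F) - F)) > e * real (card F)"
      using neg[OF F(1) False F(2)] by auto
    have finsF: "finite (s <#\<^bsub>G\<^esub> F)" using F by (auto simp: l_coset_def)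
    have "F \<union> ((s <#\<^bsub>G\<^esub> F) - F) \<subseteq> S' <#> F"
    proof -
      have "x \<in> S' <#> F" if "x \<in> F" for x
        unfolding set_mult_def S'_def using that F by (auto intro!: bexI[of _ x])
      then show ?thesis using s unfolding S'_def set_mult_def l_coset_def by auto
    qed
    then have "card (F \<union> ((s <#\<^bsub>G\<^esub> F) - F)) \<le> card (S' <#> F)"
      by (intro card_mono finmult) (use F S' in auto)
    moreover have "card (F \<union> ((s <#\<^bsub>G\<^esub> F) - F)) = card F + card ((s <#\<^bsub>G\<^esub> F) - F)"
      by (rule card_Un_disjoint) (use F finsF in auto)
    ultimately show ?thesis using s by (simp add: algebra_simps)
  qed simp
  define T where "T k = ((\<lambda>A. S' <#> A) ^^ k) {\<one>}" for k
  have T: "finite (T k) \<and> T k \<subseteq> carrier G" for k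
    by (induction k) (use S' finmult set_mult_closed in \<open>auto simp: T_def\<close>)
  have Tgrow: "(1 + e) ^ k * real (card F) \<le> real (card (T k <#> F))"
    if F: "finite F" "F \<subseteq> carrier G" for k F
  proof (induction k)
    case 0
    have "{\<one>} <#> F = F" using F by (auto simp: set_mult_def subset_iff intro!: bexI)
    then show ?case by (simp add: T_def)
  next
    case (Suc k)
    have "(1 + e) ^ Suc k * real (card F) \<le> (1 + e) * real (card (T k <#> F))"
      using Suc e by simp
    also have "\<dots> \<le> real (card (S' <#> (T k <#> F)))"
      using grow finmult T F set_mult_closed by auto
    also have "S' <#> (T k <#> F) = T (Suc k) <#> F"
      using set_mult_assoc[of S' "T k" F] S' T F by (simp add: T_def)
    finally show ?case .
  qed
  obtain k where k: "(1 + e) ^ k > 2" using real_arch_pow[of "1+e" 2] e by auto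
  have T2: "2 * card F \<le> card (T k <#> F)" if F: "finite F" "F \<subseteq> carrier G" for F
  proof -
    have "2 * real (card F) \<le> (1 + e) ^ k * real (card F)" using k by (intro mult_right_mono) auto
    also have "\<dots> \<le> real (card (T k <#> F))" using Tgrow[OF F] .
    finally show ?thesis by linarith
  qed
  \<comment> \<open>Both copies of \<open>g\<close> are offered the set \<open>T k #> g\<close>; the
    doubling inequality \<open>T2\<close> is exactly what Hall's condition demands of these
    sets.\<close>
  define I where "I = carrier G \<times> (UNIV :: bool set)"
  define A where "A = (\<lambda>(g, b::bool). T k #> g)"
  obtain f where finj: "inj_on f I" and fA: "\<And>i. i \<in> I \<Longrightarrow> f i \<in> A i"
  proof (rule infinite_marriage[of I A])
    show "finite (A i)" if "i \<in> I" for i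
      using T by (cases i) (auto simp: A_def r_coset_def)
    show "card J \<le> card (\<Union> (A ` J))" if J: "finite J" "J \<subseteq> I" for J
    proof -
      have "card J \<le> card ((fst ` J) \<times> (UNIV::bool set))"
        by (rule card_mono) (use J in \<open>force+\<close>)
      also have "\<dots> = 2 * card (fst ` J)" using J by (simp add: card_cartesian_product)
      also have "\<dots> \<le> card (T k <#> fst ` J)"
        by (rule T2) (use J in \<open>auto simp: I_def\<close>)
      also have "T k <#> fst ` J = \<Union> (A ` J)"
        unfolding A_def set_mult_def r_coset_def by force
      finally show ?thesis .
    qed
  qed (rule that)
  \<comment> \<open>\<open>f\<close> moves copy \<open>b\<close> of \<open>g\<close> by some
    \<open>t\<close> in \<open>T k\<close>, and \<open>B (t, b)\<close> collects the
    \<open>g\<close> for which this happens. For each \<open>b\<close> the pieces partition the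
    group, while injectivity of \<open>f\<close> makes all translated pieces disjoint across both
    values of \<open>b\<close>: total mass 2 in a group of mass 1.\<close>
  define B where "B = (\<lambda>(t, b). {g \<in> carrier G. f (g, b) = t \<otimes> g})"
  have Bsub: "B i \<subseteq> carrier G" for i by (auto simp: B_def split: prod.splits)
  have msum: "m (\<Union>i\<in>J. C i) = (\<Sum>i\<in>J. m (C i))"
    if "finite J" "\<And>i. i \<in> J \<Longrightarrow> C i \<subseteq> carrier G" "disjoint_family_on C J" for J and C :: "'c \<Rightarrow> _"
    using that
  proof (induction J rule: finite_induct)
    case empty
    have "m ({} \<union> {}) = m {} + m {}" by (rule madd) auto
    then show ?case by simp
  next
    case (insert x J)
    have "m (C x \<union> (\<Union>i\<in>J. C i)) = m (C x) + m (\<Union>i\<in>J. C i)"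
      by (rule madd) (use insert in \<open>auto simp: disjoint_family_on_def\<close>)
    then show ?case using insert by (auto simp: disjoint_family_on_insert)
  qed
  have cover: "(\<Union>t\<in>T k. B (t, b)) = carrier G" for b
  proof
    show "carrier G \<subseteq> (\<Union>t\<in>T k. B (t, b))"
    proof
      fix g assume g: "g \<in> carrier G"
      then have "f (g, b) \<in> T k #> g" using fA[of "(g,b)"] by (auto simp: I_def A_def)
      then show "g \<in> (\<Union>t\<in>T k. B (t, b))" using g by (auto simp: r_coset_def B_def)
    qed
  qed (use Bsub in auto)
  have one: "(\<Sum>t\<in>T k. m (B (t, b))) = 1" for b
  proof -
    have "disjoint_family_on (\<lambda>t. B (t, b)) (T k)"
      unfolding disjoint_family_on_def B_def using T by (auto simp: subset_iff)
    then have "m (\<Union>t\<in>T k. B (t, b)) = (\<Sum>t\<in>T k. m (B (t, b)))"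
      using T Bsub by (intro msum) auto
    then show ?thesis using cover m(2) by simp
  qed
  define C where "C = (\<lambda>(t, b). t <#\<^bsub>G\<^esub> B (t, b))"
  have Csub: "C i \<subseteq> carrier G" if "i \<in> T k \<times> UNIV" for i
    using that T[of k] l_coset_subset_G[OF Bsub] by (auto simp: C_def)
  have "disjoint_family_on C (T k \<times> UNIV)"
  proof (unfold disjoint_family_on_def, intro ballI impI)
    fix i j :: "'a \<times> bool" assume ij: "i \<in> T k \<times> UNIV" "j \<in> T k \<times> UNIV" "i \<noteq> j"
    obtain t b t' b' where eq: "i = (t, b)" "j = (t', b')" by (cases i, cases j) auto
    have tc: "t \<in> carrier G" "t' \<in> carrier G" using ij T[of k] eq by auto
    have False if x: "x \<in> C i" "x \<in> C j" for x
    proof -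
      obtain g where g: "g \<in> carrier G" "f (g, b) = t \<otimes> g" "x = t \<otimes> g"
        using x(1) by (auto simp: C_def B_def l_coset_def eq)
      obtain g' where g': "g' \<in> carrier G" "f (g', b') = t' \<otimes> g'" "x = t' \<otimes> g'"
        using x(2) by (auto simp: C_def B_def l_coset_def eq)
      have "(g, b) = (g', b')"
        by (rule inj_onD[OF finj]) (use g g' in \<open>auto simp: I_def\<close>)
      moreover from this have "t = t'" using g g' tc by (metis Pair_inject right_cancel)
      ultimately show False using ij eq by simp
    qed
    then show "C i \<inter> C j = {}" by blast
  qed
  then have "m (\<Union>i\<in>T k \<times> UNIV. C i) = (\<Sum>i\<in>T k \<times> UNIV. m (C i))"
    using T Csub by (intro msum) auto
  also have "\<dots> = (\<Sum>i\<in>T k \<times> UNIV. m (B i))"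
    by (rule sum.cong) (auto simp: C_def intro!: minv Bsub subsetD[OF conjunct2[OF T[of k]]])
  also have "\<dots> = (\<Sum>t\<in>T k. \<Sum>b\<in>UNIV. m (B (t, b)))"
    by (simp add: sum.cartesian_product)
  also have "\<dots> = (\<Sum>b\<in>UNIV. \<Sum>t\<in>T k. m (B (t, b)))"
    by (rule sum.swap)
  also have "\<dots> = 2" using one by (simp add: UNIV_bool)
  finally have 2: "m (\<Union>i\<in>T k \<times> UNIV. C i) = 2" .
  let ?U = "\<Union>i\<in>T k \<times> UNIV. C i"
  have U: "?U \<subseteq> carrier G" using Csub by blast
  have "m (?U \<union> (carrier G - ?U)) = m ?U + m (carrier G - ?U)"
    by (rule madd) (use U in auto)
  moreover have "?U \<union> (carrier G - ?U) = carrier G" using U by blast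
  moreover have "0 \<le> m (carrier G - ?U)" by (rule m0) auto
  ultimately show False using 2 m(2) by simp
qed

section \<open>Random linear orders on a finite set\<close>

definition orderings :: "'a set \<Rightarrow> ('a \<Rightarrow> nat) set" where
  "orderings X = {p \<in> X \<rightarrow>\<^sub>E {..<card X}. bij_betw p X {..<card X}}"

lemma finite_orderings: "finite X \<Longrightarrow> finite (orderings X)"
  unfolding orderings_def by (rule finite_subset[OF _ finite_PiE[of X "\<lambda>_. {..<card X}"]]) auto

lemma orderings_nonempty: "finite X \<Longrightarrow> orderings X \<noteq> {}"
proof -
  assume "finite X"
  then obtain h where h: "bij_betw h X {0..<card X}" using ex_bij_betw_finite_nat by blast
  then have "restrict h X \<in> orderings X"
    unfolding orderings_def by (auto simp: bij_betw_def lessThan_atLeast0 inj_on_def)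
  then show ?thesis by auto
qed

lemma orderings_inj: "p \<in> orderings X \<Longrightarrow> inj_on p X"
  by (auto simp: orderings_def bij_betw_def)

text \<open>By symmetry every element of \<open>U\<close> is equally often the smallest one.\<close>

lemma card_orderings_min:
  assumes X: "finite X" and U: "U \<subseteq> X" "U \<noteq> {}" and A: "A \<subseteq> U"
  shows "card {p \<in> orderings X. \<exists>u\<in>A. \<forall>w\<in>U. p u \<le> p w} * card U = card A * card (orderings X)"
proof -
  define Q where "Q u = {p \<in> orderings X. \<forall>w\<in>U. p u \<le> p w}" for u
  have finU: "finite U" using X U finite_subset by auto
  have finQ: "finite (Q u)" for u unfolding Q_def using finite_orderings[OF X] by auto
  have disj: "Q u \<inter> Q v = {}" if "u \<in> U" "v \<in> U" "u \<noteq> v" for u v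
  proof -
    have False if "p \<in> Q u" "p \<in> Q v" for p
    proof -
      have "p u = p v" using that \<open>u \<in> U\<close> \<open>v \<in> U\<close> unfolding Q_def by (auto intro: le_antisym)
      moreover have "inj_on p X" using that orderings_inj unfolding Q_def by auto
      ultimately show False using \<open>u \<noteq> v\<close> U \<open>u \<in> U\<close> \<open>v \<in> U\<close> by (auto simp: inj_on_def)
    qed
    then show ?thesis by auto
  qed
  \<comment> \<open>Precomposition with the transposition of \<open>u\<close> and \<open>v\<close>
    carries the orderings whose minimum on \<open>U\<close> is at \<open>u\<close> to those whose
    minimum is at \<open>v\<close>.\<close>
  have le: "card (Q u) \<le> card (Q v)" if uv: "u \<in> U" "v \<in> U" for u v
  proof (rule card_inj_on_le[of "\<lambda>p. p \<circ> Transposition.transpose u v"])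
    show "finite (Q v)" by (rule finQ)
    show "inj_on (\<lambda>p. p \<circ> Transposition.transpose u v) (Q u)"
    proof (rule inj_onI)
      fix p q assume "p \<circ> Transposition.transpose u v = q \<circ> Transposition.transpose u v"
      then have "(p \<circ> Transposition.transpose u v) \<circ> Transposition.transpose u v = (q \<circ> Transposition.transpose u v) \<circ> Transposition.transpose u v" by simp
      then show "p = q" by (simp add: comp_assoc)
    qed
    show "(\<lambda>p. p \<circ> Transposition.transpose u v) ` Q u \<subseteq> Q v"
    proof
      fix r assume "r \<in> (\<lambda>p. p \<circ> Transposition.transpose u v) ` Q u"
      then obtain p where p: "p \<in> Q u" "r = p \<circ> Transposition.transpose u v" by auto
      have t: "bij_betw (Transposition.transpose u v) X X"
        using uv U by (intro bij_betw_byWitness[of _ "Transposition.transpose u v"]) (auto simp: Transposition.transpose_def)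
      have "bij_betw r X {..<card X}"
        using p t unfolding Q_def orderings_def by (auto intro: bij_betw_trans)
      moreover have "r x = undefined" if "x \<notin> X" for x
      proof -
        have "x \<noteq> u" "x \<noteq> v" using that uv U by auto
        then show ?thesis using p that unfolding Q_def orderings_def
          by (auto simp: Transposition.transpose_def PiE_def extensional_def)
      qed
      ultimately have "r \<in> orderings X"
        unfolding orderings_def by (auto simp: PiE_def extensional_def bij_betw_def)
      moreover have "r v \<le> r w" if "w \<in> U" for w
      proof -
        have "Transposition.transpose u v w \<in> U" using uv that by (auto simp: Transposition.transpose_def)
        then show ?thesis using p unfolding Q_def by auto
      qed
      ultimately show "r \<in> Q v" unfolding Q_def by auto
    qed
  qed
  obtain u0 where u0: "u0 \<in> U" using U by auto
  have eq: "card (Q u) = card (Q u0)" if "u \<in> U" for u using le that u0 by (meson le_antisym)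
  have cnt: "card (\<Union>u\<in>B. Q u) = card B * card (Q u0)" if "B \<subseteq> U" for B
  proof -
    have "card (\<Union>u\<in>B. Q u) = (\<Sum>u\<in>B. card (Q u))"
    proof (rule card_UN_disjoint)
      show "finite B" using that finU finite_subset by metis
    qed (use that finQ disj in blast)+
    also have "\<dots> = (\<Sum>u\<in>B. card (Q u0))" by (rule sum.cong) (use eq that in auto)
    finally show ?thesis by simp
  qed
  have "(\<Union>u\<in>U. Q u) = orderings X"
  proof
    show "orderings X \<subseteq> (\<Union>u\<in>U. Q u)"
    proof
      fix p assume p: "p \<in> orderings X"
      obtain u where "u \<in> U" "\<forall>w\<in>U. p u \<le> p w"
        using finU U by (metis arg_min_if_finite(1) arg_min_least)
      then show "p \<in> (\<Union>u\<in>U. Q u)" using p unfolding Q_def by auto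
    qed
  qed (auto simp: Q_def)
  then have "card (orderings X) = card U * card (Q u0)" using cnt[of U] by simp
  moreover have "{p \<in> orderings X. \<exists>u\<in>A. \<forall>w\<in>U. p u \<le> p w} = (\<Union>u\<in>A. Q u)"
    by (auto simp: Q_def)
  ultimately show ?thesis using cnt[OF A] by simp
qed

text \<open>The ratio at level \<open>i\<close> is the measure of the cylinder of threads whose
  \<open>i\<close>-th coset is fixed by \<open>g\<close>. These cylinders decrease, and their
  intersection consists of threads fixed by \<open>g\<close>, a null set by essential freeness;
  continuity from above gives the limit.\<close>

lemma farber_fixed_points:
  fixes G (structure)
  assumes "group G" and farber: "farber_chain G H" and g: "g \<in> carrier G" "g \<noteq> \<one>"
  shows "(\<lambda>i. real (card {x \<in> lcosets\<^bsub>G\<^esub> (H i). g <#\<^bsub>G\<^esub> x = x}) / real (subgroup_index G (H i)))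
           \<longlonglongrightarrow> 0"
proof -
  interpret group G by fact
  let ?L = "\<lambda>i. lcosets\<^bsub>G\<^esub> (H i)"
  define \<Omega> where "\<Omega> = coset_limit G H"
  have H: "subgroup (H i) G" "finite (?L i)" "H (Suc i) \<subseteq> H i" for i
    using farber unfolding farber_chain_def subgroup_chain_def by auto
  have Lne: "?L i \<noteq> {}" for i by (auto simp: LCOSETS_def)
  obtain M where M: "induced_coset_measure G H M"
    and AE: "AE x in M. stabilizer G (coset_limit_action G) x = {\<one>}"
    using farber unfolding farber_chain_def by auto
  have setsM: "sets M = sets (sigma \<Omega> {U. openin (coset_limit_topology G H) U})"
    and distrM: "distr M (count_space (?L i)) (\<lambda>x. x i) = uniform_count_measure (?L i)" for i
    using M unfolding induced_coset_measure_def \<Omega>_def by auto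
  have spaceM: "space M = \<Omega>" using sets_eq_imp_space_eq[OF setsM] by (simp add: space_measure_of_conv)
  have top: "topspace (coset_limit_topology G H) = \<Omega>"
    unfolding coset_limit_topology_def \<Omega>_def coset_limit_def by auto
  have openM: "U \<in> sets M" if "openin (coset_limit_topology G H) U" for U
  proof -
    have "{U. openin (coset_limit_topology G H) U} \<subseteq> Pow \<Omega>"
      using openin_subset top by blast
    then show ?thesis unfolding setsM using that by (auto simp: sets_measure_of intro: sigma_sets.Basic)
  qed
  have meas: "(\<lambda>x. x i) \<in> measurable M (count_space (?L i))" for i
  proof -
    have "(\<lambda>x. x i) -` {a} \<inter> space M \<in> sets M" if "a \<in> ?L i" for a
    proof (rule openM)
      have "openin (product_topology (\<lambda>i. discrete_topology (?L i)) UNIV)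
          {x \<in> topspace (product_topology (\<lambda>i. discrete_topology (?L i)) UNIV). x i \<in> {a}}"
        by (rule openin_continuous_map_preimage[OF continuous_map_product_projection]) (use that in auto)
      then have "openin (coset_limit_topology G H)
         ({x \<in> topspace (product_topology (\<lambda>i. discrete_topology (?L i)) UNIV). x i \<in> {a}} \<inter> \<Omega>)"
        unfolding coset_limit_topology_def \<Omega>_def by (auto simp: openin_subtopology)
      moreover have "{x \<in> topspace (product_topology (\<lambda>i. discrete_topology (?L i)) UNIV). x i \<in> {a}} \<inter> \<Omega>
          = (\<lambda>x. x i) -` {a} \<inter> space M"
        unfolding spaceM unfolding \<Omega>_def coset_limit_def by auto
      ultimately show "openin (coset_limit_topology G H) ((\<lambda>x. x i) -` {a} \<inter> space M)" by simp
    qed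
    moreover have "(\<lambda>x. x i) \<in> space M \<rightarrow> ?L i" unfolding spaceM \<Omega>_def coset_limit_def by auto
    ultimately show ?thesis using H by (subst measurable_count_space_eq2) auto
  qed
  have em: "emeasure M ((\<lambda>x. x i) -` B \<inter> space M) = ennreal (real (card B) / real (card (?L i)))"
    if "B \<subseteq> ?L i" for B i
  proof -
    have "emeasure M ((\<lambda>x. x i) -` B \<inter> space M) = emeasure (distr M (count_space (?L i)) (\<lambda>x. x i)) B"
      using meas that by (subst emeasure_distr) auto
    then show ?thesis using that H distrM emeasure_uniform_count_measure[of "?L i" B] by simp
  qed
  interpret M: finite_measure M
  proof
    have "(\<lambda>x. x 0) -` (?L 0) \<inter> space M = space M"
      unfolding spaceM unfolding \<Omega>_def coset_limit_def by auto
    then show "emeasure M (space M) \<noteq> \<infinity>" using em[of "?L 0" 0] by simp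
  qed
  define A where "A i = (\<lambda>x. x i) -` {y \<in> ?L i. g <#\<^bsub>G\<^esub> y = y} \<inter> space M" for i
  have A: "measure M (A i) = real (card {x \<in> ?L i. g <#\<^bsub>G\<^esub> x = x}) / real (subgroup_index G (H i))" for i
    unfolding A_def measure_def by (subst em) (auto simp: subgroup_index_def)
  have Asets: "A i \<in> sets M" for i unfolding A_def using meas by (rule measurable_sets) auto
  \<comment> \<open>A coset fixed at level \<open>Suc i\<close> lies in a coset of level
    \<open>i\<close>. The latter and its translate by \<open>g\<close> share the point
    \<open>b\<close>, and cosets of one subgroup that meet coincide.\<close>
  have dec: "decseq A"
  proof (rule decseq_SucI, rule subsetI)
    fix i x assume x: "x \<in> A (Suc i)"
    then have xO: "x \<in> \<Omega>" and gx: "g <#\<^bsub>G\<^esub> x (Suc i) = x (Suc i)" unfolding A_def spaceM by auto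
    have xi: "x i \<in> ?L i" "x (Suc i) \<in> ?L (Suc i)" "x (Suc i) \<subseteq> x i"
      using xO unfolding \<Omega>_def coset_limit_def by auto
    obtain a where a: "a \<in> carrier G" "x i = a <#\<^bsub>G\<^esub> H i" using xi by (auto simp: LCOSETS_def)
    obtain b where b: "b \<in> carrier G" "x (Suc i) = b <#\<^bsub>G\<^esub> H (Suc i)" using xi by (auto simp: LCOSETS_def)
    have bx: "b \<in> x (Suc i)" using b H(1)[of "Suc i"] subgroup.one_closed
      by (force simp: l_coset_def intro!: bexI[of _ \<one>])
    have gxi: "g <#\<^bsub>G\<^esub> x i = (g \<otimes> a) <#\<^bsub>G\<^esub> H i"
      using a g by (simp add: lcos_m_assoc[OF subgroup.subset[OF H(1)]])
    have "b \<in> g <#\<^bsub>G\<^esub> x (Suc i)" using bx gx by simp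
    then have "b \<in> g <#\<^bsub>G\<^esub> x i" using xi(3) by (auto simp: l_coset_def)
    then have "b <#\<^bsub>G\<^esub> H i = (g \<otimes> a) <#\<^bsub>G\<^esub> H i"
      using gxi H(1) a g by (metis l_repr_independence m_closed)
    moreover have "b <#\<^bsub>G\<^esub> H i = x i"
      using bx xi(3) a H(1) by (metis l_repr_independence subsetD)
    ultimately show "x \<in> A i" using gxi xi(1) xO unfolding A_def spaceM by auto
  qed
  have lim: "(\<lambda>i. measure M (A i)) \<longlonglongrightarrow> measure M (\<Inter>i. A i)"
    by (rule M.finite_Lim_measure_decseq) (use Asets dec in auto)
  have "AE x in M. x \<notin> (\<Inter>i. A i)"
    using AE
  proof (rule AE_mp, intro AE_I2 impI notI)
    fix x assume st: "stabilizer G (coset_limit_action G) x = {\<one>}" and x: "x \<in> (\<Inter>i. A i)"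
    then have "coset_limit_action G g x = x" unfolding coset_limit_action_def A_def by auto
    then have "g \<in> stabilizer G (coset_limit_action G) x" using g by (auto simp: stabilizer_def)
    then show False using st g by auto
  qed
  moreover have "(\<Inter>i. A i) \<in> sets M" using Asets by auto
  moreover have "{x \<in> space M. \<not> x \<notin> (\<Inter>i. A i)} = (\<Inter>i. A i)" by (auto simp: A_def)
  ultimately have "emeasure M (\<Inter>i. A i) = 0" using AE_iff_measurable[of "\<Inter>i. A i" M "\<lambda>x. x \<notin> (\<Inter>i. A i)"] by blast
  then have "measure M (\<Inter>i. A i) = 0" by (simp add: measure_def)
  then show ?thesis using lim A by simp
qed

text \<open>Inversion turns \<open>a H\<close> into \<open>H (inv a)\<close>. This links the left
  cosets of the Farber condition with the right cosets on which the tile selection lives.\<close>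

lemma (in group) bij_betw_lcosets_rcosets:
  assumes "subgroup H G"
  shows "bij_betw ((`) (m_inv G)) (lcosets\<^bsub>G\<^esub> H) (rcosets H)"
    and "\<And>x. x \<subseteq> carrier G \<Longrightarrow> m_inv G ` m_inv G ` x = x"
    and "\<And>x. x \<in> lcosets\<^bsub>G\<^esub> H \<Longrightarrow> x \<subseteq> carrier G"
proof -
  interpret subgroup H G by fact
  let ?L = "lcosets\<^bsub>G\<^esub> H"
  define J where "J x = m_inv G ` x" for x
  show Lsub: "x \<subseteq> carrier G" if "x \<in> ?L" for x
    using that l_coset_subset_G[OF subset] unfolding LCOSETS_def by auto
  have JJ: "J (J x) = x" if "x \<subseteq> carrier G" for x
    unfolding J_def image_image using that by (simp add: subset_iff cong: image_cong_simp)
  then show "m_inv G ` m_inv G ` x = x" if "x \<subseteq> carrier G" for x using that unfolding J_def by simp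
  have Jl: "J (a <#\<^bsub>G\<^esub> H) = H #> inv a" if a: "a \<in> carrier G" for a
  proof -
    have "J (a <#\<^bsub>G\<^esub> H) = (\<lambda>h. inv h \<otimes> inv a) ` H"
      unfolding J_def l_coset_def using a inv_mult_group[OF a]
      by (auto simp: image_UN)
    also have "\<dots> = (\<lambda>h. h \<otimes> inv a) ` (m_inv G ` H)" by (simp add: image_image)
    also have "m_inv G ` H = H"
    proof
      show "H \<subseteq> m_inv G ` H"
      proof
        fix h assume "h \<in> H"
        then show "h \<in> m_inv G ` H" by (intro image_eqI[of _ _ "inv h"]) auto
      qed
    qed auto
    finally show ?thesis by (auto simp: r_coset_def)
  qed
  have "bij_betw J ?L (rcosets H)"
  proof (rule bij_betw_imageI)
    show "inj_on J ?L" by (rule inj_on_inverseI[of _ J]) (use JJ Lsub in auto)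
    show "J ` ?L = rcosets H"
    proof
      show "J ` ?L \<subseteq> rcosets H" using Jl by (auto simp: LCOSETS_def RCOSETS_def)
      show "rcosets H \<subseteq> J ` ?L"
      proof
        fix y assume "y \<in> rcosets H"
        then obtain a where a: "a \<in> carrier G" "y = H #> a" by (auto simp: RCOSETS_def)
        then have "y = J (inv a <#\<^bsub>G\<^esub> H)" using Jl[of "inv a"] by simp
        moreover have "inv a <#\<^bsub>G\<^esub> H \<in> ?L" using a by (auto simp: LCOSETS_def)
        ultimately show "y \<in> J ` ?L" by blast
      qed
    qed
  qed
  then show "bij_betw ((`) (m_inv G)) (lcosets\<^bsub>G\<^esub> H) (rcosets H)" unfolding J_def .
qed

lemma (in group) card_rcosets:
  assumes "subgroup H G"
  shows "card (rcosets H) = subgroup_index G H"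
    and "finite (lcosets\<^bsub>G\<^esub> H) \<Longrightarrow> finite (rcosets H)"
  using bij_betw_same_card[OF bij_betw_lcosets_rcosets(1)[OF assms]]
    bij_betw_finite[OF bij_betw_lcosets_rcosets(1)[OF assms]] by (auto simp: subgroup_index_def)

text \<open>Inversion intertwines left multiplication by \<open>inv g\<close> with right
  multiplication by \<open>g\<close>, so the two kinds of fixed cosets are equinumerous.\<close>

lemma farber_fixed_points_right:
  fixes G (structure)
  assumes "group G" and farber: "farber_chain G H" and g: "g \<in> carrier G" "g \<noteq> \<one>"
  shows "(\<lambda>i. real (card {x \<in> rcosets (H i). x #> g = x}) / real (card (rcosets (H i))))
           \<longlonglongrightarrow> 0"
proof -
  interpret group G by fact
  let ?L = "\<lambda>i. lcosets\<^bsub>G\<^esub> (H i)"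
  have H: "subgroup (H i) G" for i
    using farber unfolding farber_chain_def subgroup_chain_def by auto
  define J where "J x = m_inv G ` x" for x
  have bij: "bij_betw J (?L i) (rcosets (H i))" for i
    using bij_betw_lcosets_rcosets(1)[OF H] unfolding J_def .
  have JJ: "J (J x) = x" if "x \<subseteq> carrier G" for x
    using bij_betw_lcosets_rcosets(2)[OF H that] unfolding J_def .
  have Lsub: "x \<subseteq> carrier G" if "x \<in> ?L i" for x i
    using bij_betw_lcosets_rcosets(3)[OF H that] .
  have fixeq: "card {x \<in> rcosets (H i). x #> g = x} = card {x \<in> ?L i. inv g <#\<^bsub>G\<^esub> x = x}" for i
  proof -
    have Jg: "J (inv g <#\<^bsub>G\<^esub> x) = J x #> g" if "x \<subseteq> carrier G" for x
    proof -
      have "inv (inv g \<otimes> a) = inv a \<otimes> g" if "a \<in> x" for a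
        using that \<open>x \<subseteq> carrier G\<close> g by (simp add: inv_mult_group subset_iff)
      then show ?thesis unfolding J_def l_coset_def r_coset_def by (simp add: image_UN)
    qed
    have "bij_betw J {x \<in> ?L i. inv g <#\<^bsub>G\<^esub> x = x} {x \<in> rcosets (H i). x #> g = x}"
    proof (rule bij_betw_imageI)
      show "inj_on J {x \<in> ?L i. inv g <#\<^bsub>G\<^esub> x = x}"
        using bij[of i] by (auto simp: bij_betw_def intro: inj_on_subset)
      have "inv g <#\<^bsub>G\<^esub> x = x \<longleftrightarrow> J x #> g = J x" if "x \<in> ?L i" for x
        using Jg[OF Lsub[OF that]] JJ[OF Lsub[OF that]] JJ[of "inv g <#\<^bsub>G\<^esub> x"]
          l_coset_subset_G[OF Lsub[OF that], of "inv g"] g by (metis inv_closed)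
      then have "J ` {x \<in> ?L i. inv g <#\<^bsub>G\<^esub> x = x} = {x \<in> J ` ?L i. x #> g = x}" by blast
      then show "J ` {x \<in> ?L i. inv g <#\<^bsub>G\<^esub> x = x} = {x \<in> rcosets (H i). x #> g = x}"
        using bij[of i] by (simp add: bij_betw_def)
    qed
    then show ?thesis by (simp add: bij_betw_same_card)
  qed
  have "inv g \<noteq> \<one>" using g by (simp add: inv_eq_1_iff)
  then show "(\<lambda>i. real (card {x \<in> rcosets (H i). x #> g = x}) / real (card (rcosets (H i))))
           \<longlonglongrightarrow> 0"
    using farber_fixed_points[OF \<open>group G\<close> farber, of "inv g"] g by (simp add: fixeq card_rcosets(1)[OF H])
qed

lemma ex_min_on:
  fixes f :: "'a \<Rightarrow> nat"
  assumes "finite U" "U \<noteq> {}" shows "\<exists>u\<in>U. \<forall>w\<in>U. f u \<le> f w"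
proof -
  have "Min (f ` U) \<in> f ` U" using assms by (intro Min_in) auto
  then obtain u where "u \<in> U" "f u = Min (f ` U)" by auto
  then show ?thesis using assms by (intro bexI[of _ u]) auto
qed

text \<open>For an order \<open>p\<close> on the cosets, \<open>f p x\<close> names the least
  element of \<open>x F\<close>. If the least element of the union of \<open>x F\<close> and
  \<open>x s F\<close> lies in both, then \<open>x\<close> and \<open>x #> s\<close> select the same
  coset, and injectivity of \<open>W\<close> at \<open>x\<close> upgrades this to the equation
  \<open>f x = s \<otimes> f (x #> s)\<close> of group elements. The Folner property makes the other
  case improbable, and the Farber property makes injectivity typical.\<close>

lemma farber_equivariant_selection:
  fixes G (structure) and e :: real
  assumes am: "amenable_group G" and farber: "farber_chain G H"
    and S: "finite S" "S \<subseteq> carrier G" and e: "e > 0"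
  shows "\<forall>\<^sub>F i in sequentially. \<exists>f \<in> rcosets (H i) \<rightarrow> carrier G.
     real (card {x \<in> rcosets (H i). \<exists>s\<in>S. f x \<noteq> s \<otimes> f (x #> s)}) \<le> e * real (card (rcosets (H i)))"
proof -
  interpret group G using am by (simp add: amenable_group_def)
  have G: "group G" by unfold_locales
  \<comment> \<open>Half of \<open>e\<close> is spent on the cosets where \<open>W\<close> fails to
    act injectively. Each \<open>s\<close> costs a proportion \<open>2 * e1\<close>, so all of
    \<open>S\<close> costs at most the other half; the \<open>+ 1\<close> covers empty
    \<open>S\<close>.\<close>
  define e1 where "e1 = e / (4 * (real (card S) + 1))"
  have e1: "e1 > 0" using e unfolding e1_def by (intro divide_pos_pos) auto
  obtain F where F: "finite F" "F \<noteq> {}" "F \<subseteq> carrier G"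
    "\<And>s. s \<in> S \<Longrightarrow> real (card ((s <#\<^bsub>G\<^esub> F) - F)) \<le> e1 * real (card F)"
    using amenable_folner[OF am S e1] by metis
  define W where "W = F \<union> (\<Union>s\<in>S. s <#\<^bsub>G\<^esub> F)"
  have lF: "finite (s <#\<^bsub>G\<^esub> F)" for s using F by (auto simp: l_coset_def)
  have lFc: "s <#\<^bsub>G\<^esub> F \<subseteq> carrier G" if "s \<in> S" for s using l_coset_subset_G[OF F(3)] that S by auto
  have W: "finite W" "W \<subseteq> carrier G" unfolding W_def using F(1,3) S(1) lF lFc by blast+
  have card_lF: "card (s <#\<^bsub>G\<^esub> F) = card F" if "s \<in> S" for s
  proof -
    have "s <#\<^bsub>G\<^esub> F = (\<lambda>x. s \<otimes> x) ` F" by (auto simp: l_coset_def)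
    moreover have "inj_on (\<lambda>x. s \<otimes> x) F" using that S F(3) by (auto simp: inj_on_def subset_iff)
    ultimately show ?thesis by (simp add: card_image)
  qed
  \<comment> \<open>A collision \<open>x #> a = x #> b\<close> makes \<open>x\<close> a fixed point
    of \<open>a \<otimes> inv b\<close>. Outside the fixed cosets of the finitely many elements of
    \<open>E\<close>, the set \<open>W\<close> therefore acts injectively at
    \<open>x\<close>.\<close>
  define E where "E = (\<lambda>(a, b). a \<otimes> inv b) ` (W \<times> W) - {\<one>}"
  have E: "finite E" "E \<subseteq> carrier G" unfolding E_def using W by auto
  have "(\<lambda>i. \<Sum>g\<in>E. real (card {x \<in> rcosets (H i). x #> g = x}) / real (card (rcosets (H i))))
          \<longlonglongrightarrow> (\<Sum>g\<in>E. 0)"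
    by (intro tendsto_sum farber_fixed_points_right[OF G farber]) (use E in \<open>auto simp: E_def\<close>)
  then have "(\<lambda>i. \<Sum>g\<in>E. real (card {x \<in> rcosets (H i). x #> g = x}) / real (card (rcosets (H i))))
          \<longlonglongrightarrow> 0" by simp
  then have ev: "\<forall>\<^sub>F i in sequentially. (\<Sum>g\<in>E. real (card {x \<in> rcosets (H i). x #> g = x}) / real (card (rcosets (H i)))) < e / 2"
    using e by (intro order_tendstoD(2)) auto
  show ?thesis
    using ev
  proof (rule eventually_mono)
    fix i assume small: "(\<Sum>g\<in>E. real (card {x \<in> rcosets (H i). x #> g = x}) / real (card (rcosets (H i)))) < e / 2"
    interpret subgroup "H i" G using farber unfolding farber_chain_def subgroup_chain_def by auto
    define X where "X = rcosets (H i)"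
    have X: "finite X" unfolding X_def using farber card_rcosets(2)[OF subgroup_axioms]
      unfolding farber_chain_def subgroup_chain_def by auto
    have Xne: "X \<noteq> {}" unfolding X_def RCOSETS_def by auto
    have N: "real (card X) > 0" using X Xne by (simp add: card_gt_0_iff)
    have Xsub: "x \<subseteq> carrier G" if "x \<in> X" for x
      using that rcosets_carrier[OF G] unfolding X_def by auto
    have Xg: "x #> g \<in> X" if x: "x \<in> X" "g \<in> carrier G" for x g
    proof -
      obtain a where a: "a \<in> carrier G" "x = H i #> a" using x unfolding X_def RCOSETS_def by auto
      then have "x #> g = H i #> (a \<otimes> g)" using that coset_mult_assoc[OF subset] by simp
      then show ?thesis using a that unfolding X_def RCOSETS_def by auto
    qed
    define D where "D = {x \<in> X. \<exists>g\<in>E. x #> g = x}"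
    have cD: "real (card D) \<le> e / 2 * real (card X)"
    proof -
      have "D = (\<Union>g\<in>E. {x \<in> X. x #> g = x})" unfolding D_def by auto
      then have "card D \<le> (\<Sum>g\<in>E. card {x \<in> X. x #> g = x})" using card_UN_le[OF E(1)] by auto
      then have "real (card D) \<le> (\<Sum>g\<in>E. real (card {x \<in> X. x #> g = x}))"
        unfolding of_nat_sum[symmetric] by (rule of_nat_mono)
      also have "\<dots> = (\<Sum>g\<in>E. real (card {x \<in> X. x #> g = x}) / real (card X)) * real (card X)"
        using N by (simp add: sum_distrib_right)
      also have "\<dots> \<le> e / 2 * real (card X)"
        using small N unfolding X_def by (intro mult_right_mono) auto
      finally show ?thesis .
    qed
    have inj: "a = b" if "x \<in> X - D" "a \<in> W" "b \<in> W" "x #> a = x #> b" for x a b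
    proof (rule ccontr)
      assume "a \<noteq> b"
      have ab: "a \<in> carrier G" "b \<in> carrier G" using that W by auto
      have "a \<otimes> inv b \<noteq> \<one>"
      proof
        assume "a \<otimes> inv b = \<one>"
        then have "a = inv (inv b)" using ab by (metis inv_closed inv_equality inv_inv)
        then show False using ab \<open>a \<noteq> b\<close> by simp
      qed
      then have "a \<otimes> inv b \<in> E" unfolding E_def using that by auto
      moreover have "x #> (a \<otimes> inv b) = x"
      proof -
        have xs: "x \<subseteq> carrier G" using Xsub that by auto
        have "x #> (a \<otimes> inv b) = (x #> a) #> inv b" using coset_mult_assoc[OF xs] ab by simp
        also have "\<dots> = x #> (b \<otimes> inv b)" using coset_mult_assoc[OF xs] ab that by simp
        finally show ?thesis using xs ab by (simp add: coset_mult_one)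
      qed
      ultimately show False using that unfolding D_def by auto
    qed
    define f where "f p x = (SOME g. g \<in> F \<and> (\<forall>g'\<in>F. p (x #> g) \<le> p (x #> g')))" for p :: "'a set \<Rightarrow> nat" and x
    have f: "f p x \<in> F \<and> (\<forall>g'\<in>F. p (x #> f p x) \<le> p (x #> g'))" for p x
      unfolding f_def
    proof (rule someI_ex)
      show "\<exists>g. g \<in> F \<and> (\<forall>g'\<in>F. p (x #> g) \<le> p (x #> g'))"
        using ex_min_on[OF F(1,2), of "\<lambda>g. p (x #> g)"] by blast
    qed
    define B where "B p s = {x \<in> X - D. f p x \<noteq> s \<otimes> f p (x #> s)}" for p s
    have key: "real (card {p \<in> orderings X. x \<in> B p s}) \<le> 2 * e1 * real (card (orderings X))"
      if x: "x \<in> X - D" and s: "s \<in> S" for x s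
    proof -
      \<comment> \<open>\<open>U\<close> is the union of \<open>x F\<close> and
        \<open>x s F\<close>, and \<open>A\<close> is their symmetric difference. The minimum of a
        random order over \<open>U\<close> falls in \<open>A\<close> with probability
        \<open>card A / card U\<close>, which is at most \<open>2 * e1\<close> because
        \<open>card U \<ge> card F\<close>.\<close>
      define U where "U = (\<lambda>g. x #> g) ` (F \<union> (s <#\<^bsub>G\<^esub> F))"
      define A where "A = (\<lambda>g. x #> g) ` ((F - (s <#\<^bsub>G\<^esub> F)) \<union> ((s <#\<^bsub>G\<^esub> F) - F))"
      have xs: "x \<subseteq> carrier G" using Xsub x by auto
      have sc: "s \<in> carrier G" using s S by auto
      have FW: "F \<union> (s <#\<^bsub>G\<^esub> F) \<subseteq> W" unfolding W_def using s by auto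
      have U: "U \<subseteq> X" "U \<noteq> {}" "A \<subseteq> U" unfolding U_def A_def using Xg x W FW F by auto
      have iU: "inj_on (\<lambda>g. x #> g) W" using inj[OF x] by (auto simp: inj_on_def)
      have cU: "card F \<le> card U"
        unfolding U_def using card_image[OF inj_on_subset[OF iU FW]] F lF by (simp add: card_mono)
      have cA: "real (card A) \<le> 2 * e1 * real (card F)"
      proof -
        have fin: "finite F" "finite (s <#\<^bsub>G\<^esub> F)" using F lF by auto
        have "card F = card (F \<inter> (s <#\<^bsub>G\<^esub> F)) + card (F - (s <#\<^bsub>G\<^esub> F))"
          using fin by (metis card_Int_Diff)
        moreover have "card (s <#\<^bsub>G\<^esub> F) = card ((s <#\<^bsub>G\<^esub> F) \<inter> F) + card ((s <#\<^bsub>G\<^esub> F) - F)"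
          using fin by (metis card_Int_Diff)
        ultimately have eq: "card (F - (s <#\<^bsub>G\<^esub> F)) = card ((s <#\<^bsub>G\<^esub> F) - F)"
          using card_lF[OF s] by (simp add: Int_commute)
        have "card A \<le> card ((F - (s <#\<^bsub>G\<^esub> F)) \<union> ((s <#\<^bsub>G\<^esub> F) - F))"
          unfolding A_def by (rule card_image_le) (use fin in auto)
        also have "\<dots> \<le> card (F - (s <#\<^bsub>G\<^esub> F)) + card ((s <#\<^bsub>G\<^esub> F) - F)" by (rule card_Un_le)
        finally have "card A \<le> 2 * card ((s <#\<^bsub>G\<^esub> F) - F)" using eq by simp
        then show ?thesis using F(4)[OF s] by linarith
      qed
      \<comment> \<open>If the minimum is at \<open>x #> w\<close> with \<open>w\<close> in both
        \<open>F\<close> and \<open>s F\<close>, both selections must hit it: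
        \<open>f p x = w\<close> and \<open>s \<otimes> f p (x #> s) = w\<close>. A mismatch thus
        forces the minimum into \<open>A\<close>.\<close>
      have "{p \<in> orderings X. x \<in> B p s} \<subseteq> {p \<in> orderings X. \<exists>u\<in>A. \<forall>w\<in>U. p u \<le> p w}"
      proof (clarify)
        fix p assume p: "p \<in> orderings X" and xB: "x \<in> B p s"
        have pinj: "inj_on p X" using orderings_inj[OF p] .
        have "finite U" using U X finite_subset by auto
        then obtain u where u: "u \<in> U" "\<forall>w\<in>U. p u \<le> p w"
          using ex_min_on[of U p] U by blast
        obtain w where w: "w \<in> F \<union> (s <#\<^bsub>G\<^esub> F)" "u = x #> w" using u unfolding U_def by auto
        have "\<not> (w \<in> F \<and> w \<in> s <#\<^bsub>G\<^esub> F)"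
        proof
          assume a: "w \<in> F \<and> w \<in> s <#\<^bsub>G\<^esub> F"
          then obtain w' where w': "w' \<in> F" "w = s \<otimes> w'" by (auto simp: l_coset_def)
          define g where "g = f p x"
          define g' where "g' = f p (x #> s)"
          have g: "g \<in> F" "p (x #> g) \<le> p (x #> w)" using f[of p x] a unfolding g_def by auto
          have g': "g' \<in> F" "p ((x #> s) #> g') \<le> p ((x #> s) #> w')"
            using f[of p "x #> s"] w' unfolding g'_def by auto
          have sg': "s \<otimes> g' \<in> s <#\<^bsub>G\<^esub> F" using g' by (auto simp: l_coset_def)
          have "(x #> s) #> g' = x #> (s \<otimes> g')" "(x #> s) #> w' = x #> w"
            using coset_mult_assoc[OF xs sc] g' w' F(3) by auto
          then have le': "p (x #> (s \<otimes> g')) \<le> p (x #> w)" using g' by simp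
          have "x #> g \<in> U" "x #> (s \<otimes> g') \<in> U" unfolding U_def using g sg' by auto
          then have "p (x #> g) = p (x #> w)" "p (x #> (s \<otimes> g')) = p (x #> w)"
            "x #> g \<in> X" "x #> (s \<otimes> g') \<in> X" "x #> w \<in> X"
            using u w g le' U by (auto intro: le_antisym)
          then have "x #> g = x #> w" "x #> (s \<otimes> g') = x #> w"
            using pinj by (auto simp: inj_on_def)
          then have "g = w" "s \<otimes> g' = w" using inj[OF x] g sg' w FW by blast+
          then show False using xB unfolding B_def g_def g'_def by auto
        qed
        then have "u \<in> A" using w unfolding A_def by auto
        then show "\<exists>u\<in>A. \<forall>w\<in>U. p u \<le> p w" using u by auto
      qed
      then have "card {p \<in> orderings X. x \<in> B p s} \<le> card {p \<in> orderings X. \<exists>u\<in>A. \<forall>w\<in>U. p u \<le> p w}"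
        using finite_orderings[OF X] by (intro card_mono) auto
      then have "card {p \<in> orderings X. x \<in> B p s} * card F \<le> card {p \<in> orderings X. \<exists>u\<in>A. \<forall>w\<in>U. p u \<le> p w} * card U"
        using cU by (intro mult_le_mono) auto
      also have "\<dots> = card A * card (orderings X)" using card_orderings_min[OF X U] .
      finally have "real (card {p \<in> orderings X. x \<in> B p s}) * real (card F) \<le> real (card A) * real (card (orderings X))"
        by (simp only: of_nat_mult[symmetric] of_nat_le_iff)
      also have "\<dots> \<le> (2 * e1 * real (card F)) * real (card (orderings X))"
        using cA by (intro mult_right_mono) auto
      finally have "real (card {p \<in> orderings X. x \<in> B p s}) * real (card F) \<le> (2 * e1 * real (card (orderings X))) * real (card F)"
        by (simp add: mult_ac)
      moreover have "real (card F) > 0" using F by (simp add: card_gt_0_iff)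
      ultimately show ?thesis by (simp only: mult_le_cancel_right_pos)
    qed
    have finO: "finite (orderings X)" using finite_orderings[OF X] .
    have finB: "finite (B p s)" for p s unfolding B_def using X by auto
    have "(\<Sum>p\<in>orderings X. \<Sum>s\<in>S. real (card (B p s))) \<le> real (card (orderings X)) * (e / 2 * real (card X))"
    proof -
      have cB: "real (card (B p s)) = (\<Sum>x\<in>X - D. if x \<in> B p s then 1 else 0)" for p s
      proof -
        have "(X - D) \<inter> {x. x \<in> B p s} = B p s" unfolding B_def by auto
        then show ?thesis using X by (simp add: sum.If_cases)
      qed
      have "(\<Sum>p\<in>orderings X. \<Sum>s\<in>S. real (card (B p s)))
        = (\<Sum>s\<in>S. \<Sum>x\<in>X - D. \<Sum>p\<in>orderings X. if x \<in> B p s then 1 else 0)"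
        unfolding cB by (subst sum.swap) (intro sum.cong refl sum.swap)
      also have "\<dots> = (\<Sum>s\<in>S. \<Sum>x\<in>X - D. real (card {p \<in> orderings X. x \<in> B p s}))"
        using finO by (simp add: sum.If_cases Int_def)
      also have "\<dots> \<le> (\<Sum>s\<in>S. \<Sum>x\<in>X - D. 2 * e1 * real (card (orderings X)))"
        by (intro sum_mono key) auto
      also have "\<dots> = real (card S) * real (card (X - D)) * (2 * e1 * real (card (orderings X)))"
        by simp
      also have "\<dots> \<le> real (card S) * real (card X) * (2 * e1 * real (card (orderings X)))"
        using e1 X by (intro mult_right_mono mult_left_mono) (auto intro: card_mono)
      also have "\<dots> = (real (card S) * (2 * e1)) * (real (card X) * real (card (orderings X)))" by simp
      also have "\<dots> \<le> (e / 2) * (real (card X) * real (card (orderings X)))"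
      proof (intro mult_right_mono)
        show "real (card S) * (2 * e1) \<le> e / 2" unfolding e1_def using e by (simp add: field_simps)
      qed auto
      finally show ?thesis by (simp add: mult_ac)
    qed
    \<comment> \<open>First moment argument: the average over all orders satisfies the bound, hence
      so does some order.\<close>
    then have "\<exists>p\<in>orderings X. (\<Sum>s\<in>S. real (card (B p s))) \<le> e / 2 * real (card X)"
      using finO orderings_nonempty[OF X] sum_bounded_below[of "orderings X" "e / 2 * real (card X)" "\<lambda>p. \<Sum>s\<in>S. real (card (B p s))"]
      sum_strict_mono[of "orderings X" "\<lambda>_. e / 2 * real (card X)" "\<lambda>p. \<Sum>s\<in>S. real (card (B p s))"]
      by (force simp: not_le)
    then obtain p where p: "(\<Sum>s\<in>S. real (card (B p s))) \<le> e / 2 * real (card X)" by auto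
    have "{x \<in> X. \<exists>s\<in>S. f p x \<noteq> s \<otimes> f p (x #> s)} \<subseteq> D \<union> (\<Union>s\<in>S. B p s)"
      unfolding B_def by auto
    then have "card {x \<in> X. \<exists>s\<in>S. f p x \<noteq> s \<otimes> f p (x #> s)} \<le> card (D \<union> (\<Union>s\<in>S. B p s))"
      by (intro card_mono) (use X S finB in \<open>auto simp: D_def\<close>)
    also have "\<dots> \<le> card D + (\<Sum>s\<in>S. card (B p s))"
      using card_Un_le[of D "\<Union>s\<in>S. B p s"] card_UN_le[OF S(1), of "B p"] by linarith
    finally have "real (card {x \<in> X. \<exists>s\<in>S. f p x \<noteq> s \<otimes> f p (x #> s)}) \<le> real (card D) + (\<Sum>s\<in>S. real (card (B p s)))"
      by (simp only: of_nat_sum[symmetric] of_nat_add[symmetric] of_nat_le_iff)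
    also have "\<dots> \<le> e * real (card X)" using cD p by (simp add: field_simps)
    finally have "real (card {x \<in> X. \<exists>s\<in>S. f p x \<noteq> s \<otimes> f p (x #> s)}) \<le> e * real (card X)" .
    moreover have "f p \<in> X \<rightarrow> carrier G" using f F(3) by blast
    ultimately show "\<exists>f \<in> rcosets (H i) \<rightarrow> carrier G.
       real (card {x \<in> rcosets (H i). \<exists>s\<in>S. f x \<noteq> s \<otimes> f (x #> s)}) \<le> e * real (card (rcosets (H i)))"
      unfolding X_def by blast
  qed
qed

section \<open>Torsion of lattice quotients\<close>

definition frag_norm :: "('a \<Rightarrow>\<^sub>0 int) \<Rightarrow> int" where
  "frag_norm c = (\<Sum>k\<in>Poly_Mapping.keys c. \<bar>Poly_Mapping.lookup c k\<bar>)"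

definition frag_span :: "'i set \<Rightarrow> ('i \<Rightarrow> 'a \<Rightarrow>\<^sub>0 int) \<Rightarrow> ('a \<Rightarrow>\<^sub>0 int) set" where
  "frag_span B v = {\<Sum>i\<in>B. frag_cmul (m i) (v i) | m. True}"

text \<open>The saturation of \<open>V\<close> in the free abelian group: for a subgroup
  \<open>V\<close>, the elements whose classes modulo \<open>V\<close> are torsion.\<close>

definition frag_sat :: "('a \<Rightarrow>\<^sub>0 int) set \<Rightarrow> ('a \<Rightarrow>\<^sub>0 int) set" where
  "frag_sat V = {x. \<exists>k. k \<noteq> 0 \<and> frag_cmul k x \<in> V}"

lemma frag_span_add: "x \<in> frag_span B v \<Longrightarrow> y \<in> frag_span B v \<Longrightarrow> x + y \<in> frag_span B v"
proof -
  assume "x \<in> frag_span B v" "y \<in> frag_span B v"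
  then obtain m n where "x = (\<Sum>i\<in>B. frag_cmul (m i) (v i))" "y = (\<Sum>i\<in>B. frag_cmul (n i) (v i))"
    unfolding frag_span_def by auto
  then have "x + y = (\<Sum>i\<in>B. frag_cmul (m i + n i) (v i))"
    by (simp add: sum.distrib frag_cmul_distrib)
  then show ?thesis unfolding frag_span_def by (auto intro: exI[of _ "\<lambda>i. m i + n i"])
qed

lemma frag_cmul_sum': "frag_cmul k (sum f I) = (\<Sum>i\<in>I. frag_cmul k (f i))"
  by (induction I rule: infinite_finite_induct) (auto simp: frag_cmul_distrib2)

lemma frag_span_cmul: "x \<in> frag_span B v \<Longrightarrow> frag_cmul k x \<in> frag_span B v"
proof -
  assume "x \<in> frag_span B v"
  then obtain m where "x = (\<Sum>i\<in>B. frag_cmul (m i) (v i))" unfolding frag_span_def by auto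
  then have "frag_cmul k x = (\<Sum>i\<in>B. frag_cmul (k * m i) (v i))" by (simp add: frag_cmul_sum')
  then show ?thesis unfolding frag_span_def by (auto intro: exI[of _ "\<lambda>i. k * m i"])
qed

lemma frag_span_0: "0 \<in> frag_span B v"
  unfolding frag_span_def by (auto intro!: exI[of _ "\<lambda>_. 0"])

lemma frag_span_diff: "x \<in> frag_span B v \<Longrightarrow> y \<in> frag_span B v \<Longrightarrow> x - y \<in> frag_span B v"
  using frag_span_add[of x B v "- y"] frag_span_cmul[of y B v "-1"] by simp

lemma frag_span_mono:
  assumes "finite B" "A \<subseteq> B" shows "frag_span A v \<subseteq> frag_span B v"
proof
  fix x assume "x \<in> frag_span A v"
  then obtain m where m: "x = (\<Sum>i\<in>A. frag_cmul (m i) (v i))" unfolding frag_span_def by auto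
  have "x = (\<Sum>i\<in>B. frag_cmul (if i \<in> A then m i else 0) (v i))"
    unfolding m by (rule sum.mono_neutral_cong_left) (use assms in auto)
  then show "x \<in> frag_span B v" unfolding frag_span_def
    by (intro CollectI exI[of _ "\<lambda>i. if i \<in> A then m i else 0"]) simp
qed

lemma frag_span_insert:
  assumes "finite B" "b \<notin> B" "x \<in> frag_span (insert b B) v"
  obtains w k where "w \<in> frag_span B v" "x = w + frag_cmul k (v b)"
proof -
  obtain m where "x = (\<Sum>i\<in>insert b B. frag_cmul (m i) (v i))" using assms unfolding frag_span_def by auto
  then have "x = (\<Sum>i\<in>B. frag_cmul (m i) (v i)) + frag_cmul (m b) (v b)"
    using assms by (simp add: add.commute)
  then show ?thesis using that unfolding frag_span_def by blast
qed

lemma frag_cmul_eq_0: "frag_cmul k x = 0 \<longleftrightarrow> k = 0 \<or> x = 0"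
  by (auto simp: poly_mapping_eq_iff fun_eq_iff)

lemma frag_cmul_right_diff: "frag_cmul k (x - y) = frag_cmul k x - frag_cmul k y"
  and frag_cmul_left_diff: "frag_cmul (k - l) x = frag_cmul k x - frag_cmul l x"
  by (simp_all add: poly_mapping_eq_iff fun_eq_iff lookup_minus algebra_simps)

lemma frag_sat_diff: "x \<in> frag_sat (frag_span B v) \<Longrightarrow> y \<in> frag_sat (frag_span B v) \<Longrightarrow> x - y \<in> frag_sat (frag_span B v)"
proof -
  assume "x \<in> frag_sat (frag_span B v)" "y \<in> frag_sat (frag_span B v)"
  then obtain k l where kl: "k \<noteq> 0" "l \<noteq> 0" "frag_cmul k x \<in> frag_span B v" "frag_cmul l y \<in> frag_span B v"
    unfolding frag_sat_def by auto
  have "frag_cmul (k * l) (x - y) = frag_cmul l (frag_cmul k x) - frag_cmul k (frag_cmul l y)"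
    by (simp add: frag_cmul_right_diff mult.commute)
  also have "\<dots> \<in> frag_span B v" by (intro frag_span_diff frag_span_cmul kl)
  finally have "frag_cmul (k * l) (x - y) \<in> frag_span B v" .
  then show ?thesis unfolding frag_sat_def using kl by (intro CollectI exI[of _ "k*l"]) auto
qed

text \<open>Gaussian elimination: a maximal independent subfamily, and as many coordinates that
  separate the rational span.\<close>

lemma independent_coordinates:
  fixes v :: "'i \<Rightarrow> 'a \<Rightarrow>\<^sub>0 int"
  assumes "finite B"
  obtains B' I where "B' \<subseteq> B" "finite I" "card I = card B'"
    "\<And>m. (\<Sum>i\<in>B'. frag_cmul (m i) (v i)) = 0 \<Longrightarrow> \<forall>i\<in>B'. m i = 0"
    "\<And>x. x \<in> frag_sat (frag_span B v) \<Longrightarrow> \<forall>k\<in>I. Poly_Mapping.lookup x k = 0 \<Longrightarrow> x = 0"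
  using assms
proof (induction B arbitrary: thesis rule: finite_induct)
  case empty
  show ?case
    by (rule empty(1)[of "{}" "{}"]) (auto simp: frag_sat_def frag_span_def frag_cmul_eq_0)
next
  case (insert b B)
  obtain B' I where IH: "B' \<subseteq> B" "finite I" "card I = card B'"
    "\<And>m. (\<Sum>i\<in>B'. frag_cmul (m i) (v i)) = 0 \<Longrightarrow> \<forall>i\<in>B'. m i = 0"
    "\<And>x. x \<in> frag_sat (frag_span B v) \<Longrightarrow> \<forall>k\<in>I. Poly_Mapping.lookup x k = 0 \<Longrightarrow> x = 0"
    by (rule insert.IH) (rule that)
  show ?case
  proof (cases "\<exists>x\<in>frag_sat (frag_span (insert b B) v). (\<forall>k\<in>I. Poly_Mapping.lookup x k = 0) \<and> x \<noteq> 0")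
    case False
    show ?thesis
      by (rule insert.prems(1)[of B' I]) (use IH False in auto)
  next
    case True
    then obtain x where x: "x \<in> frag_sat (frag_span (insert b B) v)"
      "\<forall>k\<in>I. Poly_Mapping.lookup x k = 0" "x \<noteq> 0" by auto
    \<comment> \<open>\<open>x\<close> shows that \<open>v b\<close> enlarges the rational span; any
      coordinate \<open>j\<close> at which \<open>x\<close> is nonzero serves as the new
      pivot.\<close>
    obtain j where j: "Poly_Mapping.lookup x j \<noteq> 0"
      using x(3) by (auto simp: poly_mapping_eq_iff fun_eq_iff)
    have jI: "j \<notin> I" using x j by auto
    have finB': "finite B'" using IH(1) insert.hyps finite_subset by auto
    have bB': "b \<notin> B'" using IH insert.hyps by auto
    obtain k1 where k1: "k1 \<noteq> 0" "frag_cmul k1 x \<in> frag_span (insert b B) v" using x unfolding frag_sat_def by auto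
    obtain w \<alpha> where w: "w \<in> frag_span B v" "frag_cmul k1 x = w + frag_cmul \<alpha> (v b)"
      using frag_span_insert[OF insert.hyps k1(2)] .
    have al: "\<alpha> \<noteq> 0"
    proof
      assume "\<alpha> = 0"
      then have "x \<in> frag_sat (frag_span B v)" using w k1 unfolding frag_sat_def by auto
      then show False using IH(5) x by auto
    qed
    show ?thesis
    proof (rule insert.prems(1)[of "insert b B'" "insert j I"])
      show "insert b B' \<subseteq> insert b B" using IH by auto
      show "finite (insert j I)" using IH by auto
      show "card (insert j I) = card (insert b B')" using IH jI bB' finB' by simp
      show "\<forall>i\<in>insert b B'. m i = 0" if m: "(\<Sum>i\<in>insert b B'. frag_cmul (m i) (v i)) = 0" for m
      proof -
        let ?u = "\<Sum>i\<in>B'. frag_cmul (m i) (v i)"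
        have m': "frag_cmul (m b) (v b) = - ?u" using m finB' bB' by (simp add: add_eq_0_iff2)
        have "m b = 0"
        proof (rule ccontr)
          assume mb: "m b \<noteq> 0"
          have u: "?u \<in> frag_span B v"
            using frag_span_mono[OF insert.hyps(1) IH(1)] unfolding frag_span_def by blast
          have "frag_cmul (m b * k1) x = frag_cmul (m b) w + frag_cmul \<alpha> (frag_cmul (m b) (v b))"
            using w(2) by (metis (no_types, opaque_lifting) frag_cmul_cmul frag_cmul_distrib2 mult.commute)
          also have "\<dots> = frag_cmul (m b) w + frag_cmul (- \<alpha>) ?u"
            unfolding m' by (simp add: poly_mapping_eq_iff fun_eq_iff lookup_add)
          also have "\<dots> \<in> frag_span B v" by (intro frag_span_add frag_span_cmul w u)
          finally have "x \<in> frag_sat (frag_span B v)" unfolding frag_sat_def using mb k1 by (intro CollectI exI[of _ "m b * k1"]) auto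
          then show False using IH(5) x by auto
        qed
        moreover from this have "?u = 0" using m' by simp
        ultimately show ?thesis using IH(4) by auto
      qed
      show "y = 0" if y: "y \<in> frag_sat (frag_span (insert b B) v)" "\<forall>k\<in>insert j I. Poly_Mapping.lookup y k = 0" for y
      proof -
        obtain k2 where k2: "k2 \<noteq> 0" "frag_cmul k2 y \<in> frag_span (insert b B) v" using y unfolding frag_sat_def by auto
        obtain w' \<beta> where w': "w' \<in> frag_span B v" "frag_cmul k2 y = w' + frag_cmul \<beta> (v b)"
          using frag_span_insert[OF insert.hyps k2(2)] .
        \<comment> \<open>Elimination of \<open>v b\<close> between multiples of \<open>x\<close>
          and \<open>y\<close>: \<open>z\<close> lies in the old span and vanishes on
          \<open>I\<close>, so it is 0. At \<open>j\<close>, where \<open>y\<close> vanishes and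
          \<open>x\<close> does not, this forces \<open>\<beta> = 0\<close>, and then
          \<open>y = 0\<close>.\<close>
        define z where "z = frag_cmul (\<alpha> * k2) y - frag_cmul (\<beta> * k1) x"
        have "z = frag_cmul \<alpha> (frag_cmul k2 y) - frag_cmul \<beta> (frag_cmul k1 x)" unfolding z_def by simp
        also have "\<dots> = frag_cmul \<alpha> w' - frag_cmul \<beta> w"
          unfolding w w' by (simp add: frag_cmul_distrib2 mult.commute)
        also have "\<dots> \<in> frag_span B v" by (intro frag_span_diff frag_span_cmul w w')
        finally have "z \<in> frag_sat (frag_span B v)" unfolding frag_sat_def by (intro CollectI exI[of _ 1]) auto
        moreover have "\<forall>k\<in>I. Poly_Mapping.lookup z k = 0" unfolding z_def using x y by (simp add: lookup_minus)
        ultimately have z0: "z = 0" using IH(5) by auto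
        then have "Poly_Mapping.lookup z j = 0" by simp
        then have "\<beta> * k1 * Poly_Mapping.lookup x j = 0" unfolding z_def using y by (simp add: lookup_minus)
        then have "\<beta> * k1 = 0" using j by auto
        then have "frag_cmul (\<alpha> * k2) y = 0" using z0 unfolding z_def by simp
        then show "y = 0" using al k2 by (simp add: frag_cmul_eq_0)
      qed
    qed
  qed
qed

text \<open>After division by \<open>M ^ card I\<close> the additive constant \<open>C\<close>
  contributes only \<open>C / M\<close> to each factor and disappears in the limit, leaving a pure
  comparison of volumes.\<close>

lemma linear_power_bound:
  fixes T C :: real and S :: "'k \<Rightarrow> real"
  assumes "finite I" "\<And>M::nat. M \<ge> 1 \<Longrightarrow> T * real M ^ card I \<le> (\<Prod>k\<in>I. S k * real M + C)"
  shows "T \<le> (\<Prod>k\<in>I. S k)"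
proof -
  have "(\<lambda>M. \<Prod>k\<in>I. (S k + C / real M)) \<longlonglongrightarrow> (\<Prod>k\<in>I. S k + 0)"
    by (intro tendsto_prod tendsto_add tendsto_const lim_const_over_n)
  moreover have "\<forall>\<^sub>F M in sequentially. T \<le> (\<Prod>k\<in>I. (S k + C / real M))"
  proof (rule eventually_sequentiallyI[of 1])
    fix M :: nat assume M: "M \<ge> 1"
    have "(\<Prod>k\<in>I. S k * real M + C) = (\<Prod>k\<in>I. (S k + C / real M) * real M)"
      by (rule prod.cong) (use M in \<open>auto simp: field_simps\<close>)
    also have "\<dots> = (\<Prod>k\<in>I. (S k + C / real M)) * real M ^ card I"
      by (simp add: prod.distrib)
    finally have "T * real M ^ card I \<le> (\<Prod>k\<in>I. (S k + C / real M)) * real M ^ card I"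
      using assms(2)[OF M] by simp
    then show "T \<le> (\<Prod>k\<in>I. (S k + C / real M))" using M by simp
  qed
  ultimately show ?thesis using tendsto_lowerbound[of _ _ sequentially T] by fastforce
qed

text \<open>By AM-GM and \<open>ln x \<le> x - 1\<close>.\<close>

lemma prod_le_exp_bound:
  fixes S :: "'k \<Rightarrow> real"
  assumes "finite I" "card I \<le> b" "\<And>k. k \<in> I \<Longrightarrow> 0 \<le> S k" "(\<Sum>k\<in>I. S k) \<le> c * real b" "c \<ge> 1"
  shows "(\<Prod>k\<in>I. S k) \<le> (c * exp 1) ^ b"
proof -
  \<comment> \<open>A tangent bound normalized so that equality holds at \<open>x = c\<close>.
    Multiplied over \<open>I\<close>, it converts the bound on the sum of the \<open>S k\<close>
    into one on their product; \<open>c \<ge> 1\<close> allows the exponent to grow from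
    \<open>card I\<close> to \<open>b\<close>.\<close>
  have le: "x \<le> c * exp (x / c - 1)" for x :: real
  proof -
    have "x / c \<le> exp (x / c - 1)" using exp_ge_add_one_self[of "x / c - 1"] by simp
    then show ?thesis using \<open>c \<ge> 1\<close> by (simp add: field_simps)
  qed
  have "(\<Prod>k\<in>I. S k) \<le> (\<Prod>k\<in>I. c * exp (S k / c - 1))"
    by (rule prod_mono) (use assms le in auto)
  also have "\<dots> = c ^ card I * exp (\<Sum>k\<in>I. S k / c - 1)"
    using assms(1) by (simp add: prod.distrib exp_sum)
  also have "(\<Sum>k\<in>I. S k / c - 1) = (\<Sum>k\<in>I. S k) / c - real (card I)"
    by (simp add: sum_subtractf sum_divide_distrib)
  also have "c ^ card I * exp ((\<Sum>k\<in>I. S k) / c - real (card I)) \<le> c ^ b * exp (real b)"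
  proof (rule mult_mono)
    show "c ^ card I \<le> c ^ b" using assms by (intro power_increasing) auto
    have "(\<Sum>k\<in>I. S k) / c \<le> real b" using assms by (simp add: field_simps)
    then show "exp ((\<Sum>k\<in>I. S k) / c - real (card I)) \<le> exp (real b)" by simp
  qed (use assms in auto)
  also have "\<dots> = (c * exp 1) ^ b" by (simp add: power_mult_distrib exp_of_nat_mult[symmetric])
  finally show ?thesis .
qed

lemma frag_norm_ge: "finite I \<Longrightarrow> (\<Sum>k\<in>I. \<bar>Poly_Mapping.lookup c k\<bar>) \<le> frag_norm c"
proof -
  assume I: "finite I"
  have "(\<Sum>k\<in>I. \<bar>Poly_Mapping.lookup c k\<bar>) = (\<Sum>k\<in>I \<inter> Poly_Mapping.keys c. \<bar>Poly_Mapping.lookup c k\<bar>)"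
    by (rule sum.mono_neutral_right) (use I in \<open>auto simp: in_keys_iff\<close>)
  also have "\<dots> \<le> frag_norm c"
    unfolding frag_norm_def by (rule sum_mono2) auto
  finally show ?thesis .
qed

text \<open>Lattice points \<open>t + (\<Sum>i. m i * v i)\<close> with \<open>0 \<le> m i < M\<close> are distinct and lie in a box
  whose size is governed by the coordinates of the \<open>v i\<close>; compare volumes as \<open>M \<longlongrightarrow> \<infinity>\<close>.\<close>

lemma card_torsion_classes_le:
  fixes v :: "'i \<Rightarrow> 'a \<Rightarrow>\<^sub>0 int" and c :: real
  assumes B: "finite B" and c: "c \<ge> 1" "\<And>i. i \<in> B \<Longrightarrow> real_of_int (frag_norm (v i)) \<le> c"
    and T: "finite T" "T \<subseteq> frag_sat (frag_span B v)"
    and distinct: "\<And>x y. x \<in> T \<Longrightarrow> y \<in> T \<Longrightarrow> x - y \<in> frag_span B v \<Longrightarrow> x = y"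
  shows "real (card T) \<le> (2 * c * exp 1) ^ card B"
proof -
  obtain B' I where BI: "B' \<subseteq> B" "finite I" "card I = card B'"
    and indep: "\<And>m. (\<Sum>i\<in>B'. frag_cmul (m i) (v i)) = 0 \<Longrightarrow> \<forall>i\<in>B'. m i = 0"
    and sep: "\<And>x. x \<in> frag_sat (frag_span B v) \<Longrightarrow> \<forall>k\<in>I. Poly_Mapping.lookup x k = 0 \<Longrightarrow> x = 0"
    by (rule independent_coordinates[OF B, of v]) (rule that)
  have finB': "finite B'" using BI B finite_subset by auto
  define S where "S k = (\<Sum>i\<in>B'. \<bar>Poly_Mapping.lookup (v i) k\<bar>)" for k
  \<comment> \<open>\<open>C - 1\<close> dominates twice each coordinate of every element of
    \<open>T\<close>. Enlarging an interval by \<open>(C - 1) div 2\<close> at both ends thus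
    absorbs the shift by \<open>t\<close>, and the number of integers in \<open>Q\<close> at
    coordinate \<open>k\<close> stays at most \<open>2 * S k * M + C\<close>.\<close>
  define C where "C = 1 + (\<Sum>t\<in>T. 2 * frag_norm t)"
  have Ct: "2 * \<bar>Poly_Mapping.lookup t k\<bar> + 1 \<le> C" if "t \<in> T" for t k
  proof -
    have n0: "0 \<le> frag_norm t" for t unfolding frag_norm_def by (simp add: sum_nonneg)
    have "\<bar>Poly_Mapping.lookup t k\<bar> \<le> frag_norm t" using frag_norm_ge[of "{k}" t] by simp
    also have "2 * frag_norm t \<le> (\<Sum>t\<in>T. 2 * frag_norm t)"
      using sum_mono2[of T "{t}" "\<lambda>t. 2 * frag_norm t"] T that n0 by auto
    finally show ?thesis unfolding C_def by simp
  qed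
  have box: "real (card T) * real M ^ card I \<le> (\<Prod>k\<in>I. real_of_int (S k) * 2 * real M + real_of_int C)"
    if M: "M \<ge> 1" for M :: nat
  proof -
    define P where "P = T \<times> (B' \<rightarrow>\<^sub>E {..<M})"
    define \<xi> where "\<xi> = (\<lambda>(t, m). t + (\<Sum>i\<in>B'. frag_cmul (int (m i)) (v i)))"
    define Q where "Q = (\<Pi>\<^sub>E k\<in>I. {- (S k * int M) - (C - 1) div 2 .. S k * int M + (C - 1) div 2})"
    define \<pi> where "\<pi> = (\<lambda>p. restrict (Poly_Mapping.lookup (\<xi> p)) I)"
    have in_span: "(\<Sum>i\<in>B'. frag_cmul (m i) (v i)) \<in> frag_span B v" for m
      using frag_span_mono[OF B BI(1)] unfolding frag_span_def by blast
    have sat: "\<xi> p \<in> frag_sat (frag_span B v)" if p: "p \<in> P" for p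
    proof -
      obtain t m where tm: "p = (t, m)" by (cases p)
      then obtain k where k: "k \<noteq> 0" "frag_cmul k t \<in> frag_span B v" using p T unfolding P_def frag_sat_def by auto
      have "frag_cmul k (\<xi> p) = frag_cmul k t + frag_cmul k (\<Sum>i\<in>B'. frag_cmul (int (m i)) (v i))"
        unfolding \<xi>_def tm by (simp add: frag_cmul_distrib2)
      also have "\<dots> \<in> frag_span B v" by (intro frag_span_add k(2) frag_span_cmul in_span)
      finally show ?thesis using k unfolding frag_sat_def by blast
    qed
    \<comment> \<open>Equal coordinates on \<open>I\<close> make the difference vanish. Then
      \<open>t\<close> and \<open>t'\<close> agree modulo the span, hence are equal, and
      independence of the vectors yields \<open>m = m'\<close>.\<close>
    have "inj_on \<pi> P"
    proof (rule inj_onI)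
      fix p q assume p: "p \<in> P" and q: "q \<in> P" and eq: "\<pi> p = \<pi> q"
      have "\<xi> p - \<xi> q = 0"
      proof (rule sep)
        show "\<xi> p - \<xi> q \<in> frag_sat (frag_span B v)" by (intro frag_sat_diff sat p q)
        show "\<forall>k\<in>I. Poly_Mapping.lookup (\<xi> p - \<xi> q) k = 0"
        proof
          fix k assume "k \<in> I"
          then show "Poly_Mapping.lookup (\<xi> p - \<xi> q) k = 0"
            using fun_cong[OF eq, of k] unfolding \<pi>_def by (simp add: lookup_minus)
        qed
      qed
      obtain t m where tm: "p = (t, m)" by (cases p)
      obtain t' m' where tm': "q = (t', m')" by (cases q)
      have eq': "t - t' = (\<Sum>i\<in>B'. frag_cmul (int (m' i) - int (m i)) (v i))"
        using \<open>\<xi> p - \<xi> q = 0\<close> unfolding \<xi>_def tm tm'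
        by (simp add: frag_cmul_left_diff sum_subtractf algebra_simps)
      then have "t - t' \<in> frag_span B v" using in_span[of "\<lambda>i. int (m' i) - int (m i)"] by simp
      then have tt: "t = t'" using distinct p q tm tm' unfolding P_def by auto
      then have "\<forall>i\<in>B'. int (m' i) - int (m i) = 0" using eq' indep[of "\<lambda>i. int (m' i) - int (m i)"] by simp
      then have "m = m'" using p q tm tm' unfolding P_def by (intro PiE_ext[of m B' _ m']) auto
      then show "p = q" using tt tm tm' by simp
    qed
    moreover have "\<pi> ` P \<subseteq> Q"
    proof
      fix z assume "z \<in> \<pi> ` P"
      then obtain t m where tm: "t \<in> T" "m \<in> B' \<rightarrow>\<^sub>E {..<M}" "z = \<pi> (t, m)" unfolding P_def by auto
      show "z \<in> Q"
        unfolding Q_def tm(3) \<pi>_def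
      proof (rule restrict_PiE_iff[THEN iffD2], rule ballI)
        fix k assume k: "k \<in> I"
        have "Poly_Mapping.lookup (\<xi> (t, m)) k = Poly_Mapping.lookup t k + (\<Sum>i\<in>B'. int (m i) * Poly_Mapping.lookup (v i) k)"
          unfolding \<xi>_def by (simp add: lookup_add lookup_sum)
        moreover have "\<bar>\<Sum>i\<in>B'. int (m i) * Poly_Mapping.lookup (v i) k\<bar> \<le> S k * int M"
        proof -
          have "\<bar>\<Sum>i\<in>B'. int (m i) * Poly_Mapping.lookup (v i) k\<bar> \<le> (\<Sum>i\<in>B'. \<bar>int (m i) * Poly_Mapping.lookup (v i) k\<bar>)"
            by (rule sum_abs)
          also have "\<dots> \<le> (\<Sum>i\<in>B'. \<bar>Poly_Mapping.lookup (v i) k\<bar> * int M)"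
          proof (rule sum_mono)
            fix i assume "i \<in> B'"
            then have "m i < M" using tm by auto
            then show "\<bar>int (m i) * Poly_Mapping.lookup (v i) k\<bar> \<le> \<bar>Poly_Mapping.lookup (v i) k\<bar> * int M"
              unfolding abs_mult by (simp add: mult.commute[of _ "int M"] mult_right_mono)
          qed
          also have "\<dots> = S k * int M" unfolding S_def by (simp add: sum_distrib_right)
          finally show ?thesis .
        qed
        ultimately show "Poly_Mapping.lookup (\<xi> (t, m)) k \<in> {- (S k * int M) - (C - 1) div 2 .. S k * int M + (C - 1) div 2}"
          using Ct[OF tm(1), of k] by auto
      qed
    qed
    moreover have finQ: "finite Q" unfolding Q_def using BI by (intro finite_PiE) auto
    ultimately have "card P \<le> card Q" by (metis card_inj_on_le)
    moreover have "card P = card T * M ^ card I"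
      unfolding P_def using BI finB' by (simp add: card_cartesian_product card_PiE)
    moreover have "real (card Q) \<le> (\<Prod>k\<in>I. real_of_int (S k) * 2 * real M + real_of_int C)"
    proof -
      have "real (card Q) = (\<Prod>k\<in>I. real (nat (2 * (S k * int M) + 2 * ((C - 1) div 2) + 1)))"
        unfolding Q_def using BI by (simp add: card_PiE algebra_simps)
      also have "\<dots> \<le> (\<Prod>k\<in>I. real_of_int (S k) * 2 * real M + real_of_int C)"
      proof (rule prod_mono, safe)
        fix k assume "k \<in> I"
        have S0: "0 \<le> S k * int M" unfolding S_def by (simp add: sum_nonneg)
        have C1: "C \<ge> 1" unfolding C_def frag_norm_def by (simp add: sum_nonneg)
        have "real (nat (2 * (S k * int M) + 2 * ((C - 1) div 2) + 1)) = real_of_int (2 * (S k * int M) + 2 * ((C - 1) div 2) + 1)"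
          using S0 C1 by simp
        also have "\<dots> \<le> real_of_int (2 * (S k * int M) + C)" by (subst of_int_le_iff) linarith
        finally show "real (nat (2 * (S k * int M) + 2 * ((C - 1) div 2) + 1)) \<le> real_of_int (S k) * 2 * real M + real_of_int C"
          by simp
      qed auto
      finally show ?thesis .
    qed
    moreover have "real (card T) * real M ^ card I = real (card P)" using calculation(2) by simp
    ultimately show ?thesis by linarith
  qed
  have "real (card T) \<le> (\<Prod>k\<in>I. real_of_int (S k) * 2)"
    by (rule linear_power_bound[OF BI(2)]) (rule box)
  \<comment> \<open>Interchanging sums bounds \<open>\<Sum>k. S k\<close> by the norms of the
    \<open>v i\<close> with \<open>i\<close> in \<open>B'\<close>. The factor 2 reflects that the
    box extends by \<open>S k * M\<close> on both sides of 0.\<close>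
  also have "\<dots> \<le> (2 * c * exp 1) ^ card B"
  proof (rule prod_le_exp_bound)
    show "(\<Sum>k\<in>I. real_of_int (S k) * 2) \<le> 2 * c * real (card B)"
    proof -
      have "(\<Sum>k\<in>I. S k) = (\<Sum>i\<in>B'. \<Sum>k\<in>I. \<bar>Poly_Mapping.lookup (v i) k\<bar>)" unfolding S_def by (rule sum.swap)
      also have "\<dots> \<le> (\<Sum>i\<in>B'. frag_norm (v i))" by (intro sum_mono frag_norm_ge BI)
      finally have "real_of_int (\<Sum>k\<in>I. S k) \<le> (\<Sum>i\<in>B'. real_of_int (frag_norm (v i)))" by (metis of_int_le_iff of_int_sum)
      also have "\<dots> \<le> (\<Sum>i\<in>B'. c)" by (intro sum_mono c) (use BI in auto)
      also have "\<dots> \<le> c * real (card B)" using c(1) BI B by (simp add: card_mono mult.commute)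
      finally show ?thesis by (simp add: sum_distrib_right[symmetric])
    qed
  qed (use BI B c in \<open>auto simp: S_def sum_nonneg card_mono\<close>)
  finally show ?thesis .
qed

section \<open>The action on the realization\<close>

lemma openin_realization_iff:
  "openin (realization K) U \<longleftrightarrow> U \<subseteq> topspace (realization K) \<and>
     (\<forall>s\<in>K. \<exists>W. open W \<and> U \<inter> closed_simplex s = closed_simplex s \<inter> W)"
  unfolding openin_realization realization_open_def topspace_realization
    euclidean_product_topology openin_open by blast

section \<open>Supports, barycenters and open stars\<close>

definition support :: "('v \<Rightarrow> real) \<Rightarrow> 'v set" where
  "support x = {v. x v \<noteq> 0}"

definition barycenter :: "'v set \<Rightarrow> 'v \<Rightarrow> real" where
  "barycenter s = (\<lambda>v. if v \<in> s then 1 / real (card s) else 0)"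

definition vertex :: "'v \<Rightarrow> 'v \<Rightarrow> real" where
  "vertex v = (\<lambda>u. if u = v then 1 else 0)"

text \<open>The open star of the barycenter of \<open>s\<close> in the barycentric subdivision.\<close>

definition open_star :: "'v set set \<Rightarrow> 'v set \<Rightarrow> ('v \<Rightarrow> real) set" where
  "open_star K s = {x \<in> topspace (realization K). \<forall>v\<in>s. 0 < x v \<and> (\<forall>w. w \<notin> s \<longrightarrow> x w < x v)}"

locale simplicial_complex =
  fixes K :: "'v set set"
  assumes asc: "abstract_simplicial_complex K"
begin

abbreviation "P \<equiv> topspace (realization K)"
definition V :: "'v set" where "V = \<Union>K"

lemma simplex_finite: "s \<in> K \<Longrightarrow> finite s" and simplex_nonempty: "s \<in> K \<Longrightarrow> s \<noteq> {}"
  and face_in: "s \<in> K \<Longrightarrow> t \<subseteq> s \<Longrightarrow> t \<noteq> {} \<Longrightarrow> t \<in> K"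
  using asc unfolding abstract_simplicial_complex_def by blast+

lemma simplex_V: "s \<in> K \<Longrightarrow> s \<subseteq> V"
  by (auto simp: V_def)

lemma V_simplex: "v \<in> V \<Longrightarrow> {v} \<in> K"
  unfolding V_def using face_in[of _ "{v}"] by blast

lemma closed_simplex_P: "s \<in> K \<Longrightarrow> closed_simplex s \<subseteq> P"
  by (auto simp: topspace_realization)

lemma closed_simplex_support: "x \<in> closed_simplex s \<Longrightarrow> support x \<subseteq> s"
  by (auto simp: closed_simplex_def support_def)

lemma P_nonneg: "x \<in> P \<Longrightarrow> 0 \<le> x v"
  by (auto simp: topspace_realization closed_simplex_def)

lemma closed_simplex_support_sum:
  assumes "s \<in> K" "support x \<subseteq> s" shows "sum x s = sum x (support x)"
  by (rule sum.mono_neutral_right) (use assms simplex_finite in \<open>auto simp: support_def\<close>)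

lemma P_support:
  assumes "x \<in> P" shows "support x \<in> K" "x \<in> closed_simplex (support x)" "sum x (support x) = 1"
proof -
  obtain s where s: "s \<in> K" "x \<in> closed_simplex s" using assms by (auto simp: topspace_realization)
  have sub: "support x \<subseteq> s" using closed_simplex_support[OF s(2)] .
  show 1: "sum x (support x) = 1"
    using s closed_simplex_support_sum[OF s(1) sub] by (simp add: closed_simplex_def)
  have "support x \<noteq> {}" using 1 by auto
  then show "support x \<in> K" using face_in s sub by auto
  show "x \<in> closed_simplex (support x)"
    using s 1 by (auto simp: closed_simplex_def support_def)
qed

lemma closed_simplex_iff:
  assumes "s \<in> K" shows "x \<in> closed_simplex s \<longleftrightarrow> x \<in> P \<and> support x \<subseteq> s"
proof
  assume "x \<in> closed_simplex s"
  then show "x \<in> P \<and> support x \<subseteq> s" using closed_simplex_P[OF assms] closed_simplex_support by auto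
next
  assume x: "x \<in> P \<and> support x \<subseteq> s"
  then have "sum x s = 1" using P_support(3) closed_simplex_support_sum[OF assms] by auto
  then show "x \<in> closed_simplex s" using x P_nonneg by (auto simp: closed_simplex_def support_def)
qed

lemma P_I:
  assumes "\<And>v. 0 \<le> x v" "support x \<in> K" "sum x (support x) = 1" shows "x \<in> P"
proof -
  have "x \<in> closed_simplex (support x)" using assms by (auto simp: closed_simplex_def support_def)
  then show ?thesis using assms(2) closed_simplex_P by auto
qed

lemma support_V: "x \<in> P \<Longrightarrow> support x \<subseteq> V"
  using P_support(1) simplex_V by auto

lemma P_outside: "x \<in> P \<Longrightarrow> v \<notin> V \<Longrightarrow> x v = 0"
  using support_V by (auto simp: support_def)

lemma barycenter_in: "s \<in> K \<Longrightarrow> barycenter s \<in> closed_simplex s"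
  using simplex_finite[of s] simplex_nonempty[of s]
  by (auto simp: closed_simplex_def barycenter_def)

lemma vertex_in: "v \<in> V \<Longrightarrow> vertex v \<in> P"
proof -
  assume "v \<in> V"
  then have "{v} \<in> K" by (rule V_simplex)
  moreover have "support (vertex v) = {v}" by (auto simp: support_def vertex_def)
  ultimately show ?thesis by (intro P_I) (auto simp: vertex_def)
qed

lemma open_star_P: "open_star K s \<subseteq> P"
  by (auto simp: open_star_def)

lemma open_star_support: "x \<in> open_star K s \<Longrightarrow> s \<subseteq> support x"
  by (force simp: open_star_def support_def)

text \<open>On a closed simplex \<open>t\<close> only finitely many comparisons count: coordinates
  outside \<open>t\<close> vanish, so being larger than those is already implied by
  positivity.\<close>

lemma open_star_open:
  assumes "finite s" shows "openin (realization K) (open_star K s)"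
  unfolding openin_realization_iff
proof (intro conjI ballI open_star_P)
  fix t assume t: "t \<in> K"
  define W where "W = {x::'v \<Rightarrow> real. (\<forall>v\<in>s. 0 < x v) \<and> (\<forall>v\<in>s. \<forall>w\<in>t - s. x w < x v)}"
  have "W = (\<Inter>v\<in>s. {x. 0 < x v}) \<inter> (\<Inter>v\<in>s. \<Inter>w\<in>t - s. {x. x w < x v})"
    unfolding W_def by auto
  moreover have "open ((\<Inter>v\<in>s. {x::'v \<Rightarrow> real. 0 < x v}) \<inter> (\<Inter>v\<in>s. \<Inter>w\<in>t - s. {x. x w < x v}))"
    using assms simplex_finite[OF t]
    by (intro open_Int open_INT ballI open_Collect_less continuous_on_const continuous_on_product_coordinates) auto
  ultimately have "open W" by simp
  moreover have "open_star K s \<inter> closed_simplex t = closed_simplex t \<inter> W"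
  proof -
    have "x \<in> open_star K s \<longleftrightarrow> x \<in> W" if x: "x \<in> closed_simplex t" for x
    proof
      assume "x \<in> W"
      moreover have "x \<in> P" using x closed_simplex_P[OF t] by auto
      moreover have "x w = 0" if "w \<notin> t" for w using x that by (auto simp: closed_simplex_def)
      ultimately show "x \<in> open_star K s" unfolding open_star_def W_def by (cases "x \<in> P") force+
    qed (auto simp: open_star_def W_def)
    then show ?thesis by auto
  qed
  ultimately show "\<exists>W. open W \<and> open_star K s \<inter> closed_simplex t = closed_simplex t \<inter> W" by auto
qed

text \<open>For a point of the realization, this is the smallest simplex whose open star contains
  the point.\<close>

definition max_set :: "('v \<Rightarrow> real) \<Rightarrow> 'v set" where
  "max_set x = {v. \<forall>w. x w \<le> x v}"

lemma max_set:
  assumes x: "x \<in> P"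
  shows "max_set x \<in> K" "max_set x \<subseteq> support x" "x \<in> open_star K (max_set x)"
proof -
  have fin: "finite (support x)" "support x \<noteq> {}" using P_support(1)[OF x] simplex_finite simplex_nonempty by auto
  define m where "m = Max (x ` support x)"
  have pos: "x v > 0" if "v \<in> support x" for v
    using that P_nonneg[OF x, of v] by (auto simp: support_def)
  have "m \<in> x ` support x" unfolding m_def by (intro Max_in) (use fin in auto)
  then obtain u where u: "u \<in> support x" "x u = m" by (metis imageE)
  have le: "x w \<le> m" for w
  proof (cases "w \<in> support x")
    case True then show ?thesis unfolding m_def using fin by auto
  next
    case False then show ?thesis using u pos[of u] by (auto simp: support_def)
  qed
  have ms: "max_set x = {v. x v = m}" unfolding max_set_def using le u by (auto intro: antisym)
  have mp: "m > 0" using u pos by auto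
  show sub: "max_set x \<subseteq> support x" unfolding ms using mp by (auto simp: support_def)
  have "u \<in> max_set x" using u ms by auto
  then show "max_set x \<in> K" using face_in[OF P_support(1)[OF x] sub] by auto
  show "x \<in> open_star K (max_set x)"
    unfolding open_star_def ms using x le mp by (auto simp: order.strict_iff_order)
qed

lemma open_star_cover: "P \<subseteq> (\<Union>s\<in>K. open_star K s)"
  using max_set by blast

lemma open_star_max_set:
  assumes "x \<in> open_star K s" "s \<noteq> {}" shows "max_set x \<subseteq> s"
proof
  fix v assume v: "v \<in> max_set x"
  obtain u where u: "u \<in> s" using assms by auto
  show "v \<in> s"
  proof (rule ccontr)
    assume "v \<notin> s"
    then have "x v < x u" using assms(1) u by (auto simp: open_star_def)
    moreover have "x u \<le> x v" using v by (auto simp: max_set_def)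
    ultimately show False by simp
  qed
qed

lemma open_star_barycenter:
  assumes "s \<in> K" "t \<in> K" "barycenter t \<in> open_star K s" shows "s = t"
proof
  show "s \<subseteq> t" using assms by (force simp: open_star_def barycenter_def split: if_splits)
  show "t \<subseteq> s"
  proof
    fix w assume w: "w \<in> t"
    obtain v where v: "v \<in> s" using simplex_nonempty[OF assms(1)] by auto
    show "w \<in> s"
    proof (rule ccontr)
      assume "w \<notin> s"
      then have "barycenter t w < barycenter t v" using assms v by (auto simp: open_star_def)
      then show False using \<open>s \<subseteq> t\<close> v w by (auto simp: barycenter_def)
    qed
  qed
qed

text \<open>A vertex of \<open>s\<close> outside \<open>t\<close> and a vertex of \<open>t\<close>
  outside \<open>s\<close> would each have the strictly larger coordinate at a common point.\<close>

lemma open_star_nested: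
  assumes "x \<in> open_star K s" "x \<in> open_star K t" shows "s \<subseteq> t \<or> t \<subseteq> s"
proof (rule ccontr)
  assume "\<not> ?thesis"
  then obtain v w where "v \<in> s" "v \<notin> t" "w \<in> t" "w \<notin> s" by auto
  then have "x w < x v" "x v < x w" using assms by (auto simp: open_star_def)
  then show False by auto
qed

end

section \<open>Free simplicial actions and their orbit maps\<close>

locale free_simplicial_action = simplicial_complex K + group G
  for K :: "'v set set" and G :: "('g, 'b) monoid_scheme" (structure) +
  fixes \<phi> :: "'g \<Rightarrow> 'v \<Rightarrow> 'v"
  assumes simplicial: "simplicial_action G K \<phi>" and free: "acts_freely G K \<phi>"
begin

sublocale act: group_action G V \<phi>
  using simplicial by (simp add: simplicial_action_def V_def)

text \<open>The unrestricted form of \<open>realization_action\<close>, with which it agrees on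
  \<open>P\<close>. Each coordinate of the result is a coordinate of \<open>x\<close> or 0, so
  \<open>act g\<close> is continuous on the whole function space.\<close>

definition act :: "'g \<Rightarrow> ('v \<Rightarrow> real) \<Rightarrow> 'v \<Rightarrow> real" where
  "act g x = (\<lambda>v. if v \<in> V then x (\<phi> (inv g) v) else 0)"

lemma phi_simplex: "g \<in> carrier G \<Longrightarrow> s \<in> K \<Longrightarrow> \<phi> g ` s \<in> K"
  using simplicial by (simp add: simplicial_action_def)

lemma phi_V: "g \<in> carrier G \<Longrightarrow> v \<in> V \<Longrightarrow> \<phi> g v \<in> V"
  using act.element_image by blast

lemma phi_mult: "g \<in> carrier G \<Longrightarrow> h \<in> carrier G \<Longrightarrow> v \<in> V \<Longrightarrow> \<phi> (g \<otimes> h) v = \<phi> g (\<phi> h v)"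
  using act.composition_rule by blast

lemma phi_one: "v \<in> V \<Longrightarrow> \<phi> \<one> v = v"
  using act.id_eq_one by (metis restrict_apply')

lemma phi_inv: "g \<in> carrier G \<Longrightarrow> v \<in> V \<Longrightarrow> \<phi> (inv g) (\<phi> g v) = v"
  and phi_inv': "g \<in> carrier G \<Longrightarrow> v \<in> V \<Longrightarrow> \<phi> g (\<phi> (inv g) v) = v"
  using phi_mult[of "inv g" g v] phi_mult[of g "inv g" v] phi_one by auto

lemma phi_image_inv: "g \<in> carrier G \<Longrightarrow> s \<subseteq> V \<Longrightarrow> \<phi> (inv g) ` \<phi> g ` s = s"
  unfolding image_image using phi_inv by (force simp: image_iff subset_iff)

lemma act_mult: "g \<in> carrier G \<Longrightarrow> h \<in> carrier G \<Longrightarrow> act (g \<otimes> h) x = act g (act h x)"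
  unfolding act_def by (rule ext) (simp add: inv_mult_group phi_mult phi_V)

lemma act_one: "x \<in> P \<Longrightarrow> act \<one> x = x"
  unfolding act_def using P_outside by (auto simp: phi_one)

lemma act_support: "g \<in> carrier G \<Longrightarrow> x \<in> P \<Longrightarrow> support (act g x) = \<phi> g ` support x"
proof -
  assume g: "g \<in> carrier G" and x: "x \<in> P"
  show ?thesis
  proof
    show "support (act g x) \<subseteq> \<phi> g ` support x"
    proof
      fix v assume "v \<in> support (act g x)"
      then have "v \<in> V" "\<phi> (inv g) v \<in> support x" by (auto simp: support_def act_def split: if_splits)
      then show "v \<in> \<phi> g ` support x" using phi_inv'[OF g] by (metis imageI)
    qed
    show "\<phi> g ` support x \<subseteq> support (act g x)"
      using support_V[OF x] g phi_V phi_inv by (auto simp: support_def act_def)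
  qed
qed

lemma act_apply: "g \<in> carrier G \<Longrightarrow> v \<in> V \<Longrightarrow> act g x (\<phi> g v) = x v"
  unfolding act_def using phi_V phi_inv by auto

lemma act_P: "g \<in> carrier G \<Longrightarrow> x \<in> P \<Longrightarrow> act g x \<in> P"
proof -
  assume g: "g \<in> carrier G" and x: "x \<in> P"
  show ?thesis
  proof (rule P_I)
    show "0 \<le> act g x v" for v unfolding act_def using P_nonneg[OF x] by auto
    show "support (act g x) \<in> K" unfolding act_support[OF g x] using phi_simplex[OF g P_support(1)[OF x]] .
    have "inj_on (\<phi> g) (support x)" using support_V[OF x] act.inj_prop[OF g] inj_on_subset by blast
    then have "sum (act g x) (support (act g x)) = (\<Sum>v\<in>support x. act g x (\<phi> g v))"
      unfolding act_support[OF g x] by (simp add: sum.reindex)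
    also have "\<dots> = sum x (support x)"
      by (rule sum.cong) (use act_apply[OF g] support_V[OF x] in auto)
    finally show "sum (act g x) (support (act g x)) = 1" using P_support(3)[OF x] by simp
  qed
qed

lemma act_inv: "g \<in> carrier G \<Longrightarrow> x \<in> P \<Longrightarrow> act (inv g) (act g x) = x"
  by (simp flip: act_mult add: act_one)

lemma act_closed_simplex:
  assumes "g \<in> carrier G" "s \<in> K" "x \<in> closed_simplex s" shows "act g x \<in> closed_simplex (\<phi> g ` s)"
proof -
  have x: "x \<in> P" "support x \<subseteq> s" using assms closed_simplex_iff by auto
  then show ?thesis
    using closed_simplex_iff[OF phi_simplex[OF assms(1,2)]] act_P[OF assms(1)] act_support[OF assms(1)] by auto
qed

lemma realization_action_eq: "x \<in> P \<Longrightarrow> realization_action G K \<phi> g x = act g x"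
  by (simp add: realization_action_def act_def V_def)

lemma act_free: "g \<in> carrier G \<Longrightarrow> x \<in> P \<Longrightarrow> act g x = x \<Longrightarrow> g = \<one>"
proof -
  assume g: "g \<in> carrier G" and x: "x \<in> P" and e: "act g x = x"
  have "g \<in> stabilizer G (realization_action G K \<phi>) x"
    using g e realization_action_eq[OF x] by (simp add: stabilizer_def)
  then show ?thesis using free x by (auto simp: acts_freely_def)
qed

text \<open>An element preserving a simplex fixes its barycenter, even if it permutes the vertices;
  freeness at that point applies.\<close>

lemma simplex_free:
  assumes g: "g \<in> carrier G" and s: "s \<in> K" and e: "\<phi> g ` s = s" shows "g = \<one>"
proof (rule act_free[OF g])
  show "barycenter s \<in> P" using barycenter_in[OF s] closed_simplex_P[OF s] by auto
  have sV: "s \<subseteq> V" using s by (rule simplex_V)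
  show "act g (barycenter s) = barycenter s"
  proof
    fix v
    have "\<phi> (inv g) v \<in> s \<longleftrightarrow> v \<in> s" if "v \<in> V"
      using phi_image_inv[OF g sV] e phi_inv'[OF g that] by (metis imageI)
    then show "act g (barycenter s) v = barycenter s v"
      using sV by (auto simp: act_def barycenter_def)
  qed
qed

lemma vertex_free:
  assumes "g \<in> carrier G" "v \<in> V" "\<phi> g v = v" shows "g = \<one>"
proof (rule simplex_free[OF assms(1)])
  show "{v} \<in> K" using assms(2) by (rule V_simplex)
qed (use assms in auto)

lemma act_open_star:
  assumes g: "g \<in> carrier G" and s: "s \<in> K" and x: "x \<in> open_star K s"
  shows "act g x \<in> open_star K (\<phi> g ` s)"
proof -
  have xP: "x \<in> P" using x open_star_P by auto
  have sV: "s \<subseteq> V" using s by (rule simplex_V)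
  have "0 < act g x (\<phi> g v) \<and> (\<forall>w. w \<notin> \<phi> g ` s \<longrightarrow> act g x w < act g x (\<phi> g v))" if v: "v \<in> s" for v
  proof -
    have a: "act g x (\<phi> g v) = x v" using act_apply[OF g] v sV by auto
    have "act g x w < x v" if w: "w \<notin> \<phi> g ` s" for w
    proof (cases "w \<in> V")
      case True
      then have "\<phi> (inv g) w \<notin> s" using w phi_inv'[OF g True] by (metis imageI)
      then show ?thesis using x v True by (auto simp: act_def open_star_def)
    qed (use x v in \<open>auto simp: act_def open_star_def\<close>)
    then show ?thesis using a x v by (auto simp: open_star_def)
  qed
  then show ?thesis using act_P[OF g xP] by (auto simp: open_star_def)
qed

text \<open>The open stars of \<open>s\<close> and of its translate meet, so the two simplices are
  nested, and having the same finite cardinality they coincide. This is the source of evenly covered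
  sets: distinct points of one open star are never in the same orbit.\<close>

lemma open_star_free:
  assumes g: "g \<in> carrier G" and s: "s \<in> K" and x: "x \<in> open_star K s" "act g x \<in> open_star K s"
  shows "g = \<one>"
proof (rule simplex_free[OF g s])
  have "act g x \<in> open_star K (\<phi> g ` s)" using act_open_star g s x by auto
  then have "\<phi> g ` s \<subseteq> s \<or> s \<subseteq> \<phi> g ` s" using open_star_nested x by auto
  moreover have "card (\<phi> g ` s) = card s"
    using simplex_V[OF s] by (intro card_image inj_on_subset[OF act.inj_prop[OF g]])
  ultimately show "\<phi> g ` s = s" using simplex_finite[OF s] by (metis card_subset_eq finite_imageI)
qed

lemma continuous_act: "g \<in> carrier G \<Longrightarrow> continuous_on UNIV (act g)"
proof (rule continuous_on_coordinatewise_then_product)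
  fix v assume "g \<in> carrier G"
  show "continuous_on UNIV (\<lambda>x. act g x v)"
    unfolding act_def by (cases "v \<in> V") auto
qed

lemma continuous_map_act:
  assumes g: "g \<in> carrier G" shows "continuous_map (realization K) (realization K) (act g)"
  unfolding continuous_map
proof (intro conjI allI impI)
  show "act g ` P \<subseteq> P" using act_P[OF g] by auto
  fix U assume U: "openin (realization K) U"
  show "openin (realization K) {x \<in> P. act g x \<in> U}"
    unfolding openin_realization_iff
  proof (intro conjI ballI)
    fix s assume s: "s \<in> K"
    obtain W where W: "open W" "U \<inter> closed_simplex (\<phi> g ` s) = closed_simplex (\<phi> g ` s) \<inter> W"
      using U phi_simplex[OF g s] unfolding openin_realization_iff by auto
    have "open (act g -` W)" using continuous_act[OF g] W(1) by (simp add: open_vimage)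
    moreover have "{x \<in> P. act g x \<in> U} \<inter> closed_simplex s = closed_simplex s \<inter> act g -` W"
      using act_closed_simplex[OF g s] W(2) closed_simplex_P[OF s] by blast
    ultimately show "\<exists>W. open W \<and> {x \<in> P. act g x \<in> U} \<inter> closed_simplex s = closed_simplex s \<inter> W" by blast
  qed auto
qed

definition orb :: "'g set \<Rightarrow> ('v \<Rightarrow> real) \<Rightarrow> ('v \<Rightarrow> real) set" where
  "orb H = orbit (G\<lparr>carrier := H\<rparr>) (realization_action G K \<phi>)"

lemma orb_eq: "x \<in> P \<Longrightarrow> orb H x = {act h x | h. h \<in> H}"
  by (simp add: orb_def orbit_def realization_action_eq)

lemma orbit_space_eq: "orbit_space G K \<phi> H = quotient_topology (realization K) (orb H)"
  by (simp add: orbit_space_def orb_def)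

lemma topspace_orbit_space: "topspace (orbit_space G K \<phi> H) = orb H ` P"
  by (simp add: orbit_space_eq topspace_quotient_topology)

lemma continuous_orb: "continuous_map (realization K) (orbit_space G K \<phi> H) (orb H)"
  unfolding orbit_space_eq by (intro quotient_imp_continuous_map quotient_map_quotient_topology)

lemma orb_eq_iff:
  assumes H: "subgroup H G" and x: "x \<in> P" "y \<in> P"
  shows "orb H x = orb H y \<longleftrightarrow> (\<exists>h\<in>H. y = act h x)"
proof
  interpret H: subgroup H G by fact
  assume "orb H x = orb H y"
  moreover have "y \<in> orb H y" unfolding orb_eq[OF x(2)] using act_one[OF x(2)] H.one_closed by (auto intro!: exI[of _ \<one>])
  ultimately show "\<exists>h\<in>H. y = act h x" unfolding orb_eq[OF x(1)] by auto
next
  interpret H: subgroup H G by fact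
  assume "\<exists>h\<in>H. y = act h x"
  then obtain h where h: "h \<in> H" "y = act h x" by auto
  have hc: "h \<in> carrier G" using h H.subset by auto
  show "orb H x = orb H y"
    unfolding orb_eq[OF x(1)] orb_eq[OF x(2)]
  proof (intro equalityI subsetI)
    fix z assume "z \<in> {act k x | k. k \<in> H}"
    then obtain k where k: "k \<in> H" "z = act k x" by auto
    then have "z = act (k \<otimes> inv h) y"
      using act_mult[of k "inv h" y] h hc H.subset act_inv[OF hc x(1)] by auto
    then show "z \<in> {act k y | k. k \<in> H}" using k h by blast
  next
    fix z assume "z \<in> {act k y | k. k \<in> H}"
    then obtain k where k: "k \<in> H" "z = act k y" by auto
    then have "z = act (k \<otimes> h) x" using act_mult[of k h x] h hc H.subset by auto
    then show "z \<in> {act k x | k. k \<in> H}" using k h by blast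
  qed
qed

lemma openin_orb_image:
  assumes H: "subgroup H G" and U: "openin (realization K) U"
  shows "openin (orbit_space G K \<phi> H) (orb H ` U)"
proof -
  interpret H: subgroup H G by fact
  have UP: "U \<subseteq> P" using U openin_subset by auto
  have "{x \<in> P. orb H x \<in> orb H ` U} = (\<Union>h\<in>H. {x \<in> P. act h x \<in> U})"
  proof (intro equalityI subsetI)
    fix x assume "x \<in> {x \<in> P. orb H x \<in> orb H ` U}"
    then obtain u where u: "x \<in> P" "u \<in> U" "orb H x = orb H u" by auto
    then show "x \<in> (\<Union>h\<in>H. {x \<in> P. act h x \<in> U})" using orb_eq_iff[OF H, of x u] UP by auto
  next
    fix x assume "x \<in> (\<Union>h\<in>H. {x \<in> P. act h x \<in> U})"
    then obtain h where h: "h \<in> H" "x \<in> P" "act h x \<in> U" by auto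
    then have "orb H x = orb H (act h x)" using orb_eq_iff[OF H] UP by blast
    then show "x \<in> {x \<in> P. orb H x \<in> orb H ` U}" using h by auto
  qed
  moreover have "openin (realization K) (\<Union>h\<in>H. {x \<in> P. act h x \<in> U})"
    using continuous_map_act H.subset U by (intro openin_Union) (auto simp: continuous_map)
  ultimately show ?thesis
    unfolding orbit_space_eq openin_quotient_topology using UP by auto
qed

end

section \<open>Finiteness consequences of cocompactness\<close>

locale cocompact_simplicial_action = free_simplicial_action +
  assumes cocompact: "compact_space (orbit_space G K \<phi> (carrier G))"
begin

text \<open>Finitely many images of open stars cover the quotient. The barycenter of
  \<open>t\<close> lies in the open star of no simplex other than \<open>t\<close>, so every orbit
  of simplices has a member in the subcover.\<close>

lemma finite_orbits:
  obtains K0 where "finite K0" "K0 \<subseteq> K" "\<And>t. t \<in> K \<Longrightarrow> \<exists>g\<in>carrier G. \<exists>s\<in>K0. t = \<phi> g ` s"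
proof -
  let ?q = "orb (carrier G)"
  let ?C = "(\<lambda>s. ?q ` open_star K s) ` K"
  have "\<forall>U\<in>?C. openin (orbit_space G K \<phi> (carrier G)) U"
    using openin_orb_image[OF subgroup_self] open_star_open simplex_finite by auto
  moreover have "topspace (orbit_space G K \<phi> (carrier G)) \<subseteq> \<Union>?C"
    unfolding topspace_orbit_space using open_star_cover by blast
  ultimately have "\<exists>F. finite F \<and> F \<subseteq> ?C \<and> topspace (orbit_space G K \<phi> (carrier G)) \<subseteq> \<Union>F"
    using cocompact unfolding compact_space_alt by simp
  then obtain K0 where K0: "K0 \<subseteq> K" "finite K0" "orb (carrier G) ` P \<subseteq> (\<Union>s\<in>K0. ?q ` open_star K s)"
    unfolding topspace_orbit_space by (metis finite_subset_image)
  have "\<exists>g\<in>carrier G. \<exists>s\<in>K0. t = \<phi> g ` s" if t: "t \<in> K" for t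
  proof -
    have b: "barycenter t \<in> P" using barycenter_in[OF t] closed_simplex_P[OF t] by auto
    then obtain s x where s: "s \<in> K0" "x \<in> open_star K s" "?q (barycenter t) = ?q x" using K0(3) by blast
    then obtain g where g: "g \<in> carrier G" "barycenter t = act g x"
      using orb_eq_iff[OF subgroup_self, of x "barycenter t"] b open_star_P by (metis subsetD)
    then have "barycenter t \<in> open_star K (\<phi> g ` s)" using act_open_star s K0(1) by auto
    then have "\<phi> g ` s = t" using open_star_barycenter phi_simplex g s K0(1) t by blast
    then show ?thesis using g s by auto
  qed
  then show ?thesis using that K0 by blast
qed

text \<open>A simplex through \<open>v\<close> is a translate of one of finitely many
  \<open>s\<close>, and freeness on vertices determines the translating element from the vertex
  \<open>u\<close> of \<open>s\<close> that is sent to \<open>v\<close>. There are finitely many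
  such pairs \<open>(s, u)\<close>.\<close>

lemma locally_finite: "finite {t \<in> K. v \<in> t}"
proof -
  obtain K0 where K0: "finite K0" "K0 \<subseteq> K" "\<And>t. t \<in> K \<Longrightarrow> \<exists>g\<in>carrier G. \<exists>s\<in>K0. t = \<phi> g ` s"
    by (rule finite_orbits) (rule that)
  define f where "f = (\<lambda>(s, u). \<phi> (THE g. g \<in> carrier G \<and> \<phi> g u = v) ` s)"
  have "{t \<in> K. v \<in> t} \<subseteq> f ` (SIGMA s:K0. s)"
  proof
    fix t assume t: "t \<in> {t \<in> K. v \<in> t}"
    then obtain g s where gs: "g \<in> carrier G" "s \<in> K0" "t = \<phi> g ` s" using K0(3)[of t] by blast
    then obtain u where u: "u \<in> s" "v = \<phi> g u" using t by auto
    have uV: "u \<in> V" using u gs K0 simplex_V by auto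
    have "(THE g. g \<in> carrier G \<and> \<phi> g u = v) = g"
    proof (rule the_equality)
      fix h assume h: "h \<in> carrier G \<and> \<phi> h u = v"
      have "\<phi> (inv g \<otimes> h) u = u" using h gs u uV phi_mult[of "inv g" h u] phi_inv by auto
      then have "inv g \<otimes> h = \<one>" using vertex_free uV h gs by auto
      then show "h = g" using h gs by (metis inv_closed inv_equality inv_inv)
    qed (use gs u in auto)
    then have "f (s, u) = t" unfolding f_def using gs by simp
    then show "t \<in> f ` (SIGMA s:K0. s)" using gs u by force
  qed
  moreover have "finite (f ` (SIGMA s:K0. s))"
    using K0 simplex_finite by (intro finite_imageI finite_SigmaI) auto
  ultimately show ?thesis by (rule finite_subset)
qed

lemma closed_closed_simplex: "closed (closed_simplex s)"
proof -
  have "closed_simplex s = (\<Inter>v. {x. 0 \<le> x v}) \<inter> (\<Inter>v\<in>-s. {x. x v = 0}) \<inter> {x. (\<Sum>v\<in>s. x v) = 1}"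
    by (auto simp: closed_simplex_def)
  also have "closed \<dots>"
    by (intro closed_Int closed_INT ballI closed_Collect_le closed_Collect_eq continuous_on_sum
        continuous_on_const continuous_on_product_coordinates)
  finally show ?thesis .
qed

text \<open>For a locally finite complex the weak topology is the topology of pointwise convergence.\<close>

lemma realization_eq: "realization K = top_of_set P"
proof (rule topology_eq[THEN iffD2], intro allI iffI)
  fix U assume U: "openin (top_of_set P) U"
  then obtain W where W: "open W" "U = P \<inter> W" unfolding openin_open by auto
  show "openin (realization K) U"
    unfolding openin_realization_iff using W closed_simplex_P by (intro conjI ballI exI[of _ W]) auto
next
  fix U assume U: "openin (realization K) U"
  then have UP: "U \<subseteq> P" by (rule openin_subset)
  have "\<exists>W. open W \<and> x \<in> W \<and> P \<inter> W \<subseteq> U" if x: "x \<in> U" for x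
  proof -
    obtain v where v: "x v > 0"
      using P_support(3)[of x] x UP P_nonneg by (metis linorder_not_less order_antisym subsetD sum.neutral zero_neq_one)
    \<comment> \<open>Only simplices containing \<open>v\<close> have points with positive
      coordinate at \<open>v\<close>. There are finitely many, so the set \<open>C\<close> of their
      points outside \<open>U\<close> is closed in the product topology and can be cut away.\<close>
    define C where "C = (\<Union>t\<in>{t\<in>K. v \<in> t}. closed_simplex t - U)"
    have "closed (closed_simplex t - U)" if t: "t \<in> K" for t
    proof -
      obtain W where W: "open W" "U \<inter> closed_simplex t = closed_simplex t \<inter> W"
        using U t unfolding openin_realization_iff by auto
      have "closed_simplex t - U = closed_simplex t - W" using W(2) by blast
      then show ?thesis using closed_Diff[OF closed_closed_simplex W(1)] by simp
    qed
    then have "closed C" unfolding C_def using locally_finite by (intro closed_UN) auto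
    moreover have "open {y::'a \<Rightarrow> real. 0 < y v}"
      by (intro open_Collect_less continuous_on_const continuous_on_product_coordinates)
    ultimately have "open ({y. 0 < y v} - C)" by (simp add: open_Diff)
    moreover have "x \<in> {y. 0 < y v} - C" using v x unfolding C_def by auto
    moreover have "P \<inter> ({y. 0 < y v} - C) \<subseteq> U"
    proof
      fix y assume y: "y \<in> P \<inter> ({y. 0 < y v} - C)"
      then have "v \<in> support y" "support y \<in> K" "y \<in> closed_simplex (support y)"
        using P_support by (auto simp: support_def)
      then show "y \<in> U" using y unfolding C_def by blast
    qed
    ultimately show ?thesis by blast
  qed
  then obtain W where W: "\<And>x. x \<in> U \<Longrightarrow> open (W x) \<and> x \<in> W x \<and> P \<inter> W x \<subseteq> U" by metis
  then have "open (\<Union>x\<in>U. W x)" "U = P \<inter> (\<Union>x\<in>U. W x)" using UP by auto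
  then show "openin (top_of_set P) U" unfolding openin_open by blast
qed

end

section \<open>Cones, affine simplices and a chain homotopy\<close>

text \<open>The vertex sequence \<open>w\<close> is ordered and may repeat vertices. No orientation
  has to be chosen, and a group action permutes these simplices without signs.\<close>

definition affine_simplex :: "nat \<Rightarrow> (nat \<Rightarrow> 'v) \<Rightarrow> (nat \<Rightarrow> real) \<Rightarrow> 'v \<Rightarrow> real" where
  "affine_simplex p w = restrict (\<lambda>x u. \<Sum>i\<le>p. x i * vertex (w i) u) (standard_simplex p)"

text \<open>The join of the point \<open>v\<close> with \<open>\<sigma>\<close>: coordinate 0
  measures the distance to the opposite face, and the others are rescaled to it. The case
  \<open>x 0 = 1\<close> is the apex, where the rescaling would divide by 0.\<close>

definition cone_simplex :: "nat \<Rightarrow> 'v \<Rightarrow> ((nat \<Rightarrow> real) \<Rightarrow> 'v \<Rightarrow> real) \<Rightarrow> (nat \<Rightarrow> real) \<Rightarrow> 'v \<Rightarrow> real" where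
  "cone_simplex p v \<sigma> = restrict (\<lambda>x u. x 0 * vertex v u +
      (if x 0 = 1 then 0 else (1 - x 0) * \<sigma> (\<lambda>i. x (Suc i) / (1 - x 0)) u)) (standard_simplex (Suc p))"

definition cone :: "nat \<Rightarrow> 'v \<Rightarrow> ('v \<Rightarrow> real) chain \<Rightarrow> ('v \<Rightarrow> real) chain" where
  "cone p v = frag_extend (frag_of \<circ> cone_simplex p v)"

lemma vertex_in_standard_simplex: "i \<le> p \<Longrightarrow> vertex i \<in> standard_simplex p"
  by (auto simp: standard_simplex_def vertex_def)

lemma standard_simplex_tail:
  assumes "x \<in> standard_simplex (Suc p)" "x 0 \<noteq> 1"
  shows "(\<lambda>i. x (Suc i) / (1 - x 0)) \<in> standard_simplex p"
proof -
  have x: "\<And>i. 0 \<le> x i" "\<And>i. x i \<le> 1" "\<And>i. i > Suc p \<Longrightarrow> x i = 0" "(\<Sum>i\<le>Suc p. x i) = 1"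
    using assms(1) by (auto simp: standard_simplex_def)
  have pos: "1 - x 0 > 0" using assms(2) x(2)[of 0] by simp
  have s: "(\<Sum>i\<le>p. x (Suc i)) = 1 - x 0" using x(4) by (simp add: sum.atMost_Suc_shift del: sum.atMost_Suc)
  have le: "x (Suc i) \<le> 1 - x 0" for i
  proof (cases "i \<le> p")
    case True
    then have "x (Suc i) \<le> (\<Sum>i\<le>p. x (Suc i))" using x(1) by (intro member_le_sum) auto
    then show ?thesis using s by simp
  next
    case False
    then show ?thesis using x(3)[of "Suc i"] pos by simp
  qed
  show ?thesis
    unfolding standard_simplex_def
    using x(1,3) pos s le by (auto simp: sum_divide_distrib[symmetric] divide_le_eq)
qed

lemma cone_simplex_extensional: "cone_simplex p v \<sigma> \<in> extensional (standard_simplex (Suc p))"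
  by (simp add: cone_simplex_def)

lemma singular_face_apply:
  "x \<in> standard_simplex p \<Longrightarrow> singular_face (Suc p) k f x = f (simplical_face k x)"
  by (simp add: singular_face_def)

lemma singular_face_eqI:
  assumes "\<And>x. x \<in> standard_simplex p \<Longrightarrow> f (simplical_face k x) = g x" "g \<in> extensional (standard_simplex p)"
  shows "singular_face (Suc p) k f = g"
  using assms by (auto simp: singular_face_def fun_eq_iff restrict_def extensional_def)

lemma face_cone_0:
  assumes "\<sigma> \<in> extensional (standard_simplex p)"
  shows "singular_face (Suc p) 0 (cone_simplex p v \<sigma>) = \<sigma>"
proof (rule singular_face_eqI[OF _ assms])
  fix x :: "nat \<Rightarrow> real" assume x: "x \<in> standard_simplex p"
  have "simplical_face 0 x \<in> standard_simplex (Suc p)"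
    using simplical_face_in_standard_simplex[of "Suc p" 0 x] x by simp
  then show "cone_simplex p v \<sigma> (simplical_face 0 x) = \<sigma> x"
    by (simp add: cone_simplex_def simplical_face_def)
qed

lemma face_cone_Suc:
  assumes "k \<le> Suc p"
  shows "singular_face (Suc (Suc p)) (Suc k) (cone_simplex (Suc p) v \<sigma>)
       = cone_simplex p v (singular_face (Suc p) k \<sigma>)"
proof (rule singular_face_eqI[OF _ cone_simplex_extensional])
  fix x :: "nat \<Rightarrow> real" assume x: "x \<in> standard_simplex (Suc p)"
  have 1: "simplical_face (Suc k) x \<in> standard_simplex (Suc (Suc p))"
    using simplical_face_in_standard_simplex[of "Suc (Suc p)" "Suc k" x] x assms by simp
  have 2: "simplical_face (Suc k) x 0 = x 0" by (simp add: simplical_face_def)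
  have 3: "(\<lambda>i. simplical_face (Suc k) x (Suc i) / (1 - x 0)) = simplical_face k (\<lambda>i. x (Suc i) / (1 - x 0))"
  proof
    fix i
    show "simplical_face (Suc k) x (Suc i) / (1 - x 0) = simplical_face k (\<lambda>i. x (Suc i) / (1 - x 0)) i"
      by (cases i) (auto simp: simplical_face_def)
  qed
  show "cone_simplex (Suc p) v \<sigma> (simplical_face (Suc k) x) = cone_simplex p v (singular_face (Suc p) k \<sigma>) x"
  proof (cases "x 0 = 1")
    case True
    then show ?thesis using 1 2 x by (simp add: cone_simplex_def)
  next
    case False
    have "singular_face (Suc p) k \<sigma> (\<lambda>i. x (Suc i) / (1 - x 0)) = \<sigma> (simplical_face k (\<lambda>i. x (Suc i) / (1 - x 0)))"
      by (rule singular_face_apply) (rule standard_simplex_tail[OF x False])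
    then show ?thesis using 1 2 3 x False by (simp add: cone_simplex_def)
  qed
qed

lemma face_cone_point: "singular_face (Suc 0) (Suc 0) (cone_simplex 0 v \<sigma>) = restrict (\<lambda>_. vertex v) (standard_simplex 0)"
proof (rule singular_face_eqI)
  fix x :: "nat \<Rightarrow> real" assume x: "x \<in> standard_simplex 0"
  have 1: "simplical_face (Suc 0) x \<in> standard_simplex (Suc 0)"
    using simplical_face_in_standard_simplex[of "Suc 0" "Suc 0" x] x by simp
  have "x 0 = 1" using x by (auto simp: standard_simplex_def)
  then show "cone_simplex 0 v \<sigma> (simplical_face (Suc 0) x) = restrict (\<lambda>_. vertex v) (standard_simplex 0) x"
    using 1 x by (simp add: cone_simplex_def simplical_face_def)
qed auto

text \<open>Face 0 lies opposite the apex and returns the chain. Every other face is the cone over a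
  face whose index is lower by one, which accounts for the minus sign.\<close>

lemma boundary_cone_Suc:
  assumes "Poly_Mapping.keys c \<subseteq> extensional (standard_simplex (Suc p))"
  shows "chain_boundary (Suc (Suc p)) (cone (Suc p) v c) = c - cone p v (chain_boundary (Suc p) c)"
  using assms
proof (induction c rule: frag_induction)
  case (one \<sigma>)
  have "chain_boundary (Suc (Suc p)) (cone (Suc p) v (frag_of \<sigma>))
     = (\<Sum>k\<le>Suc (Suc p). frag_cmul ((-1) ^ k) (frag_of (singular_face (Suc (Suc p)) k (cone_simplex (Suc p) v \<sigma>))))"
    by (simp add: cone_def chain_boundary_of)
  also have "\<dots> = frag_of \<sigma> + (\<Sum>k\<le>Suc p. frag_cmul ((-1) ^ Suc k) (frag_of (singular_face (Suc (Suc p)) (Suc k) (cone_simplex (Suc p) v \<sigma>))))"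
    by (subst sum.atMost_Suc_shift) (use one in \<open>simp add: face_cone_0\<close>)
  also have "(\<Sum>k\<le>Suc p. frag_cmul ((-1) ^ Suc k) (frag_of (singular_face (Suc (Suc p)) (Suc k) (cone_simplex (Suc p) v \<sigma>))))
     = - (\<Sum>k\<le>Suc p. frag_cmul ((-1) ^ k) (frag_of (cone_simplex p v (singular_face (Suc p) k \<sigma>))))"
    unfolding sum_negf[symmetric] by (rule sum.cong) (simp_all add: face_cone_Suc)
  also have "(\<Sum>k\<le>Suc p. frag_cmul ((-1) ^ k) (frag_of (cone_simplex p v (singular_face (Suc p) k \<sigma>))))
     = cone p v (chain_boundary (Suc p) (frag_of \<sigma>))"
    by (simp only: cone_def chain_boundary_of) (simp add: frag_extend_sum frag_extend_cmul del: sum.atMost_Suc)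
  finally show ?case by simp
next
  case (diff a b)
  then show ?case by (simp add: chain_boundary_diff cone_def frag_extend_diff)
qed (auto simp: cone_def)

text \<open>In degree 0 the second face of a cone is the constant simplex at the apex, which cancels
  only in chains of augmentation 0; hence the formulation for differences of two simplices.\<close>

lemma boundary_cone_0:
  assumes "\<sigma> \<in> extensional (standard_simplex 0)" "\<tau> \<in> extensional (standard_simplex 0)"
  shows "chain_boundary (Suc 0) (cone 0 v (frag_of \<sigma> - frag_of \<tau>)) = frag_of \<sigma> - frag_of \<tau>"
  using assms by (simp add: cone_def frag_extend_diff chain_boundary_diff chain_boundary_of face_cone_0 face_cone_point)

text \<open>The recursion of acyclic carriers for the identity and the map given by
  \<open>F\<close>: at each simplex, what the lower homotopy leaves over is a cycle and is filled by
  the cone from the apex \<open>ap\<close>.\<close>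

primrec cone_homotopy :: "(nat \<Rightarrow> ((nat \<Rightarrow> real) \<Rightarrow> 'v \<Rightarrow> real) \<Rightarrow> 'v) \<Rightarrow>
   (nat \<Rightarrow> ((nat \<Rightarrow> real) \<Rightarrow> 'v \<Rightarrow> real) \<Rightarrow> ('v \<Rightarrow> real) chain) \<Rightarrow> nat \<Rightarrow> ('v \<Rightarrow> real) chain \<Rightarrow> ('v \<Rightarrow> real) chain" where
  "cone_homotopy ap F 0 = frag_extend (\<lambda>\<sigma>. cone 0 (ap 0 \<sigma>) (frag_of \<sigma> - F 0 \<sigma>))"
| "cone_homotopy ap F (Suc p) = frag_extend (\<lambda>\<sigma>. cone (Suc p) (ap (Suc p) \<sigma>)
     (frag_of \<sigma> - F (Suc p) \<sigma> - cone_homotopy ap F p (chain_boundary (Suc p) (frag_of \<sigma>))))"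

lemma cone_homotopy_diff: "cone_homotopy ap F p (a - b) = cone_homotopy ap F p a - cone_homotopy ap F p b"
  and cone_homotopy_zero: "cone_homotopy ap F p 0 = 0"
  by (cases p; simp add: frag_extend_diff)+

lemma keys_diff_subset: "Poly_Mapping.keys a \<subseteq> S \<Longrightarrow> Poly_Mapping.keys b \<subseteq> S \<Longrightarrow> Poly_Mapping.keys (a - b) \<subseteq> S"
  using keys_diff[of a b] by blast

text \<open>By induction on the degree the chain to be coned off is a cycle, so
  \<open>boundary_cone_Suc\<close> fills it. \<open>A\<close> may be larger than \<open>B\<close>
  because cones over simplices of \<open>B\<close> may leave \<open>B\<close>: faces must stay in
  \<open>B\<close>, while \<open>A\<close> must absorb cones with apexes chosen for simplices of
  \<open>B\<close>. For \<open>p = 0\<close> the truncated \<open>p - 1\<close> is harmless, as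
  \<open>chain_boundary 0\<close> vanishes.\<close>

lemma cone_homotopy:
  assumes BA: "\<And>p. B p \<subseteq> A p" and sing: "\<And>p \<sigma>. \<sigma> \<in> B p \<Longrightarrow> singular_simplex p X \<sigma>" and ext: "\<And>p. A p \<subseteq> extensional (standard_simplex p)"
    and bd: "\<And>p \<sigma>. \<sigma> \<in> B (Suc p) \<Longrightarrow> Poly_Mapping.keys (chain_boundary (Suc p) (frag_of \<sigma>)) \<subseteq> B p"
    and con: "\<And>p \<sigma> \<tau>. \<sigma> \<in> B p \<Longrightarrow> \<tau> \<in> A p \<Longrightarrow> cone_simplex p (ap p \<sigma>) \<tau> \<in> A (Suc p)"
    and F: "\<And>p \<sigma>. \<sigma> \<in> B p \<Longrightarrow> Poly_Mapping.keys (F p \<sigma>) \<subseteq> A p"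
    and Fbd: "\<And>p \<sigma>. \<sigma> \<in> B (Suc p) \<Longrightarrow>
        chain_boundary (Suc p) (F (Suc p) \<sigma>) = frag_extend (F p) (chain_boundary (Suc p) (frag_of \<sigma>))"
    and F0: "\<And>\<sigma>. \<sigma> \<in> B 0 \<Longrightarrow> \<exists>\<tau>. F 0 \<sigma> = frag_of \<tau>"
    and c: "Poly_Mapping.keys c \<subseteq> B p"
  shows "Poly_Mapping.keys (cone_homotopy ap F p c) \<subseteq> A (Suc p) \<and>
     chain_boundary (Suc p) (cone_homotopy ap F p c)
       = c - frag_extend (F p) c - cone_homotopy ap F (p - 1) (chain_boundary p c)"
  using c
proof (induction p arbitrary: c)
  have keyscone: "Poly_Mapping.keys (cone p (ap p \<sigma>) w) \<subseteq> A (Suc p)"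
    if "\<sigma> \<in> B p" "Poly_Mapping.keys w \<subseteq> A p" for p \<sigma> w
    unfolding cone_def using that con by (intro order_trans[OF keys_frag_extend]) auto
  case 0
  then show ?case
  proof (induction c rule: frag_induction)
    case (one \<sigma>)
    obtain \<tau> where \<tau>: "F 0 \<sigma> = frag_of \<tau>" using F0 one by auto
    have \<tau>A: "\<tau> \<in> A 0" using F[OF one] \<tau> by simp
    have "Poly_Mapping.keys (frag_of \<sigma> - F 0 \<sigma>) \<subseteq> A 0"
      by (rule keys_diff_subset) (use F[OF one] subsetD[OF BA one] in auto)
    then show ?case
      using keyscone[OF one] boundary_cone_0[of \<sigma> \<tau>] one \<tau>A BA ext \<tau>
      by (auto simp: chain_boundary_def cone_homotopy_zero subset_iff)
  next
    case (diff a b)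
    then show ?case
      by (simp add: cone_homotopy_diff chain_boundary_diff frag_extend_diff keys_diff_subset)
  qed auto
next
  have keyscone: "Poly_Mapping.keys (cone p (ap p \<sigma>) w) \<subseteq> A (Suc p)"
    if "\<sigma> \<in> B p" "Poly_Mapping.keys w \<subseteq> A p" for p \<sigma> w
    unfolding cone_def using that con by (intro order_trans[OF keys_frag_extend]) auto
  case (Suc p)
  note IH = Suc.IH
  from Suc.prems show ?case
  proof (induction c rule: frag_induction)
    case (one \<sigma>)
    let ?d = "chain_boundary (Suc p) (frag_of \<sigma>)"
    let ?w = "frag_of \<sigma> - F (Suc p) \<sigma> - cone_homotopy ap F p ?d"
    have IHd: "Poly_Mapping.keys (cone_homotopy ap F p ?d) \<subseteq> A (Suc p)"
      "chain_boundary (Suc p) (cone_homotopy ap F p ?d) = ?d - frag_extend (F p) ?d - cone_homotopy ap F (p - 1) (chain_boundary p ?d)"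
      using IH[OF bd[OF one]] by auto
    have sA: "Poly_Mapping.keys (frag_of \<sigma>) \<subseteq> A (Suc p)" using one BA by auto
    have kw: "Poly_Mapping.keys ?w \<subseteq> A (Suc p)"
      by (intro keys_diff_subset sA F[OF one] IHd(1))
    have "chain_boundary p ?d = 0"
    proof -
      have "singular_chain (Suc p) X (frag_of \<sigma>)" using sing[OF one] by (simp add: singular_chain_of)
      from chain_boundary_boundary[OF this] show ?thesis by simp
    qed
    then have "chain_boundary (Suc p) ?w = 0"
      unfolding chain_boundary_diff IHd(2) Fbd[OF one] by (simp add: cone_homotopy_zero)
    moreover have "Poly_Mapping.keys ?w \<subseteq> extensional (standard_simplex (Suc p))" using kw ext by blast
    ultimately have "chain_boundary (Suc (Suc p)) (cone (Suc p) (ap (Suc p) \<sigma>) ?w) = ?w"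
      using boundary_cone_Suc[of ?w p "ap (Suc p) \<sigma>"] by (simp add: cone_def)
    then show ?case using keyscone[OF one kw] by simp
  next
    case (diff a b)
    then show ?case
      by (simp add: cone_homotopy_diff chain_boundary_diff frag_extend_diff keys_diff_subset del: cone_homotopy.simps)
  qed (auto simp: cone_homotopy_zero)
qed

section \<open>Affine simplices and continuity of cones\<close>

lemma affine_simplex_extensional: "affine_simplex p w \<in> extensional (standard_simplex p)"
  by (simp add: affine_simplex_def)

lemma affine_simplex_vertex: "i \<le> p \<Longrightarrow> affine_simplex p w (vertex i) = vertex (w i)"
proof -
  assume i: "i \<le> p"
  have "(\<Sum>j\<le>p. vertex i j * vertex (w j) u) = (\<Sum>j\<le>p. if j = i then vertex (w j) u else 0)" for u
    by (rule sum.cong) (auto simp: vertex_def)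
  then show ?thesis using i vertex_in_standard_simplex[OF i] by (auto simp: affine_simplex_def)
qed

lemma affine_simplex_cong: "(\<And>i. i \<le> p \<Longrightarrow> w i = w' i) \<Longrightarrow> affine_simplex p w = affine_simplex p w'"
  unfolding affine_simplex_def by (intro restrict_ext ext sum.cong) auto

lemma face_affine_simplex:
  assumes "k \<le> Suc p"
  shows "singular_face (Suc p) k (affine_simplex (Suc p) w) = affine_simplex p (\<lambda>j. w (if j < k then j else Suc j))"
proof (rule singular_face_eqI[OF _ affine_simplex_extensional])
  fix x :: "nat \<Rightarrow> real" assume x: "x \<in> standard_simplex p"
  have 1: "simplical_face k x \<in> standard_simplex (Suc p)"
    using simplical_face_in_standard_simplex[of "Suc p" k x] x assms by simp
  have "(\<Sum>i\<le>Suc p. simplical_face k x i * vertex (w i) u)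
     = (\<Sum>j\<le>p. x j * vertex (w (if j < k then j else Suc j)) u)" for u
  proof -
    define r where "r j = (if j < k then j else Suc j)" for j
    have eq: "{..Suc p} = insert k (r ` {..p})"
    proof (intro equalityI subsetI)
      fix i assume i: "i \<in> {..Suc p}"
      consider "i < k" | "i = k" | "i > k" by linarith
      then show "i \<in> insert k (r ` {..p})"
      proof cases
        case 1 then show ?thesis using assms by (intro insertI2 image_eqI[of _ _ i]) (auto simp: r_def)
      next
        case 3 then show ?thesis using i by (intro insertI2 image_eqI[of _ _ "i - 1"]) (auto simp: r_def)
      qed auto
    qed (use assms in \<open>auto simp: r_def split: if_splits\<close>)
    have inj: "inj_on r {..p}" by (auto simp: inj_on_def r_def split: if_splits)
    have nk: "k \<notin> r ` {..p}" by (auto simp: r_def split: if_splits)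
    have fr: "simplical_face k x (r j) = x j" "simplical_face k x k = 0" for j
      by (auto simp: simplical_face_def r_def)
    have "(\<Sum>i\<le>Suc p. simplical_face k x i * vertex (w i) u) = (\<Sum>j\<le>p. x j * vertex (w (r j)) u)"
      unfolding eq using nk inj by (simp add: sum.reindex fr)
    then show ?thesis unfolding r_def .
  qed
  then show "affine_simplex (Suc p) w (simplical_face k x) = affine_simplex p (\<lambda>j. w (if j < k then j else Suc j)) x"
    using 1 x by (simp add: affine_simplex_def)
qed

lemma simplical_face_vertex: "simplical_face k (vertex j) = vertex (if j < k then j else Suc j)"
  by (rule ext) (auto simp: simplical_face_def vertex_def)

lemma cone_affine_simplex: "cone_simplex p v (affine_simplex p w) = affine_simplex (Suc p) (case_nat v w)"
proof
  fix x :: "nat \<Rightarrow> real"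
  show "cone_simplex p v (affine_simplex p w) x = affine_simplex (Suc p) (case_nat v w) x"
  proof (cases "x \<in> standard_simplex (Suc p)")
    case x: True
    have s: "(\<Sum>i\<le>Suc p. x i * vertex (case_nat v w i) u) = x 0 * vertex v u + (\<Sum>i\<le>p. x (Suc i) * vertex (w i) u)" for u
      by (subst sum.atMost_Suc_shift) simp
    show ?thesis
    proof (cases "x 0 = 1")
      case True
      have "(\<Sum>i\<le>p. x (Suc i)) = 0"
        using x True unfolding standard_simplex_def by (simp add: sum.atMost_Suc_shift del: sum.atMost_Suc)
      then have "x (Suc i) = 0" if "i \<le> p" for i
        using x that by (subst (asm) sum_nonneg_eq_0_iff) (auto simp: standard_simplex_def)
      then show ?thesis using x True s by (simp add: cone_simplex_def affine_simplex_def del: sum.atMost_Suc)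
    next
      case False
      then have "(1 - x 0) * (\<Sum>i\<le>p. x (Suc i) / (1 - x 0) * vertex (w i) u) = (\<Sum>i\<le>p. x (Suc i) * vertex (w i) u)" for u
        by (simp add: sum_distrib_left)
      then show ?thesis using x False s standard_simplex_tail[OF x False]
        by (simp add: cone_simplex_def affine_simplex_def del: sum.atMost_Suc)
    qed
  qed (simp add: cone_simplex_def affine_simplex_def)
qed

lemma singular_simplex_top_of_set:
  fixes \<sigma> :: "(nat \<Rightarrow> real) \<Rightarrow> 'v \<Rightarrow> real"
  shows "singular_simplex p (top_of_set W) \<sigma> \<longleftrightarrow>
    continuous_on (standard_simplex p) \<sigma> \<and> \<sigma> ` standard_simplex p \<subseteq> W \<and> \<sigma> \<in> extensional (standard_simplex p)"
  by (auto simp: singular_simplex_def euclidean_product_topology continuous_map_in_subtopology)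

lemma continuous_affine_simplex: "continuous_on (standard_simplex p) (affine_simplex p w)"
proof -
  have "continuous_on (standard_simplex p) (\<lambda>x u. \<Sum>i\<le>p. x i * vertex (w i) u)"
    by (intro continuous_on_coordinatewise_then_product continuous_on_sum continuous_on_mult_right
        continuous_on_subset[OF continuous_on_product_coordinates]) auto
  then show ?thesis by (rule continuous_on_eq) (simp add: affine_simplex_def)
qed

text \<open>Only the apex is delicate: bounded coordinates of \<open>\<sigma>\<close> make the
  second summand at most \<open>1 - x 0\<close> in absolute value, so it tends to 0 where the
  rescaling degenerates.\<close>

lemma continuous_cone_simplex:
  assumes \<sigma>: "continuous_on (standard_simplex p) \<sigma>"
    and bound: "\<And>x u. x \<in> standard_simplex p \<Longrightarrow> \<bar>\<sigma> x u\<bar> \<le> 1"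
  shows "continuous_on (standard_simplex (Suc p)) (cone_simplex p v \<sigma>)"
proof -
  let ?S = "standard_simplex (Suc p)"
  have coord: "continuous_on S (\<lambda>x::nat \<Rightarrow> real. x i)" for i and S
    using continuous_on_subset[OF continuous_on_product_coordinates] by auto
  have "continuous_on ?S (\<lambda>x u. x 0 * vertex v u +
      (if x 0 = 1 then 0 else (1 - x 0) * \<sigma> (\<lambda>i. x (Suc i) / (1 - x 0)) u))"
  proof (intro continuous_on_coordinatewise_then_product continuous_on_add continuous_on_mult_right coord)
    fix u
    define h where "h x = (if x 0 = 1 then 0 else (1 - x 0) * \<sigma> (\<lambda>i. x (Suc i) / (1 - x 0)) u)" for x
    have hb: "\<bar>h x\<bar> \<le> 1 - x 0" if x: "x \<in> ?S" for x
    proof (cases "x 0 = 1")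
      case False
      have "x 0 \<le> 1" using x by (auto simp: standard_simplex_def)
      then show ?thesis
        using bound[OF standard_simplex_tail[OF x False], of u] False
        by (simp add: h_def abs_mult mult_left_le)
    qed (simp add: h_def)
    have "continuous_on ?S h"
      unfolding continuous_on_eq_continuous_within
    proof
      fix x assume x: "x \<in> ?S"
      show "continuous (at x within ?S) h"
      proof (cases "x 0 = 1")
        case True
        have "((\<lambda>y. 1 - y 0) \<longlongrightarrow> 1 - x 0) (at x within ?S)"
          using coord[of ?S 0] x by (intro tendsto_diff tendsto_const) (auto simp: continuous_on_def)
        then have "((\<lambda>y. 1 - y 0) \<longlongrightarrow> 0) (at x within ?S)" using True by simp
        then have "(h \<longlongrightarrow> 0) (at x within ?S)"
          by (rule Lim_null_comparison[rotated]) (use hb in \<open>auto simp: eventually_at_filter\<close>)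
        then show ?thesis using True by (simp add: continuous_within h_def)
      next
        case False
        define Q where "Q = ?S \<inter> {y. y 0 \<noteq> 1}"
        have "continuous_on Q (\<lambda>y i. y (Suc i) / (1 - y 0))"
          by (intro continuous_on_coordinatewise_then_product continuous_on_divide continuous_on_diff
              continuous_on_const coord) (auto simp: Q_def)
        moreover have "(\<lambda>y i. y (Suc i) / (1 - y 0)) ` Q \<subseteq> standard_simplex p"
          using standard_simplex_tail unfolding Q_def by auto
        ultimately have "continuous_on Q (\<lambda>y. \<sigma> (\<lambda>i. y (Suc i) / (1 - y 0)))"
          by (rule continuous_on_compose2[OF \<sigma>])
        then have c2: "continuous_on Q (\<lambda>y. \<sigma> (\<lambda>i. y (Suc i) / (1 - y 0)) u)"
          by (rule continuous_on_product_then_coordinatewise)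
        have c1: "continuous_on Q (\<lambda>y. 1 - y 0)" by (intro continuous_on_diff continuous_on_const coord)
        have "continuous_on Q (\<lambda>y. (1 - y 0) * \<sigma> (\<lambda>i. y (Suc i) / (1 - y 0)) u)"
          by (rule continuous_on_mult[OF c1 c2])
        then have "continuous_on Q h"
          by (rule continuous_on_eq) (auto simp: h_def Q_def)
        then have "continuous (at x within Q) h" using x False by (auto simp: Q_def continuous_on_eq_continuous_within)
        moreover have "open {y::nat \<Rightarrow> real. y 0 \<noteq> 1}"
          by (intro open_Collect_neq continuous_on_const continuous_on_product_coordinates)
        ultimately have "at x within Q = at x within ?S"
          by (intro at_within_nhd[of x "{y. y 0 \<noteq> 1}"]) (use False in \<open>auto simp: Q_def\<close>)
        then show ?thesis using \<open>continuous (at x within Q) h\<close> by simp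
      qed
    qed
    then show "continuous_on ?S (\<lambda>x. if x 0 = 1 then 0 else (1 - x 0) * \<sigma> (\<lambda>i. x (Suc i) / (1 - x 0)) u)"
      by (simp only: h_def[abs_def])
  qed
  then show ?thesis by (rule continuous_on_eq) (simp add: cone_simplex_def)
qed

lemma closed_simplex_bound: "finite s \<Longrightarrow> x \<in> closed_simplex s \<Longrightarrow> \<bar>x u\<bar> \<le> 1"
proof -
  assume s: "finite s" and x: "x \<in> closed_simplex s"
  have "x u \<le> 1"
  proof (cases "u \<in> s")
    case True
    then have "x u \<le> (\<Sum>v\<in>s. x v)" using s x by (intro member_le_sum) (auto simp: closed_simplex_def)
    then show ?thesis using x by (simp add: closed_simplex_def)
  qed (use x in \<open>auto simp: closed_simplex_def\<close>)
  then show ?thesis using x by (auto simp: closed_simplex_def)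
qed

lemma cone_simplex_in_closed_simplex:
  assumes "finite s" "v \<in> s" and x: "x \<in> standard_simplex (Suc p)"
    and \<sigma>: "x 0 \<noteq> 1 \<Longrightarrow> \<sigma> (\<lambda>i. x (Suc i) / (1 - x 0)) \<in> closed_simplex s"
  shows "cone_simplex p v \<sigma> x \<in> closed_simplex s"
proof -
  have v: "(\<Sum>u\<in>s. vertex v u) = 1" using assms by (simp add: vertex_def)
  have x01: "0 \<le> x 0" "x 0 \<le> 1" using x by (auto simp: standard_simplex_def)
  show ?thesis
  proof (cases "x 0 = 1")
    case True
    then show ?thesis using x v assms by (auto simp: cone_simplex_def closed_simplex_def vertex_def)
  next
    case False
    have s: "0 \<le> \<sigma> (\<lambda>i. x (Suc i) / (1 - x 0)) u" "u \<notin> s \<Longrightarrow> \<sigma> (\<lambda>i. x (Suc i) / (1 - x 0)) u = 0"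
      "(\<Sum>v\<in>s. \<sigma> (\<lambda>i. x (Suc i) / (1 - x 0)) v) = 1" for u
      using \<sigma>[OF False] by (auto simp: closed_simplex_def)
    have "(\<Sum>u\<in>s. x 0 * vertex v u + (1 - x 0) * \<sigma> (\<lambda>i. x (Suc i) / (1 - x 0)) u) = 1"
      unfolding sum.distrib sum_distrib_left[symmetric] v s(3) by simp
    moreover have "0 \<le> x 0 * vertex v u + (1 - x 0) * \<sigma> (\<lambda>i. x (Suc i) / (1 - x 0)) u" for u
      using s(1) x01 by (auto simp: vertex_def)
    ultimately show ?thesis
      using x False s(2) assms(2) by (auto simp: cone_simplex_def closed_simplex_def vertex_def)
  qed
qed

lemma affine_simplex_in_closed_simplex:
  assumes "finite s" "w ` {..p} \<subseteq> s" "x \<in> standard_simplex p"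
  shows "affine_simplex p w x \<in> closed_simplex s"
proof -
  have x: "\<And>i. 0 \<le> x i" "(\<Sum>i\<le>p. x i) = 1" using assms by (auto simp: standard_simplex_def)
  have "(\<Sum>u\<in>s. \<Sum>i\<le>p. x i * vertex (w i) u) = (\<Sum>i\<le>p. \<Sum>u\<in>s. x i * vertex (w i) u)" by (rule sum.swap)
  also have "\<dots> = (\<Sum>i\<le>p. x i)"
  proof (rule sum.cong)
    fix i assume "i \<in> {..p}"
    then have "(\<Sum>u\<in>s. vertex (w i) u) = 1" using assms by (auto simp: vertex_def)
    then show "(\<Sum>u\<in>s. x i * vertex (w i) u) = x i" by (simp add: sum_distrib_left[symmetric])
  qed simp
  finally have "(\<Sum>u\<in>s. \<Sum>i\<le>p. x i * vertex (w i) u) = 1" using x by simp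
  moreover have "(\<Sum>i\<le>p. x i * vertex (w i) u) = 0" if "u \<notin> s" for u
    by (rule sum.neutral) (use that assms in \<open>auto simp: vertex_def\<close>)
  ultimately show ?thesis
    using assms x by (auto simp: affine_simplex_def closed_simplex_def sum_nonneg vertex_def)
qed

section \<open>Comparison of affine and singular chains\<close>

lemma keys_boundary_of:
  "Poly_Mapping.keys (chain_boundary (Suc p) (frag_of \<sigma>)) \<subseteq> (\<lambda>k. singular_face (Suc p) k \<sigma>) ` {..Suc p}"
proof -
  have "Poly_Mapping.keys (chain_boundary (Suc p) (frag_of \<sigma>)) \<subseteq>
    (\<Union>k\<in>{..Suc p}. Poly_Mapping.keys (frag_cmul ((-1) ^ k) (frag_of (singular_face (Suc p) k \<sigma>))))"
    unfolding chain_boundary_of by (simp del: sum.atMost_Suc add: keys_sum)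
  also have "\<dots> \<subseteq> (\<lambda>k. singular_face (Suc p) k \<sigma>) ` {..Suc p}"
    using keys_cmul by fastforce
  finally show ?thesis .
qed

lemma keys_boundary_subset:
  assumes "Poly_Mapping.keys c \<subseteq> B" "\<And>\<sigma> k. \<sigma> \<in> B \<Longrightarrow> k \<le> Suc p \<Longrightarrow> singular_face (Suc p) k \<sigma> \<in> C"
  shows "Poly_Mapping.keys (chain_boundary (Suc p) c) \<subseteq> C"
  using assms(1)
proof (induction c rule: frag_induction)
  case (one \<sigma>)
  then show ?case using keys_boundary_of[of p \<sigma>] assms(2)[OF one] by auto
next
  case (diff a b)
  then show ?case unfolding chain_boundary_diff by (intro keys_diff_subset)
qed auto

lemma chain_boundary_power_subdivision:
  "singular_chain p X c \<Longrightarrow> singular_chain p X ((singular_subdivision p ^^ m) c) \<and>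
    chain_boundary p ((singular_subdivision p ^^ m) c) = (singular_subdivision (p - Suc 0) ^^ m) (chain_boundary p c)"
proof (induction m)
  case (Suc m)
  then show ?case
    using chain_boundary_singular_subdivision[of p X "(singular_subdivision p ^^ m) c"]
      singular_chain_singular_subdivision[of p X "(singular_subdivision p ^^ m) c"] by simp
qed simp

lemma simplex_map_comp_eq:
  "(\<And>x. x \<in> standard_simplex p \<Longrightarrow> f (g (\<sigma> x)) = f' (\<sigma> x)) \<Longrightarrow> simplex_map p f (simplex_map p g \<sigma>) = simplex_map p f' \<sigma>"
  by (auto simp: simplex_map_def fun_eq_iff restrict_def)

section \<open>Equivariant straightening\<close>

context cocompact_simplicial_action
begin

lemma act_cancel:
  assumes "g \<in> carrier G" "h \<in> carrier G" "x \<in> P" "act g x = act h x" shows "g = h"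
proof -
  have "act (inv h \<otimes> g) x = x" using assms by (simp add: act_mult act_inv)
  then have "inv h \<otimes> g = \<one>" using assms act_free by auto
  then show ?thesis using assms by (metis inv_closed inv_equality inv_inv)
qed

lemma max_set_act: "g \<in> carrier G \<Longrightarrow> x \<in> P \<Longrightarrow> v \<in> max_set x \<Longrightarrow> \<phi> g v \<in> max_set (act g x)"
proof -
  assume g: "g \<in> carrier G" and x: "x \<in> P" and v: "v \<in> max_set x"
  have vV: "v \<in> V" using max_set[OF x] v simplex_V by auto
  have "act g x w \<le> act g x (\<phi> g v)" for w
    unfolding act_apply[OF g vV] using v P_nonneg[OF x, of v] by (auto simp: act_def max_set_def)
  then show ?thesis by (simp add: max_set_def)
qed

text \<open>The choice sees only the orbit as a set, so all points of an orbit get the same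
  representative. By freeness \<open>orbit_elt\<close> is then determined, and this makes it
  equivariant.\<close>

definition orbit_rep :: "('a \<Rightarrow> real) \<Rightarrow> 'a \<Rightarrow> real" where
  "orbit_rep x = (SOME y. y \<in> orb (carrier G) x)"

definition orbit_elt :: "('a \<Rightarrow> real) \<Rightarrow> 'b" where
  "orbit_elt x = (SOME g. g \<in> carrier G \<and> act g (orbit_rep x) = x)"

text \<open>An equivariant choice of a vertex at which the barycentric coordinate is maximal.\<close>

definition max_vertex :: "('a \<Rightarrow> real) \<Rightarrow> 'a" where
  "max_vertex x = \<phi> (orbit_elt x) (SOME v. v \<in> max_set (orbit_rep x))"

lemma orbit_rep: "x \<in> P \<Longrightarrow> orbit_rep x \<in> P"
  and orbit_elt: "x \<in> P \<Longrightarrow> orbit_elt x \<in> carrier G" "x \<in> P \<Longrightarrow> act (orbit_elt x) (orbit_rep x) = x"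
proof -
  assume x: "x \<in> P"
  have "x \<in> orb (carrier G) x" unfolding orb_eq[OF x] using act_one[OF x] by (auto intro!: exI[of _ \<one>])
  then have "orbit_rep x \<in> orb (carrier G) x" unfolding orbit_rep_def
    by (rule someI[where P = "\<lambda>y. y \<in> orb (carrier G) x"])
  then obtain h where h: "h \<in> carrier G" "orbit_rep x = act h x" unfolding orb_eq[OF x] by auto
  then show "orbit_rep x \<in> P" using act_P x by auto
  have "inv h \<in> carrier G \<and> act (inv h) (orbit_rep x) = x" using h act_inv x by auto
  then have "orbit_elt x \<in> carrier G \<and> act (orbit_elt x) (orbit_rep x) = x" unfolding orbit_elt_def
    by (rule someI[where P = "\<lambda>g. g \<in> carrier G \<and> act g (orbit_rep x) = x"])
  then show "orbit_elt x \<in> carrier G" "act (orbit_elt x) (orbit_rep x) = x" by auto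
qed

lemma max_vertex: assumes x: "x \<in> P" shows "max_vertex x \<in> max_set x"
proof -
  have "max_set (orbit_rep x) \<noteq> {}" using max_set(1)[OF orbit_rep[OF x]] simplex_nonempty by auto
  then have "(SOME v. v \<in> max_set (orbit_rep x)) \<in> max_set (orbit_rep x)" by (rule some_in_eq[THEN iffD2])
  then show ?thesis unfolding max_vertex_def
    using max_set_act[OF orbit_elt(1)[OF x] orbit_rep[OF x]] orbit_elt(2)[OF x] by simp
qed

lemma max_vertex_support: "x \<in> P \<Longrightarrow> max_vertex x \<in> support x"
  using max_vertex max_set(2) by blast

lemma max_vertex_V: "x \<in> P \<Longrightarrow> max_vertex x \<in> V"
  using max_vertex_support support_V by blast

lemma orbit_elt_act:
  assumes g: "g \<in> carrier G" and x: "x \<in> P" shows "orbit_elt (act g x) = g \<otimes> orbit_elt x"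
proof -
  have gx: "act g x \<in> P" using act_P[OF g x] .
  have rep: "orbit_rep (act g x) = orbit_rep x"
    using orb_eq_iff[OF subgroup_self x gx] g unfolding orbit_rep_def by (metis (no_types, lifting))
  have "act (orbit_elt (act g x)) (orbit_rep x) = act (g \<otimes> orbit_elt x) (orbit_rep x)"
    using orbit_elt(2)[OF gx] orbit_elt[OF x] rep g by (simp add: act_mult)
  then show ?thesis
    using act_cancel[OF orbit_elt(1)[OF gx] _ orbit_rep[OF x]] orbit_elt(1)[OF x] g by auto
qed

lemma max_vertex_act:
  assumes g: "g \<in> carrier G" and x: "x \<in> P" shows "max_vertex (act g x) = \<phi> g (max_vertex x)"
proof -
  have rep: "orbit_rep (act g x) = orbit_rep x"
    using orb_eq_iff[OF subgroup_self x act_P[OF g x]] g unfolding orbit_rep_def by (metis (no_types, lifting))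
  have "max_set (orbit_rep x) \<noteq> {}" using max_set(1)[OF orbit_rep[OF x]] simplex_nonempty by auto
  then have "(SOME v. v \<in> max_set (orbit_rep x)) \<in> max_set (orbit_rep x)" by (rule some_in_eq[THEN iffD2])
  then have "(SOME v. v \<in> max_set (orbit_rep x)) \<in> V" using max_set(1)[OF orbit_rep[OF x]] simplex_V by auto
  then show ?thesis unfolding max_vertex_def rep orbit_elt_act[OF g x] using phi_mult[OF g orbit_elt(1)[OF x]] by simp
qed

lemma max_vertex_vertex: "v \<in> V \<Longrightarrow> max_vertex (vertex v) = v"
  using max_vertex_support[OF vertex_in, of v] by (auto simp: support_def vertex_def split: if_splits)

text \<open>Only the corners of \<open>\<sigma>\<close> enter. If \<open>\<sigma>\<close> lies in
  the open star of \<open>s\<close>, each corner is sent to a vertex of \<open>s\<close>, so the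
  result is an affine simplex inside \<open>s\<close>.\<close>

definition straighten :: "nat \<Rightarrow> ((nat \<Rightarrow> real) \<Rightarrow> 'a \<Rightarrow> real) \<Rightarrow> (nat \<Rightarrow> real) \<Rightarrow> 'a \<Rightarrow> real" where
  "straighten p \<sigma> = affine_simplex p (\<lambda>i. max_vertex (\<sigma> (vertex i)))"

definition straighten_chain :: "nat \<Rightarrow> ('a \<Rightarrow> real) chain \<Rightarrow> ('a \<Rightarrow> real) chain" where
  "straighten_chain p = frag_extend (\<lambda>\<sigma>. frag_of (straighten p \<sigma>))"

definition affine_simplices :: "nat \<Rightarrow> ((nat \<Rightarrow> real) \<Rightarrow> 'a \<Rightarrow> real) set" where
  "affine_simplices p = {affine_simplex p w | w. w ` {..p} \<in> K}"

lemma straighten_chain_diff: "straighten_chain p (a - b) = straighten_chain p a - straighten_chain p b"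
  by (simp add: straighten_chain_def frag_extend_diff)

lemma straighten_chain_of [simp]: "straighten_chain p (frag_of \<sigma>) = frag_of (straighten p \<sigma>)"
  by (simp add: straighten_chain_def)

lemma straighten_chain_0 [simp]: "straighten_chain p 0 = 0"
  by (simp add: straighten_chain_def)

lemma face_straighten:
  assumes "k \<le> Suc p"
  shows "singular_face (Suc p) k (straighten (Suc p) \<sigma>) = straighten p (singular_face (Suc p) k \<sigma>)"
  unfolding straighten_def face_affine_simplex[OF assms]
  by (rule affine_simplex_cong)
    (simp add: singular_face_apply vertex_in_standard_simplex simplical_face_vertex)

lemma chain_boundary_straighten:
  "chain_boundary (Suc p) (straighten_chain (Suc p) c) = straighten_chain p (chain_boundary (Suc p) c)"
proof -
  have "Poly_Mapping.keys c \<subseteq> UNIV" by simp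
  then show ?thesis
  proof (induction c rule: frag_induction)
    case (one \<sigma>)
    have "straighten_chain p (chain_boundary (Suc p) (frag_of \<sigma>))
       = (\<Sum>k\<le>Suc p. frag_cmul ((-1) ^ k) (frag_of (straighten p (singular_face (Suc p) k \<sigma>))))"
      unfolding chain_boundary_of straighten_chain_def
      by (simp add: frag_extend_sum frag_extend_cmul del: sum.atMost_Suc)
    also have "\<dots> = chain_boundary (Suc p) (straighten_chain (Suc p) (frag_of \<sigma>))"
      by (simp add: chain_boundary_of face_straighten del: sum.atMost_Suc)
    finally show ?case by simp
  next
    case (diff a b)
    then show ?case by (simp add: chain_boundary_diff straighten_chain_diff)
  qed auto
qed

lemma singular_simplex_realization:
  "singular_simplex p (realization K) \<sigma> \<longleftrightarrow>
    continuous_on (standard_simplex p) \<sigma> \<and> \<sigma> ` standard_simplex p \<subseteq> P \<and> \<sigma> \<in> extensional (standard_simplex p)"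
proof -
  have "singular_simplex p (realization K) \<sigma> \<longleftrightarrow> singular_simplex p (top_of_set P) \<sigma>"
    using realization_eq by simp
  then show ?thesis unfolding singular_simplex_top_of_set .
qed

lemma affine_simplex_singular:
  assumes "s \<in> K" "w ` {..p} \<subseteq> s"
  shows "singular_simplex p (top_of_set (closed_simplex s)) (affine_simplex p w)"
    and "singular_simplex p (realization K) (affine_simplex p w)"
proof -
  have "affine_simplex p w x \<in> closed_simplex s" if "x \<in> standard_simplex p" for x
    using affine_simplex_in_closed_simplex[OF simplex_finite[OF assms(1)] assms(2) that] .
  then show "singular_simplex p (top_of_set (closed_simplex s)) (affine_simplex p w)"
    "singular_simplex p (realization K) (affine_simplex p w)"
    using continuous_affine_simplex affine_simplex_extensional closed_simplex_P[OF assms(1)]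
    unfolding singular_simplex_top_of_set singular_simplex_realization by blast+
qed

lemma affine_simplices_I:
  assumes "s \<in> K" "w ` {..p} \<subseteq> s" shows "affine_simplex p w \<in> affine_simplices p"
  unfolding affine_simplices_def using face_in[OF assms] by blast

lemma affine_simplices_singular: "\<sigma> \<in> affine_simplices p \<Longrightarrow> singular_simplex p (realization K) \<sigma>"
  unfolding affine_simplices_def using affine_simplex_singular(2) by blast

lemma affine_simplices_face:
  assumes "\<sigma> \<in> affine_simplices (Suc p)" "k \<le> Suc p" shows "singular_face (Suc p) k \<sigma> \<in> affine_simplices p"
proof -
  obtain w where w: "\<sigma> = affine_simplex (Suc p) w" "w ` {..Suc p} \<in> K"
    using assms by (auto simp: affine_simplices_def)
  show ?thesis unfolding w(1) face_affine_simplex[OF assms(2)]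
    by (rule affine_simplices_I[OF w(2)]) auto
qed

lemma straighten_in:
  assumes "s \<in> K" "\<And>x. x \<in> standard_simplex p \<Longrightarrow> \<sigma> x \<in> P \<and> max_vertex (\<sigma> x) \<in> s"
  shows "straighten p \<sigma> \<in> affine_simplices p" "\<exists>w. straighten p \<sigma> = affine_simplex p w \<and> w ` {..p} \<subseteq> s"
proof -
  have sub: "(\<lambda>i. max_vertex (\<sigma> (vertex i))) ` {..p} \<subseteq> s"
    using assms(2) vertex_in_standard_simplex by auto
  show "straighten p \<sigma> \<in> affine_simplices p" unfolding straighten_def by (rule affine_simplices_I[OF assms(1) sub])
  show "\<exists>w. straighten p \<sigma> = affine_simplex p w \<and> w ` {..p} \<subseteq> s" unfolding straighten_def using sub by blast
qed

lemma max_vertex_open_star: "x \<in> open_star K s \<Longrightarrow> s \<noteq> {} \<Longrightarrow> max_vertex x \<in> s"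
  using max_vertex[of x] open_star_max_set[of x s] open_star_P by blast

definition apex :: "nat \<Rightarrow> ((nat \<Rightarrow> real) \<Rightarrow> 'a \<Rightarrow> real) \<Rightarrow> 'a" where
  "apex p \<sigma> = max_vertex (\<sigma> (vertex 0))"

lemma apex_affine: "w 0 \<in> V \<Longrightarrow> apex p (affine_simplex p w) = w 0"
  by (simp add: apex_def affine_simplex_vertex max_vertex_vertex)

text \<open>Affine simplices with vertices in a fixed simplex \<open>s\<close> are closed under
  faces and under cones from vertices of \<open>s\<close>, and straightening the subdivided
  simplices stays within \<open>s\<close>. The homotopy can therefore be built inside each closed
  simplex separately.\<close>

lemma subdivision_homotopy:
  fixes m :: nat
  defines "F \<equiv> \<lambda>p \<sigma>. straighten_chain p ((singular_subdivision p ^^ m) (frag_of \<sigma>))"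
  assumes c: "Poly_Mapping.keys c \<subseteq> affine_simplices p"
  shows "Poly_Mapping.keys (cone_homotopy apex F p c) \<subseteq> affine_simplices (Suc p) \<and>
     chain_boundary (Suc p) (cone_homotopy apex F p c)
       = c - straighten_chain p ((singular_subdivision p ^^ m) c) - cone_homotopy apex F (p - 1) (chain_boundary p c)"
proof -
  have ext: "frag_extend (F p) c = straighten_chain p ((singular_subdivision p ^^ m) c)" for p c
  proof -
    have "Poly_Mapping.keys c \<subseteq> UNIV" by simp
    then show ?thesis
    proof (induction c rule: frag_induction)
      case (diff a b)
      then show ?case by (simp add: frag_extend_diff singular_subdivision_power_diff straighten_chain_diff)
    qed (auto simp: F_def)
  qed
  have in_simplex: "Poly_Mapping.keys (cone_homotopy apex F p c) \<subseteq> affine_simplices (Suc p) \<and>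
     chain_boundary (Suc p) (cone_homotopy apex F p c)
       = c - frag_extend (F p) c - cone_homotopy apex F (p - 1) (chain_boundary p c)"
    if s: "s \<in> K" and c: "Poly_Mapping.keys c \<subseteq> {affine_simplex p w | w. w ` {..p} \<subseteq> s}" for s p c
  proof -
    define B where "B p = {affine_simplex p w | w. w ` {..p} \<subseteq> s}" for p
    have BI: "affine_simplex p w \<in> B p" if "w ` {..p} \<subseteq> s" for p w using that unfolding B_def by blast
    have BE: "\<exists>w. \<sigma> = affine_simplex p w \<and> w ` {..p} \<subseteq> s" if "\<sigma> \<in> B p" for p \<sigma> using that unfolding B_def by blast
    have sing: "singular_simplex p (top_of_set (closed_simplex s)) \<sigma>" if "\<sigma> \<in> B p" for p \<sigma>
      using BE[OF that] affine_simplex_singular(1)[OF s] by auto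
    have "Poly_Mapping.keys (cone_homotopy apex F p c) \<subseteq> B (Suc p) \<and>
     chain_boundary (Suc p) (cone_homotopy apex F p c)
       = c - frag_extend (F p) c - cone_homotopy apex F (p - 1) (chain_boundary p c)"
    proof (rule cone_homotopy[where A = B and B = B and X = "top_of_set (closed_simplex s)"])
      show "B p \<subseteq> extensional (standard_simplex p)" for p
        using BE affine_simplex_extensional by blast
      show "Poly_Mapping.keys (chain_boundary (Suc p) (frag_of \<sigma>)) \<subseteq> B p" if \<sigma>: "\<sigma> \<in> B (Suc p)" for p \<sigma>
      proof (rule keys_boundary_subset[where B = "{\<sigma>}"])
        fix \<tau> k assume k: "\<tau> \<in> {\<sigma>}" "k \<le> Suc p"
        obtain w where w: "\<sigma> = affine_simplex (Suc p) w" "w ` {..Suc p} \<subseteq> s" using BE[OF \<sigma>] by auto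
        have "(\<lambda>j. w (if j < k then j else Suc j)) ` {..p} \<subseteq> s" using w(2) by auto
        then show "singular_face (Suc p) k \<tau> \<in> B p"
          using k w(1) face_affine_simplex[OF k(2), of w] BI by simp
      qed auto
      show "cone_simplex p (apex p \<sigma>) \<tau> \<in> B (Suc p)" if st: "\<sigma> \<in> B p" "\<tau> \<in> B p" for p \<sigma> \<tau>
      proof -
        obtain w where w: "\<sigma> = affine_simplex p w" "w ` {..p} \<subseteq> s" using BE[OF st(1)] by auto
        obtain w' where w': "\<tau> = affine_simplex p w'" "w' ` {..p} \<subseteq> s" using BE[OF st(2)] by auto
        have "w 0 \<in> s" using w by auto
        then have "apex p \<sigma> \<in> s" unfolding w(1) using apex_affine[of w p] simplex_V[OF s] by auto
        then have "case_nat (apex p \<sigma>) w' ` {..Suc p} \<subseteq> s" using w'(2) by (auto simp: image_subset_iff split: nat.splits)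
        then show ?thesis unfolding w'(1) cone_affine_simplex by (rule BI)
      qed
      show "Poly_Mapping.keys (F p \<sigma>) \<subseteq> B p" if \<sigma>: "\<sigma> \<in> B p" for p \<sigma>
      proof -
        have "singular_chain p (top_of_set (closed_simplex s)) ((singular_subdivision p ^^ m) (frag_of \<sigma>))"
          using chain_boundary_power_subdivision sing[OF \<sigma>] singular_chain_of by blast
        then have "straighten p \<tau> \<in> B p" if "\<tau> \<in> Poly_Mapping.keys ((singular_subdivision p ^^ m) (frag_of \<sigma>))" for \<tau>
        proof -
          have "singular_simplex p (top_of_set (closed_simplex s)) \<tau>"
            using that \<open>singular_chain p _ _\<close> unfolding singular_chain_def by auto
          then have "\<tau> x \<in> closed_simplex s" if "x \<in> standard_simplex p" for x
            using that unfolding singular_simplex_top_of_set by auto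
          then have "\<tau> x \<in> P \<and> max_vertex (\<tau> x) \<in> s" if "x \<in> standard_simplex p" for x
            using that closed_simplex_iff[OF s] max_vertex_support by blast
          then show ?thesis using straighten_in(2)[OF s] BI by metis
        qed
        then show ?thesis unfolding F_def straighten_chain_def
          by (intro order_trans[OF keys_frag_extend]) auto
      qed
      show "chain_boundary (Suc p) (F (Suc p) \<sigma>) = frag_extend (F p) (chain_boundary (Suc p) (frag_of \<sigma>))"
        if \<sigma>: "\<sigma> \<in> B (Suc p)" for p \<sigma>
      proof -
        have "singular_chain (Suc p) (top_of_set (closed_simplex s)) (frag_of \<sigma>)" using sing[OF \<sigma>] by (simp add: singular_chain_of)
        then show ?thesis unfolding ext unfolding F_def chain_boundary_straighten
          using chain_boundary_power_subdivision by (metis diff_Suc_1 One_nat_def)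
      qed
      show "\<exists>\<tau>. F 0 \<sigma> = frag_of \<tau>" if \<sigma>: "\<sigma> \<in> B 0" for \<sigma>
      proof -
        have "singular_chain 0 (top_of_set (closed_simplex s)) (frag_of \<sigma>)" using sing[OF \<sigma>] by (simp add: singular_chain_of)
        then have "(singular_subdivision 0 ^^ k) (frag_of \<sigma>) = frag_of \<sigma>" for k
          by (induction k) (auto simp: singular_subdivision_zero)
        then show ?thesis unfolding F_def by auto
      qed
      show "Poly_Mapping.keys c \<subseteq> B p" using c unfolding B_def .
    qed (use sing in auto)
    moreover have "B (Suc p) \<subseteq> affine_simplices (Suc p)"
      using affine_simplices_I[OF s] unfolding B_def by blast
    ultimately show ?thesis by blast
  qed
  show ?thesis
    unfolding ext[symmetric] using c
  proof (induction c rule: frag_induction)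
    case (one \<sigma>)
    then obtain w where w: "\<sigma> = affine_simplex p w" "w ` {..p} \<in> K" by (auto simp: affine_simplices_def)
    show ?case by (rule in_simplex[OF w(2)]) (use w in auto)
  next
    case (diff a b)
    then show ?case by (simp add: cone_homotopy_diff chain_boundary_diff frag_extend_diff keys_diff_subset)
  qed (auto simp: cone_homotopy_zero)
qed

text \<open>A singular filling is subdivided until its simplices lie in open stars and can be
  straightened. This changes its boundary from \<open>z\<close> to the straightened subdivision of
  \<open>z\<close>; the affine homotopy \<open>D\<close> makes up for the difference.\<close>

lemma affine_cycle_boundary:
  assumes triv: "trivial_group (homology_group (int n) (realization K))"
    and z: "Poly_Mapping.keys z \<subseteq> affine_simplices n" "chain_boundary n z = 0"
  shows "\<exists>y. Poly_Mapping.keys y \<subseteq> affine_simplices (Suc n) \<and> chain_boundary (Suc n) y = z"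
proof -
  let ?X = "realization K"
  have zs: "singular_chain n ?X z"
    using z affine_simplices_singular unfolding singular_chain_def by auto
  then have cyc: "singular_relcycle n ?X {} z" using z by (simp add: singular_cycle)
  have "homologous_rel_set n ?X {} z \<in> carrier (homology_group (int n) ?X)"
    using cyc by (simp add: carrier_relative_homology_group)
  then have "homologous_rel_set n ?X {} z = singular_relboundary_set n ?X {}"
    using triv by (simp add: trivial_group_def)
  then have "singular_relboundary n ?X {} z"
    by (simp add: homologous_rel_set_eq_relboundary)
  then obtain c where c: "singular_chain (Suc n) ?X c" "chain_boundary (Suc n) c = z"
    by (auto simp: singular_boundary)
  obtain m where m: "\<And>m' f. m \<le> m' \<Longrightarrow> f \<in> Poly_Mapping.keys ((singular_subdivision (Suc n) ^^ m') c) \<Longrightarrow>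
      \<exists>U\<in>open_star K ` K. f \<in> standard_simplex (Suc n) \<rightarrow> U"
  proof (rule sufficient_iterated_singular_subdivision_exists[of "open_star K ` K" ?X "Suc n" c])
    show "P \<subseteq> \<Union> (open_star K ` K)" using open_star_cover by simp
  qed (use open_star_open simplex_finite c(1) in auto)
  define y0 where "y0 = straighten_chain (Suc n) ((singular_subdivision (Suc n) ^^ m) c)"
  have "straighten (Suc n) f \<in> affine_simplices (Suc n)"
    if f: "f \<in> Poly_Mapping.keys ((singular_subdivision (Suc n) ^^ m) c)" for f
  proof -
    obtain s where s: "s \<in> K" "f \<in> standard_simplex (Suc n) \<rightarrow> open_star K s" using m[OF order_refl f] by auto
    show ?thesis
      by (rule straighten_in(1)[OF s(1)])
        (use s max_vertex_open_star simplex_nonempty[OF s(1)] open_star_P in blast)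
  qed
  then have y0: "Poly_Mapping.keys y0 \<subseteq> affine_simplices (Suc n)"
    unfolding y0_def straighten_chain_def by (intro order_trans[OF keys_frag_extend]) auto
  have "chain_boundary (Suc n) y0 = straighten_chain n ((singular_subdivision n ^^ m) z)"
    unfolding y0_def chain_boundary_straighten using chain_boundary_power_subdivision[OF c(1), of m] c(2) by simp
  moreover obtain D where "Poly_Mapping.keys D \<subseteq> affine_simplices (Suc n)"
    "chain_boundary (Suc n) D = z - straighten_chain n ((singular_subdivision n ^^ m) z)"
    using subdivision_homotopy[OF z(1), of m] z(2) by (auto simp: cone_homotopy_zero)
  ultimately have "Poly_Mapping.keys (D + y0) \<subseteq> affine_simplices (Suc n) \<and> chain_boundary (Suc n) (D + y0) = z"
    using y0 keys_add[of D y0] by (auto simp: chain_boundary_add)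
  then show ?thesis by blast
qed

section \<open>Straightening small singular chains\<close>

definition small_simplices :: "nat \<Rightarrow> ((nat \<Rightarrow> real) \<Rightarrow> 'a \<Rightarrow> real) set" where
  "small_simplices p = {\<sigma>. \<exists>s\<in>K. singular_simplex p (top_of_set (open_star K s)) \<sigma>}"

abbreviation straighten_homotopy :: "nat \<Rightarrow> ('a \<Rightarrow> real) chain \<Rightarrow> ('a \<Rightarrow> real) chain" where
  "straighten_homotopy \<equiv> cone_homotopy apex (\<lambda>p \<sigma>. frag_of (straighten p \<sigma>))"

lemma small_simplices_singular: "\<sigma> \<in> small_simplices p \<Longrightarrow> singular_simplex p (realization K) \<sigma>"
  using open_star_P unfolding small_simplices_def singular_simplex_top_of_set singular_simplex_realization by blast

text \<open>Cones over simplices in the open star of \<open>s\<close> leave that star, but with apex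
  in \<open>s\<close> they stay in the union of the closed simplices containing \<open>s\<close>.
  This is why \<open>cone_homotopy\<close> is applied with the closed star for \<open>A\<close> and
  the open star for \<open>B\<close>.\<close>

lemma straighten_homotopy:
  assumes c: "Poly_Mapping.keys c \<subseteq> small_simplices p"
  shows "singular_chain (Suc p) (realization K) (straighten_homotopy p c) \<and>
     chain_boundary (Suc p) (straighten_homotopy p c)
       = c - straighten_chain p c - straighten_homotopy (p - 1) (chain_boundary p c)"
proof -
  let ?F = "\<lambda>p \<sigma>. frag_of (straighten p \<sigma>)"
  have in_simplex: "Poly_Mapping.keys (straighten_homotopy p c) \<subseteq> {\<sigma>. singular_simplex (Suc p) (realization K) \<sigma>} \<and>
     chain_boundary (Suc p) (straighten_homotopy p c)
       = c - frag_extend (?F p) c - straighten_homotopy (p - 1) (chain_boundary p c)"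
    if s: "s \<in> K" and c: "Poly_Mapping.keys c \<subseteq> {\<sigma>. singular_simplex p (top_of_set (open_star K s)) \<sigma>}" for s p c
  proof -
    define star where "star = (\<Union>t\<in>{t\<in>K. s \<subseteq> t}. closed_simplex t)"
    define A where "A p = {\<sigma>. singular_simplex p (top_of_set star) \<sigma>}" for p
    define B where "B p = {\<sigma>. singular_simplex p (top_of_set (open_star K s)) \<sigma>}" for p
    have open_star_star: "open_star K s \<subseteq> star"
    proof
      fix x assume x: "x \<in> open_star K s"
      then have "x \<in> P" "s \<subseteq> support x" using open_star_P open_star_support by auto
      then show "x \<in> star" unfolding star_def using P_support(1,2)[of x] by blast
    qed
    have starP: "star \<subseteq> P" unfolding star_def using closed_simplex_P by auto
    have vs: "max_vertex (\<sigma> x) \<in> s" if "\<sigma> \<in> B p" "x \<in> standard_simplex p" for \<sigma> x p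
      using that max_vertex_open_star simplex_nonempty[OF s] unfolding B_def singular_simplex_top_of_set by blast
    have "Poly_Mapping.keys (straighten_homotopy p c) \<subseteq> A (Suc p) \<and>
     chain_boundary (Suc p) (straighten_homotopy p c)
       = c - frag_extend (?F p) c - straighten_homotopy (p - 1) (chain_boundary p c)"
    proof (rule cone_homotopy[where A = A and B = B and X = "top_of_set (open_star K s)"])
      show "B p \<subseteq> A p" for p unfolding A_def B_def singular_simplex_top_of_set using open_star_star by blast
      show "A p \<subseteq> extensional (standard_simplex p)" for p unfolding A_def singular_simplex_top_of_set by blast
      show "Poly_Mapping.keys (chain_boundary (Suc p) (frag_of \<sigma>)) \<subseteq> B p" if \<sigma>: "\<sigma> \<in> B (Suc p)" for p \<sigma>
        by (rule keys_boundary_subset[where B = "{\<sigma>}"])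
          (use \<sigma> singular_simplex_singular_face[of "Suc p"] in \<open>auto simp: B_def\<close>)
      show "cone_simplex p (apex p \<sigma>) \<tau> \<in> A (Suc p)" if \<sigma>: "\<sigma> \<in> B p" and \<tau>: "\<tau> \<in> A p" for p \<sigma> \<tau>
      proof -
        have ap: "apex p \<sigma> \<in> s" unfolding apex_def using vs[OF \<sigma>] vertex_in_standard_simplex by blast
        have \<tau>c: "continuous_on (standard_simplex p) \<tau>" and \<tau>s: "\<And>x. x \<in> standard_simplex p \<Longrightarrow> \<exists>t\<in>K. s \<subseteq> t \<and> \<tau> x \<in> closed_simplex t"
          using \<tau> unfolding A_def singular_simplex_top_of_set star_def by blast+
        have "continuous_on (standard_simplex (Suc p)) (cone_simplex p (apex p \<sigma>) \<tau>)"
        proof (rule continuous_cone_simplex[OF \<tau>c])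
          fix x u assume "x \<in> standard_simplex p"
          from \<tau>s[OF this] obtain t where "t \<in> K" "\<tau> x \<in> closed_simplex t" by blast
          then show "\<bar>\<tau> x u\<bar> \<le> 1" using closed_simplex_bound[OF simplex_finite] by blast
        qed
        moreover have "cone_simplex p (apex p \<sigma>) \<tau> x \<in> star" if x: "x \<in> standard_simplex (Suc p)" for x
        proof -
          have "\<exists>t\<in>K. s \<subseteq> t \<and> (x 0 \<noteq> 1 \<longrightarrow> \<tau> (\<lambda>i. x (Suc i) / (1 - x 0)) \<in> closed_simplex t)"
            using \<tau>s standard_simplex_tail[OF x] s by blast
          then obtain t where t: "t \<in> K" "s \<subseteq> t" "x 0 \<noteq> 1 \<Longrightarrow> \<tau> (\<lambda>i. x (Suc i) / (1 - x 0)) \<in> closed_simplex t" by blast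
          have "cone_simplex p (apex p \<sigma>) \<tau> x \<in> closed_simplex t"
          proof (rule cone_simplex_in_closed_simplex)
            show "x 0 \<noteq> 1 \<Longrightarrow> \<tau> (\<lambda>i. x (Suc i) / (1 - x 0)) \<in> closed_simplex t" by (rule t(3))
          qed (use ap t x simplex_finite in auto)
          then show ?thesis unfolding star_def using t by blast
        qed
        ultimately show ?thesis unfolding A_def singular_simplex_top_of_set
          by (simp add: image_subset_iff cone_simplex_extensional)
      qed
      show "Poly_Mapping.keys (frag_of (straighten p \<sigma>)) \<subseteq> A p" if \<sigma>: "\<sigma> \<in> B p" for p \<sigma>
      proof -
        have "\<sigma> x \<in> P \<and> max_vertex (\<sigma> x) \<in> s" if "x \<in> standard_simplex p" for x
          using vs[OF \<sigma> that] \<sigma> that open_star_P unfolding B_def singular_simplex_top_of_set by blast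
        then obtain w where w: "straighten p \<sigma> = affine_simplex p w" "w ` {..p} \<subseteq> s" using straighten_in(2)[OF s] by metis
        have "closed_simplex s \<subseteq> star" unfolding star_def using s by blast
        then have "straighten p \<sigma> \<in> A p"
          using affine_simplex_singular(1)[OF s w(2)] unfolding A_def w(1) singular_simplex_top_of_set by blast
        then show ?thesis by simp
      qed
      show "chain_boundary (Suc p) (frag_of (straighten (Suc p) \<sigma>)) = frag_extend (?F p) (chain_boundary (Suc p) (frag_of \<sigma>))" for p \<sigma>
        using chain_boundary_straighten[of p "frag_of \<sigma>"] by (simp add: straighten_chain_def)
      show "Poly_Mapping.keys c \<subseteq> B p" using c unfolding B_def .
    qed (auto simp: B_def)
    moreover have "A (Suc p) \<subseteq> {\<sigma>. singular_simplex (Suc p) (realization K) \<sigma>}"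
      unfolding A_def singular_simplex_top_of_set singular_simplex_realization using starP by blast
    ultimately show ?thesis by blast
  qed
  have "Poly_Mapping.keys (straighten_homotopy p c) \<subseteq> {\<sigma>. singular_simplex (Suc p) (realization K) \<sigma>} \<and>
     chain_boundary (Suc p) (straighten_homotopy p c)
       = c - frag_extend (?F p) c - straighten_homotopy (p - 1) (chain_boundary p c)"
    using c
  proof (induction c rule: frag_induction)
    case (one \<sigma>)
    then obtain s where s: "s \<in> K" "singular_simplex p (top_of_set (open_star K s)) \<sigma>" by (auto simp: small_simplices_def)
    show ?case by (rule in_simplex[OF s(1)]) (use s in auto)
  next
    case (diff a b)
    then show ?case by (simp add: cone_homotopy_diff chain_boundary_diff frag_extend_diff keys_diff_subset)
  qed (auto simp: cone_homotopy_zero)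
  then show ?thesis unfolding singular_chain_def straighten_chain_def by blast
qed

section \<open>Equivariance of straightening and of its homotopy\<close>

lemma affine_simplex_act:
  assumes "g \<in> carrier G" "w ` {..p} \<subseteq> V"
  shows "affine_simplex p (\<lambda>i. \<phi> g (w i)) = simplex_map p (act g) (affine_simplex p w)"
proof
  fix x
  have "(\<Sum>i\<le>p. x i * vertex (\<phi> g (w i)) u) = act g (\<lambda>u. \<Sum>i\<le>p. x i * vertex (w i) u) u" for u
  proof (cases "u \<in> V")
    case True
    have "vertex (\<phi> g (w i)) u = vertex (w i) (\<phi> (inv g) u)" if "i \<le> p" for i
    proof -
      have "w i \<in> V" using assms(2) that by auto
      from phi_inv[OF assms(1) this] phi_inv'[OF assms(1) True] show ?thesis by (auto simp: vertex_def)
    qed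
    then show ?thesis using True by (simp add: act_def)
  next
    case False
    have "vertex (\<phi> g (w i)) u = 0" if "i \<le> p" for i
      using assms that False phi_V by (auto simp: vertex_def)
    then show ?thesis using False by (simp add: act_def)
  qed
  then show "affine_simplex p (\<lambda>i. \<phi> g (w i)) x = simplex_map p (act g) (affine_simplex p w) x"
    by (auto simp: affine_simplex_def simplex_map_def)
qed

lemma cone_simplex_act:
  assumes "g \<in> carrier G" "v \<in> V"
  shows "cone_simplex p (\<phi> g v) (simplex_map p (act g) \<sigma>) = simplex_map (Suc p) (act g) (cone_simplex p v \<sigma>)"
proof
  fix x
  show "cone_simplex p (\<phi> g v) (simplex_map p (act g) \<sigma>) x = simplex_map (Suc p) (act g) (cone_simplex p v \<sigma>) x"
  proof (cases "x \<in> standard_simplex (Suc p)")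
    case x: True
    have v: "vertex (\<phi> g v) u = (if u \<in> V then vertex v (\<phi> (inv g) u) else 0)" for u
      using assms phi_inv phi_inv' phi_V by (auto simp: vertex_def)
    show ?thesis
      using x standard_simplex_tail[OF x] by (auto simp: cone_simplex_def simplex_map_def v act_def fun_eq_iff)
  qed (simp add: cone_simplex_def simplex_map_def)
qed

lemma cone_act:
  assumes "g \<in> carrier G" "v \<in> V"
  shows "cone p (\<phi> g v) (chain_map p (act g) c) = chain_map (Suc p) (act g) (cone p v c)"
proof -
  have "Poly_Mapping.keys c \<subseteq> UNIV" by simp
  then show ?thesis
  proof (induction c rule: frag_induction)
    case (one \<sigma>)
    then show ?case by (simp add: cone_def cone_simplex_act[OF assms])
  next
    case (diff a b)
    then show ?case by (simp add: cone_def frag_extend_diff chain_map_diff)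
  qed (auto simp: cone_def)
qed

lemma straighten_act:
  assumes g: "g \<in> carrier G" and \<sigma>: "singular_simplex p (realization K) \<sigma>"
  shows "straighten p (simplex_map p (act g) \<sigma>) = simplex_map p (act g) (straighten p \<sigma>)"
proof -
  have P: "\<sigma> (vertex i) \<in> P" if "i \<le> p" for i
    using \<sigma> vertex_in_standard_simplex[OF that] unfolding singular_simplex_realization by blast
  have "straighten p (simplex_map p (act g) \<sigma>) = affine_simplex p (\<lambda>i. \<phi> g (max_vertex (\<sigma> (vertex i))))"
    unfolding straighten_def
    by (rule affine_simplex_cong) (use P vertex_in_standard_simplex in \<open>auto simp: simplex_map_def max_vertex_act[OF g]\<close>)
  also have "\<dots> = simplex_map p (act g) (straighten p \<sigma>)"
    unfolding straighten_def by (rule affine_simplex_act[OF g]) (use P max_vertex_V in auto)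
  finally show ?thesis .
qed

lemma apex_act:
  assumes "g \<in> carrier G" "singular_simplex p (realization K) \<sigma>"
  shows "apex p (simplex_map p (act g) \<sigma>) = \<phi> g (apex p \<sigma>)" "apex p \<sigma> \<in> V"
proof -
  have "\<sigma> (vertex 0) \<in> P"
    using assms vertex_in_standard_simplex[of 0 p] unfolding singular_simplex_realization by blast
  then show "apex p (simplex_map p (act g) \<sigma>) = \<phi> g (apex p \<sigma>)" "apex p \<sigma> \<in> V"
    using assms vertex_in_standard_simplex[of 0 p] max_vertex_V
    by (auto simp: apex_def simplex_map_def max_vertex_act)
qed

text \<open>Apexes, straightenings and cones all commute with the action, so the recursion does too.
  This lets the homotopy be defined on the quotient through an arbitrary lift.\<close>

lemma straighten_homotopy_act:
  assumes g: "g \<in> carrier G" and c: "singular_chain p (realization K) c"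
  shows "straighten_homotopy p (chain_map p (act g) c) = chain_map (Suc p) (act g) (straighten_homotopy p c)"
  using c
proof (induction p arbitrary: c)
  case 0
  then show ?case
    unfolding singular_chain_def
  proof (induction c rule: frag_induction)
    case (one \<sigma>)
    then have \<sigma>: "singular_simplex 0 (realization K) \<sigma>" by simp
    show ?case
      by (simp add: apex_act[OF g \<sigma>] straighten_act[OF g \<sigma>] cone_act[OF g apex_act(2)[OF g \<sigma>], symmetric] chain_map_diff)
  next
    case (diff a b)
    then show ?case by (simp add: cone_homotopy_diff chain_map_diff del: cone_homotopy.simps)
  qed (auto simp: cone_homotopy_zero)
next
  case (Suc p)
  note IH = Suc.IH
  from Suc.prems show ?case
    unfolding singular_chain_def
  proof (induction c rule: frag_induction)
    case (one \<sigma>)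
    then have \<sigma>: "singular_simplex (Suc p) (realization K) \<sigma>" by simp
    then have \<sigma>c: "singular_chain (Suc p) (realization K) (frag_of \<sigma>)" by (simp add: singular_chain_of)
    have bd: "chain_boundary (Suc p) (frag_of (simplex_map (Suc p) (act g) \<sigma>)) = chain_map p (act g) (chain_boundary (Suc p) (frag_of \<sigma>))"
      using chain_boundary_chain_map[OF \<sigma>c, of "act g"] by simp
    have "singular_chain p (realization K) (chain_boundary (Suc p) (frag_of \<sigma>))"
      using singular_chain_boundary[OF \<sigma>c] by simp
    from IH[OF this] show ?case
      by (simp add: apex_act[OF g \<sigma>] straighten_act[OF g \<sigma>] cone_act[OF g apex_act(2)[OF g \<sigma>], symmetric] chain_map_diff bd)
  next
    case (diff a b)
    then show ?case by (simp add: cone_homotopy_diff chain_map_diff del: cone_homotopy.simps)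
  qed (auto simp: cone_homotopy_zero)
qed

end

section \<open>Chains on the quotient\<close>

locale simplicial_covering = cocompact_simplicial_action +
  fixes H :: "'b set"
  assumes subH: "subgroup H G"
begin

abbreviation "Y \<equiv> orbit_space G K \<phi> H"
abbreviation "q \<equiv> orb H"

lemma H_carrier: "h \<in> H \<Longrightarrow> h \<in> carrier G"
  using subgroup.subset[OF subH] by auto

lemma q_act: "h \<in> H \<Longrightarrow> x \<in> P \<Longrightarrow> q (act h x) = q x"
  using orb_eq_iff[OF subH, of x "act h x"] act_P H_carrier by auto

lemma singular_simplex_q: "singular_simplex p (realization K) \<sigma> \<Longrightarrow> singular_simplex p Y (simplex_map p q \<sigma>)"
  by (rule singular_simplex_simplex_map[OF _ continuous_orb])

lemma singular_chain_q: "singular_chain p (realization K) c \<Longrightarrow> singular_chain p Y (chain_map p q c)"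
  by (rule singular_chain_chain_map[OF _ continuous_orb])

lemma simplex_map_q_act:
  assumes "h \<in> H" "singular_simplex p (realization K) \<sigma>"
  shows "simplex_map p q (simplex_map p (act h) \<sigma>) = simplex_map p q \<sigma>"
  using assms q_act unfolding singular_simplex_realization by (intro simplex_map_comp_eq) blast

lemma chain_map_q_act:
  assumes h: "h \<in> H" and c: "singular_chain p (realization K) c"
  shows "chain_map p q (chain_map p (act h) c) = chain_map p q c"
  using c unfolding singular_chain_def
proof (induction c rule: frag_induction)
  case (one \<sigma>)
  then show ?case by (simp add: simplex_map_q_act[OF h])
next
  case (diff a b)
  then show ?case by (simp add: chain_map_diff)
qed auto

text \<open>The orbit map is continuous and open, and it is injective on an open star because two
  points of the star in one orbit differ by an element that \<open>open_star_free\<close> shows to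
  be trivial.\<close>

lemma homeomorphic_open_star:
  assumes s: "s \<in> K"
  shows "homeomorphic_map (subtopology (realization K) (open_star K s)) (subtopology Y (q ` open_star K s)) q"
proof (rule bijective_open_imp_homeomorphic_map)
  let ?X = "subtopology (realization K) (open_star K s)" and ?Z = "subtopology Y (q ` open_star K s)"
  have tX: "topspace ?X = open_star K s" using open_star_P by auto
  have tZ: "topspace ?Z = q ` open_star K s" using open_star_P by (auto simp: topspace_orbit_space)
  have op: "openin (realization K) (open_star K s)" using open_star_open simplex_finite[OF s] by auto
  show "continuous_map ?X ?Z q"
    unfolding continuous_map_in_subtopology using continuous_map_from_subtopology[OF continuous_orb] tX by auto
  show "open_map ?X ?Z q"
    unfolding open_map_def
  proof (intro allI impI)
    fix U assume "openin ?X U"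
    then have U: "openin (realization K) U" "U \<subseteq> open_star K s" using op by (auto simp: openin_open_subtopology)
    then have "openin Y (q ` U)" using openin_orb_image[OF subH] by auto
    then show "openin ?Z (q ` U)" using U by (auto simp: openin_subtopology)
  qed
  show "q ` topspace ?X = topspace ?Z" using tX tZ by simp
  show "inj_on q (topspace ?X)"
  proof (rule inj_onI)
    fix x y assume xy: "x \<in> topspace ?X" "y \<in> topspace ?X" "q x = q y"
    then have U: "x \<in> open_star K s" "y \<in> open_star K s" "x \<in> P" "y \<in> P" using tX open_star_P by auto
    then obtain h where h: "h \<in> H" "y = act h x" using orb_eq_iff[OF subH] xy(3) by blast
    then have "h = \<one>" using open_star_free[OF H_carrier s U(1)] U(2) by auto
    then show "x = y" using h act_one U(3) by simp
  qed
qed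

lemma lift_small:
  assumes s: "s \<in> K" and \<tau>: "singular_simplex p Y \<tau>" "\<tau> \<in> standard_simplex p \<rightarrow> q ` open_star K s"
  obtains \<sigma> where "singular_simplex p (top_of_set (open_star K s)) \<sigma>" "simplex_map p q \<sigma> = \<tau>"
proof -
  let ?X = "subtopology (realization K) (open_star K s)" and ?Z = "subtopology Y (q ` open_star K s)"
  obtain g where g: "homeomorphic_maps ?X ?Z q g"
    using homeomorphic_open_star[OF s] unfolding homeomorphic_map_maps by blast
  have tZ: "topspace ?Z = q ` open_star K s" using open_star_P by (auto simp: topspace_orbit_space)
  have \<tau>Z: "singular_simplex p ?Z \<tau>" using \<tau> by (auto simp: singular_simplex_subtopology)
  have "?X = subtopology (top_of_set P) (open_star K s)" using realization_eq by simp
  also have "\<dots> = top_of_set (open_star K s)"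
    using open_star_P[of s] by (simp add: subtopology_subtopology inf.absorb2)
  finally have X: "?X = top_of_set (open_star K s)" .
  have "singular_simplex p ?X (simplex_map p g \<tau>)"
    by (rule singular_simplex_simplex_map[OF \<tau>Z]) (use g in \<open>simp add: homeomorphic_maps_def\<close>)
  moreover have "simplex_map p q (simplex_map p g \<tau>) = \<tau>"
  proof
    fix x
    show "simplex_map p q (simplex_map p g \<tau>) x = \<tau> x"
    proof (cases "x \<in> standard_simplex p")
      case True
      then have "\<tau> x \<in> topspace ?Z" using \<tau>(2) tZ by auto
      then have "q (g (\<tau> x)) = \<tau> x" using g by (simp add: homeomorphic_maps_def)
      then show ?thesis using True by (simp add: simplex_map_def)
    next
      case False
      then show ?thesis using \<tau>(1) by (auto simp: simplex_map_def singular_simplex_def extensional_def)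
    qed
  qed
  ultimately show ?thesis using that X by simp
qed

text \<open>Two lifts of a simplex differ by a group element that is locally constant, hence constant.\<close>

lemma lift_unique:
  assumes \<sigma>: "singular_simplex p (realization K) \<sigma>" and \<sigma>': "singular_simplex p (realization K) \<sigma>'"
    and eq: "simplex_map p q \<sigma> = simplex_map p q \<sigma>'"
  obtains h where "h \<in> H" "\<sigma>' = simplex_map p (act h) \<sigma>"
proof -
  let ?S = "standard_simplex p"
  have c: "continuous_on ?S \<sigma>" "continuous_on ?S \<sigma>'" and P: "\<And>x. x \<in> ?S \<Longrightarrow> \<sigma> x \<in> P" "\<And>x. x \<in> ?S \<Longrightarrow> \<sigma>' x \<in> P"
    and e: "\<sigma>' \<in> extensional ?S"
    using \<sigma> \<sigma>' unfolding singular_simplex_realization by blast+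
  have "\<exists>h. h \<in> H \<and> \<sigma>' x = act h (\<sigma> x)" if x: "x \<in> ?S" for x
  proof -
    have "q (\<sigma> x) = q (\<sigma>' x)" using fun_cong[OF eq, of x] x by (simp add: simplex_map_def)
    then show ?thesis using orb_eq_iff[OF subH P(1)[OF x] P(2)[OF x]] by auto
  qed
  then obtain k where k: "\<And>x. x \<in> ?S \<Longrightarrow> k x \<in> H \<and> \<sigma>' x = act (k x) (\<sigma> x)" by metis
  have loc: "\<forall>x\<in>?S. eventually (\<lambda>y. k x = k y) (at x within ?S)"
  proof
    fix x assume x: "x \<in> ?S"
    have kx: "k x \<in> H" "k x \<in> carrier G" using k[OF x] H_carrier by auto
    obtain s where s: "s \<in> K" "\<sigma> x \<in> open_star K s" using open_star_cover P(1)[OF x] by auto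
    \<comment> \<open>For \<open>y\<close> near \<open>x\<close>, both \<open>\<sigma> y\<close> and
      the translate of \<open>\<sigma>' y\<close> by \<open>inv (k x)\<close> lie in this star. They
      differ by \<open>inv (k x) \<otimes> k y\<close>, which is trivial by
      \<open>open_star_free\<close>.\<close>
    obtain W where W: "open W" "open_star K s = P \<inter> W"
      using open_star_open[OF simplex_finite[OF s(1)]] realization_eq openin_open by metis
    have c': "continuous_on ?S (\<lambda>y. act (inv (k x)) (\<sigma>' y))"
      by (rule continuous_on_compose2[OF continuous_act c(2)]) (use kx in auto)
    have "((\<lambda>y. \<sigma> y) \<longlongrightarrow> \<sigma> x) (at x within ?S)" using c(1) x by (auto simp: continuous_on_def)
    then have e1: "eventually (\<lambda>y. \<sigma> y \<in> W) (at x within ?S)"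
      by (rule topological_tendstoD) (use W s in auto)
    have ix: "act (inv (k x)) (\<sigma>' x) = \<sigma> x" using k[OF x] act_inv kx P(1)[OF x] by simp
    have "((\<lambda>y. act (inv (k x)) (\<sigma>' y)) \<longlongrightarrow> act (inv (k x)) (\<sigma>' x)) (at x within ?S)"
      using c' x by (auto simp: continuous_on_def)
    then have e2: "eventually (\<lambda>y. act (inv (k x)) (\<sigma>' y) \<in> W) (at x within ?S)"
      by (rule topological_tendstoD) (use W s ix in auto)
    have e3: "eventually (\<lambda>y. y \<in> ?S) (at x within ?S)" by (simp add: eventually_at_filter)
    show "eventually (\<lambda>y. k x = k y) (at x within ?S)"
      using e1 e2 e3
    proof eventually_elim
      case (elim y)
      have ky: "k y \<in> carrier G" "\<sigma>' y = act (k y) (\<sigma> y)" using k[OF elim(3)] H_carrier by auto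
      have "\<sigma> y \<in> open_star K s" using elim W P by auto
      moreover have "act (inv (k x) \<otimes> k y) (\<sigma> y) \<in> open_star K s"
        using elim W P(2)[OF elim(3)] act_P[of "inv (k x)"] kx ky by (auto simp: act_mult)
      ultimately have "inv (k x) \<otimes> k y = \<one>" using open_star_free[of "inv (k x) \<otimes> k y" s "\<sigma> y"] s(1) kx ky by auto
      then show "k x = k y" using kx ky by (metis inv_closed inv_equality inv_inv)
    qed
  qed
  have con: "connected ?S" using connectedin_standard_simplex[of p] by (simp add: euclidean_product_topology)
  have x0: "vertex 0 \<in> ?S" by (simp add: vertex_in_standard_simplex)
  have const: "k (vertex 0) = k y" if "y \<in> ?S" for y
    by (rule connected_local_const[OF con x0 that loc])
  have "\<sigma>' = simplex_map p (act (k (vertex 0))) \<sigma>"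
  proof
    fix x show "\<sigma>' x = simplex_map p (act (k (vertex 0))) \<sigma> x"
      using k const e by (cases "x \<in> ?S") (auto simp: simplex_map_def extensional_def)
  qed
  then show ?thesis using that k[OF x0] by blast
qed

section \<open>Straightening on the quotient\<close>

definition lift :: "nat \<Rightarrow> ((nat \<Rightarrow> real) \<Rightarrow> ('a \<Rightarrow> real) set) \<Rightarrow> (nat \<Rightarrow> real) \<Rightarrow> 'a \<Rightarrow> real" where
  "lift p \<tau> = (SOME \<sigma>. singular_simplex p (realization K) \<sigma> \<and> simplex_map p q \<sigma> = \<tau>)"

lemma lift_q:
  assumes \<sigma>: "singular_simplex p (realization K) \<sigma>"
  obtains h where "h \<in> H" "lift p (simplex_map p q \<sigma>) = simplex_map p (act h) \<sigma>"
proof -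
  have "singular_simplex p (realization K) (lift p (simplex_map p q \<sigma>)) \<and> simplex_map p q (lift p (simplex_map p q \<sigma>)) = simplex_map p q \<sigma>"
    unfolding lift_def by (rule someI[where x = \<sigma>]) (use \<sigma> in auto)
  then show ?thesis using lift_unique[OF \<sigma>] that by metis
qed

text \<open>Lift, straighten, project. Another lift differs by an element of \<open>H\<close>, and
  by equivariance the projection forgets it.\<close>

definition straighten_q :: "nat \<Rightarrow> ('a \<Rightarrow> real) set chain \<Rightarrow> ('a \<Rightarrow> real) set chain" where
  "straighten_q p = frag_extend (\<lambda>\<tau>. chain_map p q (frag_of (straighten p (lift p \<tau>))))"

definition homotopy_q :: "nat \<Rightarrow> ('a \<Rightarrow> real) set chain \<Rightarrow> ('a \<Rightarrow> real) set chain" where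
  "homotopy_q p = frag_extend (\<lambda>\<tau>. chain_map (Suc p) q (straighten_homotopy p (frag_of (lift p \<tau>))))"

lemma straighten_singular: "singular_simplex p (realization K) \<sigma> \<Longrightarrow> \<exists>s\<in>K. \<sigma> ` standard_simplex p \<subseteq> open_star K s \<Longrightarrow> straighten p \<sigma> \<in> affine_simplices p"
proof -
  assume \<sigma>: "singular_simplex p (realization K) \<sigma>" and "\<exists>s\<in>K. \<sigma> ` standard_simplex p \<subseteq> open_star K s"
  then obtain s where s: "s \<in> K" "\<sigma> ` standard_simplex p \<subseteq> open_star K s" by auto
  show ?thesis
    by (rule straighten_in(1)[OF s(1)]) (use s max_vertex_open_star simplex_nonempty[OF s(1)] open_star_P in blast)
qed

lemma straighten_small: "\<sigma> \<in> small_simplices p \<Longrightarrow> straighten p \<sigma> \<in> affine_simplices p"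
  using straighten_singular small_simplices_singular
  unfolding small_simplices_def singular_simplex_top_of_set by blast

lemma straighten_q_map:
  assumes c: "Poly_Mapping.keys c \<subseteq> small_simplices p"
  shows "straighten_q p (chain_map p q c) = chain_map p q (straighten_chain p c)"
  using c
proof (induction c rule: frag_induction)
  case (one \<sigma>)
  then have \<sigma>: "singular_simplex p (realization K) \<sigma>" using small_simplices_singular by auto
  obtain h where h: "h \<in> H" "lift p (simplex_map p q \<sigma>) = simplex_map p (act h) \<sigma>" using lift_q[OF \<sigma>] .
  have "singular_simplex p (realization K) (straighten p \<sigma>)"
    using straighten_small[OF one] affine_simplices_singular by auto
  then show ?case
    by (simp add: straighten_q_def h straighten_act[OF H_carrier[OF h(1)] \<sigma>] simplex_map_q_act[OF h(1)])
next
  case (diff a b)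
  then show ?case by (simp add: straighten_q_def chain_map_diff frag_extend_diff straighten_chain_diff)
qed (auto simp: straighten_q_def)

lemma homotopy_q_map:
  assumes c: "Poly_Mapping.keys c \<subseteq> small_simplices p"
  shows "homotopy_q p (chain_map p q c) = chain_map (Suc p) q (straighten_homotopy p c)"
  using c
proof (induction c rule: frag_induction)
  case (one \<sigma>)
  then have \<sigma>: "singular_simplex p (realization K) \<sigma>" using small_simplices_singular by auto
  obtain h where h: "h \<in> H" "lift p (simplex_map p q \<sigma>) = simplex_map p (act h) \<sigma>" using lift_q[OF \<sigma>] .
  have "singular_chain (Suc p) (realization K) (straighten_homotopy p (frag_of \<sigma>))"
    using straighten_homotopy[of "frag_of \<sigma>" p] one by simp
  moreover have "straighten_homotopy p (frag_of (simplex_map p (act h) \<sigma>)) = chain_map (Suc p) (act h) (straighten_homotopy p (frag_of \<sigma>))"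
    using straighten_homotopy_act[OF H_carrier[OF h(1)], of p "frag_of \<sigma>"] \<sigma> by (simp add: singular_chain_of)
  ultimately show ?case
    by (simp add: homotopy_q_def h chain_map_q_act[OF h(1)])
next
  case (diff a b)
  then show ?case by (simp add: homotopy_q_def chain_map_diff frag_extend_diff cone_homotopy_diff)
qed (auto simp: homotopy_q_def cone_homotopy_zero)

definition small_q :: "nat \<Rightarrow> ((nat \<Rightarrow> real) \<Rightarrow> ('a \<Rightarrow> real) set) set" where
  "small_q p = {\<tau>. singular_simplex p Y \<tau> \<and> (\<exists>s\<in>K. \<tau> \<in> standard_simplex p \<rightarrow> q ` open_star K s)}"

lemma small_q_chain: "Poly_Mapping.keys z \<subseteq> small_q p \<Longrightarrow> singular_chain p Y z"
  unfolding small_q_def singular_chain_def by auto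

lemma lift_small_chain:
  assumes "Poly_Mapping.keys z \<subseteq> small_q p"
  shows "\<exists>c. Poly_Mapping.keys c \<subseteq> small_simplices p \<and> chain_map p q c = z"
  using assms
proof (induction z rule: frag_induction)
  case (one \<tau>)
  then obtain s where s: "singular_simplex p Y \<tau>" "s \<in> K" "\<tau> \<in> standard_simplex p \<rightarrow> q ` open_star K s"
    by (auto simp: small_q_def)
  obtain \<sigma> where "singular_simplex p (top_of_set (open_star K s)) \<sigma>" "simplex_map p q \<sigma> = \<tau>"
    using lift_small[OF s(2,1,3)] .
  then show ?case using s(2) by (intro exI[of _ "frag_of \<sigma>"]) (auto simp: small_simplices_def)
next
  case (diff a b)
  then obtain c d where "Poly_Mapping.keys c \<subseteq> small_simplices p" "chain_map p q c = a"
    "Poly_Mapping.keys d \<subseteq> small_simplices p" "chain_map p q d = b" by auto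
  then show ?case by (intro exI[of _ "c - d"] conjI keys_diff_subset) (auto simp: chain_map_diff)
qed (auto intro: exI[of _ 0])

lemma small_simplices_boundary:
  "Poly_Mapping.keys c \<subseteq> small_simplices (Suc p) \<Longrightarrow> Poly_Mapping.keys (chain_boundary (Suc p) c) \<subseteq> small_simplices p"
  by (erule keys_boundary_subset)
    (use singular_simplex_singular_face[of "Suc p"] in \<open>auto simp: small_simplices_def\<close>)

lemma small_chain_singular: "Poly_Mapping.keys c \<subseteq> small_simplices p \<Longrightarrow> singular_chain p (realization K) c"
  unfolding singular_chain_def using small_simplices_singular by auto

lemma straighten_chain_keys:
  "Poly_Mapping.keys c \<subseteq> small_simplices p \<Longrightarrow> Poly_Mapping.keys (straighten_chain p c) \<subseteq> affine_simplices p"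
  unfolding straighten_chain_def using straighten_small
  by (intro order_trans[OF keys_frag_extend]) auto

lemma affine_chain_singular: "Poly_Mapping.keys c \<subseteq> affine_simplices p \<Longrightarrow> singular_chain p (realization K) c"
  unfolding singular_chain_def using affine_simplices_singular by auto

definition affine_q :: "nat \<Rightarrow> ((nat \<Rightarrow> real) \<Rightarrow> ('a \<Rightarrow> real) set) set" where
  "affine_q p = simplex_map p q ` affine_simplices p"

lemma keys_chain_map: "Poly_Mapping.keys (chain_map p f c) \<subseteq> simplex_map p f ` Poly_Mapping.keys c"
  unfolding chain_map_def by (intro order_trans[OF keys_frag_extend]) auto

lemma straighten_q_keys:
  assumes "Poly_Mapping.keys z \<subseteq> small_q p" shows "Poly_Mapping.keys (straighten_q p z) \<subseteq> affine_q p"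
proof -
  obtain c where c: "Poly_Mapping.keys c \<subseteq> small_simplices p" "chain_map p q c = z" using lift_small_chain[OF assms] by auto
  then have "straighten_q p z = chain_map p q (straighten_chain p c)" using straighten_q_map by blast
  then show ?thesis unfolding affine_q_def using keys_chain_map[of p q "straighten_chain p c"] straighten_chain_keys[OF c(1)] by auto
qed

lemma chain_boundary_straighten_q:
  assumes "Poly_Mapping.keys w \<subseteq> small_q (Suc p)"
  shows "straighten_q p (chain_boundary (Suc p) w) = chain_boundary (Suc p) (straighten_q (Suc p) w)"
proof -
  obtain c where c: "Poly_Mapping.keys c \<subseteq> small_simplices (Suc p)" "chain_map (Suc p) q c = w" using lift_small_chain[OF assms] by auto
  have "chain_boundary (Suc p) w = chain_map p q (chain_boundary (Suc p) c)"
    using chain_boundary_chain_map[OF small_chain_singular[OF c(1)]] c(2) by auto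
  then have "straighten_q p (chain_boundary (Suc p) w) = chain_map p q (chain_boundary (Suc p) (straighten_chain (Suc p) c))"
    using straighten_q_map[OF small_simplices_boundary[OF c(1)]] by (simp add: chain_boundary_straighten)
  also have "\<dots> = chain_boundary (Suc p) (chain_map (Suc p) q (straighten_chain (Suc p) c))"
    using chain_boundary_chain_map[OF affine_chain_singular[OF straighten_chain_keys[OF c(1)]], of q] by simp
  finally show ?thesis using straighten_q_map[OF c(1)] c(2) by simp
qed

text \<open>A lift \<open>c\<close> of the cycle \<open>z\<close> need not be a cycle, so the
  homotopy upstairs has an extra term from its boundary. That boundary projects to 0, and as
  \<open>homotopy_q\<close> depends only on the projection, the extra term projects to 0 as
  well.\<close>

lemma straighten_q_homologous:
  assumes z: "Poly_Mapping.keys z \<subseteq> small_q (Suc p)" "chain_boundary (Suc p) z = 0"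
  shows "\<exists>w. singular_chain (Suc (Suc p)) Y w \<and> chain_boundary (Suc (Suc p)) w = z - straighten_q (Suc p) z"
proof -
  obtain c where c: "Poly_Mapping.keys c \<subseteq> small_simplices (Suc p)" "chain_map (Suc p) q c = z" using lift_small_chain[OF z(1)] by auto
  let ?D = "straighten_homotopy (Suc p) c"
  have D: "singular_chain (Suc (Suc p)) (realization K) ?D"
    "chain_boundary (Suc (Suc p)) ?D = c - straighten_chain (Suc p) c - straighten_homotopy p (chain_boundary (Suc p) c)"
    using straighten_homotopy[OF c(1)] by auto
  have "chain_map p q (chain_boundary (Suc p) c) = 0"
    using chain_boundary_chain_map[OF small_chain_singular[OF c(1)], of q] c(2) z(2) by simp
  then have "chain_map (Suc p) q (straighten_homotopy p (chain_boundary (Suc p) c)) = 0"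
    using homotopy_q_map[OF small_simplices_boundary[OF c(1)]] by (simp add: homotopy_q_def)
  then have "chain_map (Suc p) q (chain_boundary (Suc (Suc p)) ?D) = z - straighten_q (Suc p) z"
    unfolding D(2) using c straighten_q_map[OF c(1)] by (simp add: chain_map_diff)
  moreover have "chain_map (Suc p) q (chain_boundary (Suc (Suc p)) ?D) = chain_boundary (Suc (Suc p)) (chain_map (Suc (Suc p)) q ?D)"
    using chain_boundary_chain_map[OF D(1), of q] by simp
  ultimately show ?thesis using singular_chain_q[OF D(1)] by auto
qed

section \<open>Small cycles and small fillings\<close>

lemma open_cover_q:
  shows "\<And>U. U \<in> (\<lambda>s. q ` open_star K s) ` K \<Longrightarrow> openin Y U" and "topspace Y \<subseteq> \<Union>((\<lambda>s. q ` open_star K s) ` K)"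
proof -
  show "openin Y U" if "U \<in> (\<lambda>s. q ` open_star K s) ` K" for U
    using that openin_orb_image[OF subH] open_star_open simplex_finite by auto
  show "topspace Y \<subseteq> \<Union>((\<lambda>s. q ` open_star K s) ` K)"
    unfolding topspace_orbit_space using open_star_cover by blast
qed

lemma small_cycle_exists:
  assumes z: "singular_relcycle p Y {} z"
  obtains z' where "Poly_Mapping.keys z' \<subseteq> small_q p" "singular_relcycle p Y {} z'" "homologous_rel p Y {} z z'"
proof -
  obtain z' where z': "singular_relcycle p Y {} z'" "homologous_rel p Y {} z z'"
    "\<And>f. f \<in> Poly_Mapping.keys z' \<Longrightarrow> \<exists>U\<in>(\<lambda>s. q ` open_star K s) ` K. f \<in> standard_simplex p \<rightarrow> U"
    using small_homologous_rel_relcycle_exists[OF open_cover_q z] by metis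
  have "Poly_Mapping.keys z' \<subseteq> small_q p"
    using z'(1,3) unfolding small_q_def singular_cycle singular_chain_def by blast
  then show ?thesis using that z' by blast
qed

text \<open>Subdividing the filling makes it small but replaces its boundary \<open>z\<close> by the
  subdivision of \<open>z\<close>. The subdivision homotopy \<open>h\<close> maps chains in a
  subspace to chains in that subspace, so \<open>h p z\<close> is small too, and subtracting it
  restores the boundary \<open>z\<close>.\<close>

lemma small_boundary:
  assumes z: "Poly_Mapping.keys z \<subseteq> small_q p" "chain_boundary p z = 0"
    and b: "singular_chain (Suc p) Y c" "chain_boundary (Suc p) c = z"
  shows "\<exists>w. Poly_Mapping.keys w \<subseteq> small_q (Suc p) \<and> chain_boundary (Suc p) w = z"
proof -
  obtain m where m: "\<And>m' f. m \<le> m' \<Longrightarrow> f \<in> Poly_Mapping.keys ((singular_subdivision (Suc p) ^^ m') c) \<Longrightarrow>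
      \<exists>U\<in>(\<lambda>s. q ` open_star K s) ` K. f \<in> standard_simplex (Suc p) \<rightarrow> U"
    using sufficient_iterated_singular_subdivision_exists[OF open_cover_q b(1)] by blast
  define c' where "c' = (singular_subdivision (Suc p) ^^ m) c"
  have c': "singular_chain (Suc p) Y c'" "chain_boundary (Suc p) c' = (singular_subdivision p ^^ m) z"
    using chain_boundary_power_subdivision[OF b(1), of m] b(2) unfolding c'_def by auto
  have kc': "Poly_Mapping.keys c' \<subseteq> small_q (Suc p)"
    using c'(1) m[OF order_refl] unfolding small_q_def c'_def[symmetric] singular_chain_def by blast
  obtain h :: "nat \<Rightarrow> ('a \<Rightarrow> real) set chain \<Rightarrow> ('a \<Rightarrow> real) set chain" where h:
    "\<And>p. h p 0 = 0" "\<And>p c1 c2. h p (c1 - c2) = h p c1 - h p c2"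
    "\<And>p X c. singular_chain p X c \<Longrightarrow> singular_chain (Suc p) X (h p c)"
    "\<And>p X c. singular_chain p X c \<Longrightarrow> chain_boundary (Suc p) (h p c) + h (p - Suc 0) (chain_boundary p c)
       = (singular_subdivision p ^^ m) c - c"
    using chain_homotopic_iterated_singular_subdivision[of m] by blast
  have "Poly_Mapping.keys (h p z) \<subseteq> small_q (Suc p)"
    using z(1)
  proof (induction z rule: frag_induction)
    case (one \<tau>)
    then obtain s where s: "singular_simplex p Y \<tau>" "s \<in> K" "\<tau> \<in> standard_simplex p \<rightarrow> q ` open_star K s"
      by (auto simp: small_q_def)
    then have "singular_chain p (subtopology Y (q ` open_star K s)) (frag_of \<tau>)"
      by (auto simp: singular_chain_of singular_simplex_subtopology)
    from h(3)[OF this] show ?case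
      unfolding singular_chain_def using s(2) by (force simp: small_q_def singular_simplex_subtopology)
  next
    case (diff a b)
    then show ?case by (simp add: h(2) keys_diff_subset)
  qed (auto simp: h(1))
  then have "Poly_Mapping.keys (c' - h p z) \<subseteq> small_q (Suc p)" using kc' by (intro keys_diff_subset)
  moreover have "chain_boundary (Suc p) (c' - h p z) = z"
    using h(4)[OF small_q_chain[OF z(1)]] z(2) h(1) c'(2) by (simp add: chain_boundary_diff)
  ultimately show ?thesis by blast
qed

end

section \<open>Tiles and the torsion estimate\<close>

lemma frag_norm_add: "frag_norm (a + b) \<le> frag_norm a + frag_norm b"
proof -
  let ?S = "Poly_Mapping.keys a \<union> Poly_Mapping.keys b"
  have n: "frag_norm c = (\<Sum>k\<in>?S. \<bar>Poly_Mapping.lookup c k\<bar>)" if "Poly_Mapping.keys c \<subseteq> ?S" for c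
    unfolding frag_norm_def by (rule sum.mono_neutral_left) (use that in \<open>auto simp: in_keys_iff\<close>)
  have "frag_norm (a + b) = (\<Sum>k\<in>?S. \<bar>Poly_Mapping.lookup (a + b) k\<bar>)"
    by (rule n) (rule keys_add)
  also have "\<dots> \<le> (\<Sum>k\<in>?S. \<bar>Poly_Mapping.lookup a k\<bar> + \<bar>Poly_Mapping.lookup b k\<bar>)"
    by (rule sum_mono) (simp add: lookup_add)
  also have "\<dots> = frag_norm a + frag_norm b" using n[of a] n[of b] by (simp add: sum.distrib)
  finally show ?thesis .
qed

lemma frag_norm_sum: "frag_norm (sum f I) \<le> (\<Sum>i\<in>I. frag_norm (f i))"
proof (induction I rule: infinite_finite_induct)
  case (insert i I)
  then show ?case using frag_norm_add[of "f i" "sum f I"] by simp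
qed (auto simp: frag_norm_def)

lemma frag_norm_cmul: "frag_norm (frag_cmul k c) = \<bar>k\<bar> * frag_norm c"
proof (cases "k = 0")
  case False
  then have "Poly_Mapping.keys (frag_cmul k c) = Poly_Mapping.keys c" by (auto simp: in_keys_iff)
  then show ?thesis by (simp add: frag_norm_def abs_mult sum_distrib_left)
qed (simp add: frag_norm_def)

lemma frag_norm_of: "frag_norm (frag_of x) = 1"
  by (simp add: frag_norm_def)

lemma frag_norm_extend:
  assumes "\<And>x. x \<in> Poly_Mapping.keys c \<Longrightarrow> frag_norm (f x) \<le> N"
  shows "frag_norm (frag_extend f c) \<le> N * frag_norm c"
proof -
  have "frag_norm (frag_extend f c) \<le> (\<Sum>x\<in>Poly_Mapping.keys c. frag_norm (frag_cmul (Poly_Mapping.lookup c x) (f x)))"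
    unfolding frag_extend_def by (rule frag_norm_sum)
  also have "\<dots> \<le> (\<Sum>x\<in>Poly_Mapping.keys c. \<bar>Poly_Mapping.lookup c x\<bar> * N)"
    unfolding frag_norm_cmul by (intro sum_mono mult_left_mono assms) auto
  finally show ?thesis by (simp add: frag_norm_def sum_distrib_left mult.commute)
qed

lemma frag_norm_boundary: "frag_norm (chain_boundary (Suc p) (frag_of \<sigma>)) \<le> int p + 2"
proof -
  have "frag_norm (chain_boundary (Suc p) (frag_of \<sigma>))
     \<le> (\<Sum>k\<le>Suc p. frag_norm (frag_cmul ((-1) ^ k) (frag_of (singular_face (Suc p) k \<sigma>))))"
    unfolding chain_boundary_of by (simp only: nat.distinct if_False) (rule frag_norm_sum)
  also have "\<dots> = (\<Sum>k\<le>Suc p. 1)" by (rule sum.cong) (simp_all add: frag_norm_cmul frag_norm_of power_abs)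
  finally show ?thesis by simp
qed

section \<open>Group labels of affine simplices\<close>

context cocompact_simplicial_action
begin

definition vertex_elt :: "'a \<Rightarrow> 'b" where "vertex_elt v = orbit_elt (vertex v)"

lemma act_vertex: "g \<in> carrier G \<Longrightarrow> v \<in> V \<Longrightarrow> act g (vertex v) = vertex (\<phi> g v)"
proof -
  assume g: "g \<in> carrier G" and v: "v \<in> V"
  show ?thesis
  proof
    fix u show "act g (vertex v) u = vertex (\<phi> g v) u"
      using phi_inv[OF g v] phi_inv'[OF g, of u] phi_V[OF g v] by (auto simp: act_def vertex_def)
  qed
qed

lemma vertex_elt: "v \<in> V \<Longrightarrow> vertex_elt v \<in> carrier G"
  unfolding vertex_elt_def using orbit_elt vertex_in by auto

lemma vertex_elt_phi: "g \<in> carrier G \<Longrightarrow> v \<in> V \<Longrightarrow> vertex_elt (\<phi> g v) = g \<otimes> vertex_elt v"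
  unfolding vertex_elt_def using orbit_elt_act[of g "vertex v"] act_vertex vertex_in by simp

lemma apex_V: "\<sigma> \<in> affine_simplices p \<Longrightarrow> apex p \<sigma> \<in> V"
  using apex_act(2)[OF one_closed affine_simplices_singular] .

text \<open>The label is read off the vertex with index 0, so it is equivariant, and every face
  except the one opposite that vertex inherits it.\<close>

definition simplex_elt :: "nat \<Rightarrow> ((nat \<Rightarrow> real) \<Rightarrow> 'a \<Rightarrow> real) \<Rightarrow> 'b" where
  "simplex_elt p \<sigma> = vertex_elt (apex p \<sigma>)"

lemma simplex_elt: "\<sigma> \<in> affine_simplices p \<Longrightarrow> simplex_elt p \<sigma> \<in> carrier G"
  unfolding simplex_elt_def using vertex_elt apex_V by auto

lemma simplex_elt_act:
  "g \<in> carrier G \<Longrightarrow> \<sigma> \<in> affine_simplices p \<Longrightarrow> simplex_elt p (simplex_map p (act g) \<sigma>) = g \<otimes> simplex_elt p \<sigma>"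
  unfolding simplex_elt_def using apex_act(1)[OF _ affine_simplices_singular] vertex_elt_phi apex_V by simp

lemma affine_simplices_act:
  assumes "g \<in> carrier G" "\<sigma> \<in> affine_simplices p" shows "simplex_map p (act g) \<sigma> \<in> affine_simplices p"
proof -
  obtain w where w: "\<sigma> = affine_simplex p w" "w ` {..p} \<in> K" using assms by (auto simp: affine_simplices_def)
  have "(\<lambda>i. \<phi> g (w i)) ` {..p} = \<phi> g ` (w ` {..p})" by auto
  then have "(\<lambda>i. \<phi> g (w i)) ` {..p} \<in> K" using phi_simplex[OF assms(1) w(2)] by simp
  moreover have "simplex_map p (act g) \<sigma> = affine_simplex p (\<lambda>i. \<phi> g (w i))"
    unfolding w(1) using affine_simplex_act[OF assms(1), of w p] simplex_V[OF w(2)] by simp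
  ultimately show ?thesis unfolding affine_simplices_def by blast
qed

lemma simplex_map_act_mult:
  assumes "g \<in> carrier G" "h \<in> carrier G"
  shows "simplex_map p (act g) (simplex_map p (act h) \<sigma>) = simplex_map p (act (g \<otimes> h)) \<sigma>"
  using assms by (intro simplex_map_comp_eq) (simp add: act_mult)

lemma simplex_map_act_one: "singular_simplex p (realization K) \<sigma> \<Longrightarrow> simplex_map p (act \<one>) \<sigma> = \<sigma>"
  by (rule simplex_map_id_gen) (auto intro: act_one)

lemma face_act:
  assumes "k \<le> Suc p" "singular_simplex (Suc p) (realization K) \<sigma>"
  shows "singular_face (Suc p) k (simplex_map (Suc p) (act g) \<sigma>) = simplex_map p (act g) (singular_face (Suc p) k \<sigma>)"
proof (rule singular_face_eqI)
  fix x :: "nat \<Rightarrow> real" assume x: "x \<in> standard_simplex p"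
  have "simplical_face k x \<in> standard_simplex (Suc p)"
    using simplical_face_in_standard_simplex[of "Suc p" k x] x assms by simp
  then show "simplex_map (Suc p) (act g) \<sigma> (simplical_face k x) = simplex_map p (act g) (singular_face (Suc p) k \<sigma>) x"
    using x by (simp add: simplex_map_def singular_face_apply)
qed (simp add: simplex_map_def)

text \<open>A fundamental domain for the action on affine simplices: by equivariance of
  \<open>simplex_elt\<close>, each orbit has exactly one member with trivial label.\<close>

definition base_simplices :: "nat \<Rightarrow> ((nat \<Rightarrow> real) \<Rightarrow> 'a \<Rightarrow> real) set" where
  "base_simplices p = {\<sigma> \<in> affine_simplices p. simplex_elt p \<sigma> = \<one>}"

text \<open>The initial vertex of a base simplex lies in \<open>R\<close>, which has one vertex for
  each of the finitely many vertex orbits. Local finiteness bounds the remaining vertices.\<close>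

lemma base_simplices_finite: "finite (base_simplices p)"
proof -
  obtain K0 where K0: "finite K0" "K0 \<subseteq> K" "\<And>t. t \<in> K \<Longrightarrow> \<exists>g\<in>carrier G. \<exists>s\<in>K0. t = \<phi> g ` s"
    by (rule finite_orbits) (rule that)
  define R where "R = {v \<in> V. vertex_elt v = \<one>}"
  have "R \<subseteq> (\<lambda>u. \<phi> (inv (vertex_elt u)) u) ` \<Union>K0"
  proof
    fix v assume v: "v \<in> R"
    then have "{v} \<in> K" using V_simplex by (auto simp: R_def)
    then obtain g s where gs: "g \<in> carrier G" "s \<in> K0" "{v} = \<phi> g ` s" using K0(3)[of "{v}"] by blast
    then obtain u where u: "u \<in> s" "v = \<phi> g u" by auto
    have uV: "u \<in> V" using simplex_V[of s] u(1) gs(2) K0(2) by blast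
    have "g \<otimes> vertex_elt u = \<one>" using vertex_elt_phi[OF gs(1) uV] u v by (simp add: R_def)
    then have "g = inv (vertex_elt u)" using vertex_elt[OF uV] gs(1) by (metis inv_equality)
    then show "v \<in> (\<lambda>u. \<phi> (inv (vertex_elt u)) u) ` \<Union>K0" using u gs by blast
  qed
  moreover have "finite (\<Union>K0)" using K0 simplex_finite by auto
  ultimately have finR: "finite R" by (meson finite_imageI finite_subset)
  define N where "N = (\<Union>v\<in>R. \<Union>{t \<in> K. v \<in> t})"
  have finN: "finite N" unfolding N_def using finR locally_finite simplex_finite by auto
  have "base_simplices p \<subseteq> affine_simplex p ` ({..p} \<rightarrow>\<^sub>E N)"
  proof
    fix \<sigma> assume \<sigma>: "\<sigma> \<in> base_simplices p"
    then obtain w where w: "\<sigma> = affine_simplex p w" "w ` {..p} \<in> K" by (auto simp: base_simplices_def affine_simplices_def)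
    have w0: "w 0 \<in> w ` {..p}" by auto
    then have w0V: "w 0 \<in> V" using simplex_V[OF w(2)] by auto
    then have "w 0 \<in> R" using \<sigma> apex_affine[of w p, OF w0V] w(1) by (simp add: R_def base_simplices_def simplex_elt_def)
    then have "w ` {..p} \<subseteq> N" unfolding N_def using w(2) w0 by blast
    then have "restrict w {..p} \<in> {..p} \<rightarrow>\<^sub>E N" by auto
    moreover have "\<sigma> = affine_simplex p (restrict w {..p})" unfolding w(1) by (rule affine_simplex_cong) simp
    ultimately show "\<sigma> \<in> affine_simplex p ` ({..p} \<rightarrow>\<^sub>E N)" by blast
  qed
  then show ?thesis using finN by (meson finite_PiE finite_atMost finite_imageI finite_subset)
qed

end

section \<open>Tiles and preferred lifts\<close>

locale tiled_covering = simplicial_covering +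
  fixes f :: "'b set \<Rightarrow> 'b"
  assumes f: "f \<in> rcosets H \<rightarrow> carrier G"
begin

text \<open>The tiles are the fibres of the \<open>H\<close>-equivariant map \<open>tile\<close>. As \<open>H\<close> acts freely on the
  labels, every tile embeds into the quotient.\<close>

definition tile :: "nat \<Rightarrow> ((nat \<Rightarrow> real) \<Rightarrow> 'a \<Rightarrow> real) \<Rightarrow> 'b" where
  "tile p \<sigma> = simplex_elt p \<sigma> \<otimes> f (H #> simplex_elt p \<sigma>)"

lemma f_carrier: "g \<in> carrier G \<Longrightarrow> f (H #> g) \<in> carrier G"
  using f subgroup.subset[OF subH] rcosetsI by blast

lemma tile_carrier: "\<sigma> \<in> affine_simplices p \<Longrightarrow> tile p \<sigma> \<in> carrier G"
  unfolding tile_def using simplex_elt f_carrier by simp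

lemma coset_H: "h \<in> H \<Longrightarrow> g \<in> carrier G \<Longrightarrow> H #> (h \<otimes> g) = H #> g"
  using coset_mult_assoc[OF subgroup.subset[OF subH], of h g] H_carrier coset_join2[OF _ subH] by auto

lemma tile_act: "h \<in> H \<Longrightarrow> \<sigma> \<in> affine_simplices p \<Longrightarrow> tile p (simplex_map p (act h) \<sigma>) = h \<otimes> tile p \<sigma>"
  unfolding tile_def using simplex_elt_act[OF H_carrier] coset_H simplex_elt f_carrier H_carrier
  by (simp add: m_assoc)

definition coset_rep :: "'b set \<Rightarrow> 'b" where "coset_rep x = (SOME g. g \<in> x)"

definition transversal :: "'b set" where "transversal = coset_rep ` (rcosets H)"

lemma coset_rep: "x \<in> rcosets H \<Longrightarrow> coset_rep x \<in> x"
proof -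
  assume "x \<in> rcosets H"
  then obtain g where "g \<in> carrier G" "x = H #> g" by (auto simp: RCOSETS_def)
  then have "g \<in> x" using rcos_self[OF _ subH] by auto
  then show ?thesis unfolding coset_rep_def by (rule someI[where P = "\<lambda>g. g \<in> x"])
qed

lemma coset_rep_mult:
  assumes "g \<in> carrier G" obtains h where "h \<in> H" "coset_rep (H #> g) = h \<otimes> g"
  using coset_rep[of "H #> g"] rcosetsI[OF subgroup.subset[OF subH] assms] that by (auto simp: r_coset_def)

lemma transversal_unique:
  assumes "g \<in> transversal" "h \<otimes> g \<in> transversal" "h \<in> H" shows "h = \<one>"
proof -
  have tr: "coset_rep (H #> t) = t \<and> t \<in> carrier G" if "t \<in> transversal" for t
  proof -
    obtain x where x: "x \<in> rcosets H" "t = coset_rep x" using \<open>t \<in> transversal\<close> by (auto simp: transversal_def)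
    then obtain a where a: "a \<in> carrier G" "x = H #> a" by (auto simp: RCOSETS_def)
    have "t \<in> H #> a" using coset_rep[OF x(1)] x(2) a by simp
    then have "H #> a = H #> t" using repr_independence[OF _ a(1) subH] by auto
    moreover have "t \<in> carrier G" using \<open>t \<in> H #> a\<close> r_coset_subset_G[OF subgroup.subset[OF subH] a(1)] by auto
    ultimately show ?thesis using x a by simp
  qed
  have g: "g \<in> carrier G" "coset_rep (H #> g) = g" using tr[OF assms(1)] by auto
  have "coset_rep (H #> (h \<otimes> g)) = h \<otimes> g" using tr[OF assms(2)] by auto
  then have "g = h \<otimes> g" using coset_H[OF assms(3) g(1)] g(2) by simp
  then show ?thesis using g(1) H_carrier[OF assms(3)] by (metis r_cancel_one')
qed

text \<open>The tile labels of the lifts of \<open>\<tau>\<close> run through one right coset of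
  \<open>H\<close>, so exactly one lift has its label in the transversal. Preferred lifts of
  simplices in the same tile therefore fit together without further translation.\<close>

definition tile_lift :: "nat \<Rightarrow> ((nat \<Rightarrow> real) \<Rightarrow> ('a \<Rightarrow> real) set) \<Rightarrow> (nat \<Rightarrow> real) \<Rightarrow> 'a \<Rightarrow> real" where
  "tile_lift p \<tau> = (SOME \<sigma>. \<sigma> \<in> affine_simplices p \<and> simplex_map p q \<sigma> = \<tau> \<and> tile p \<sigma> \<in> transversal)"

lemma tile_lift_unique:
  assumes "\<sigma> \<in> affine_simplices p" "\<sigma>' \<in> affine_simplices p" "simplex_map p q \<sigma> = simplex_map p q \<sigma>'"
    "tile p \<sigma> \<in> transversal" "tile p \<sigma>' \<in> transversal"
  shows "\<sigma> = \<sigma>'"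
proof -
  note s = affine_simplices_singular[OF assms(1)] affine_simplices_singular[OF assms(2)]
  obtain h where h: "h \<in> H" "\<sigma>' = simplex_map p (act h) \<sigma>" using lift_unique[OF s assms(3)] .
  have "h = \<one>" using transversal_unique[OF assms(4) _ h(1)] assms(5) tile_act[OF h(1) assms(1)] h(2) by simp
  then show ?thesis using h(2) simplex_map_act_one[OF s(1)] by simp
qed

lemma tile_lift:
  assumes "\<tau> \<in> affine_q p"
  shows "tile_lift p \<tau> \<in> affine_simplices p \<and> simplex_map p q (tile_lift p \<tau>) = \<tau> \<and> tile p (tile_lift p \<tau>) \<in> transversal"
proof -
  obtain \<sigma> where \<sigma>: "\<sigma> \<in> affine_simplices p" "\<tau> = simplex_map p q \<sigma>" using assms by (auto simp: affine_q_def)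
  obtain h where h: "h \<in> H" "coset_rep (H #> tile p \<sigma>) = h \<otimes> tile p \<sigma>" using coset_rep_mult[OF tile_carrier[OF \<sigma>(1)]] .
  let ?\<sigma> = "simplex_map p (act h) \<sigma>"
  have "?\<sigma> \<in> affine_simplices p" using affine_simplices_act[OF H_carrier[OF h(1)] \<sigma>(1)] .
  moreover have "simplex_map p q ?\<sigma> = \<tau>" using simplex_map_q_act[OF h(1) affine_simplices_singular[OF \<sigma>(1)]] \<sigma>(2) by simp
  moreover have "tile p ?\<sigma> \<in> transversal"
    unfolding tile_act[OF h(1) \<sigma>(1)] h(2)[symmetric] transversal_def
    using rcosetsI[OF subgroup.subset[OF subH] tile_carrier[OF \<sigma>(1)]] by auto
  ultimately have "\<exists>\<sigma>. \<sigma> \<in> affine_simplices p \<and> simplex_map p q \<sigma> = \<tau> \<and> tile p \<sigma> \<in> transversal" by blast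
  then show ?thesis unfolding tile_lift_def by (rule someI_ex)
qed

lemma tile_lift_eq:
  assumes "\<sigma> \<in> affine_simplices p" "tile p \<sigma> \<in> transversal" shows "tile_lift p (simplex_map p q \<sigma>) = \<sigma>"
proof -
  have "simplex_map p q \<sigma> \<in> affine_q p" using assms by (auto simp: affine_q_def)
  from tile_lift[OF this] show ?thesis using tile_lift_unique[of "tile_lift p (simplex_map p q \<sigma>)" p \<sigma>] assms by auto
qed

text \<open>The boundary of each simplex, remembering the tile of the simplex: a chain is killed
  if and only if its part in every single tile is a cycle.\<close>

definition tile_boundary :: "nat \<Rightarrow> ('a \<Rightarrow> real) chain \<Rightarrow> ('b \<times> ((nat \<Rightarrow> real) \<Rightarrow> 'a \<Rightarrow> real)) \<Rightarrow>\<^sub>0 int" where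
  "tile_boundary p = frag_extend (\<lambda>\<sigma>. frag_extend (\<lambda>e. frag_of (tile p \<sigma>, e)) (chain_boundary p (frag_of \<sigma>)))"

definition tile_boundary_q :: "nat \<Rightarrow> ('a \<Rightarrow> real) set chain \<Rightarrow> ('b \<times> ((nat \<Rightarrow> real) \<Rightarrow> 'a \<Rightarrow> real)) \<Rightarrow>\<^sub>0 int" where
  "tile_boundary_q p = frag_extend (\<lambda>\<tau>. tile_boundary p (frag_of (tile_lift p \<tau>)))"

lemma tile_boundary_diff: "tile_boundary p (a - b) = tile_boundary p a - tile_boundary p b"
  by (simp add: tile_boundary_def frag_extend_diff)

lemma tile_boundary_q_diff: "tile_boundary_q p (a - b) = tile_boundary_q p a - tile_boundary_q p b"
  by (simp add: tile_boundary_q_def frag_extend_diff)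

lemma tile_boundary_q_cmul: "tile_boundary_q p (frag_cmul k a) = frag_cmul k (tile_boundary_q p a)"
  by (simp add: tile_boundary_q_def frag_extend_cmul)

lemma tile_boundary_q_sum: "finite I \<Longrightarrow> tile_boundary_q p (sum c I) = (\<Sum>i\<in>I. tile_boundary_q p (c i))"
  by (simp add: tile_boundary_q_def frag_extend_sum o_def)

definition tile_part :: "nat \<Rightarrow> 'b \<Rightarrow> ('a \<Rightarrow> real) chain \<Rightarrow> ('a \<Rightarrow> real) chain" where
  "tile_part p d = frag_extend (\<lambda>\<sigma>. if tile p \<sigma> = d then frag_of \<sigma> else 0)"

lemma chain_boundary_tile_part:
  "chain_boundary p (tile_part p d c) = frag_extend (\<lambda>(d', e). if d' = d then frag_of e else 0) (tile_boundary p c)"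
proof -
  have "Poly_Mapping.keys c \<subseteq> UNIV" by simp
  then show ?thesis
  proof (induction c rule: frag_induction)
    case (one \<sigma>)
    have id: "frag_extend frag_of c = c" for c :: "('a \<Rightarrow> real) chain"
      by (rule frag_expansion[symmetric])
    have "frag_extend (\<lambda>(d', e). if d' = d then frag_of e else 0) (frag_extend (\<lambda>e. frag_of (tile p \<sigma>, e)) c)
       = frag_extend (\<lambda>e. if tile p \<sigma> = d then frag_of e else 0) c" for c
      using frag_extend_compose[of "\<lambda>(d', e). if d' = d then frag_of e else 0" "\<lambda>e. (tile p \<sigma>, e)"]
      by (simp add: o_def fun_eq_iff)
    then have "frag_extend (\<lambda>(d', e). if d' = d then frag_of e else 0) (tile_boundary p (frag_of \<sigma>))
       = frag_extend (\<lambda>e. if tile p \<sigma> = d then frag_of e else 0) (chain_boundary p (frag_of \<sigma>))"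
      by (simp only: tile_boundary_def frag_extend_of)
    moreover have "frag_extend (\<lambda>e. 0) c = (0 :: ('a \<Rightarrow> real) chain)" for c :: "('a \<Rightarrow> real) chain"
      by (simp add: frag_extend_def)
    ultimately show ?case by (cases "tile p \<sigma> = d") (simp_all add: tile_part_def id)
  next
    case (diff a b)
    then show ?case by (simp add: tile_part_def tile_boundary_def frag_extend_diff chain_boundary_diff)
  qed (auto simp: tile_part_def tile_boundary_def)
qed

lemma sum_tile_part:
  assumes "finite D" "Poly_Mapping.keys c \<subseteq> {\<sigma>. tile p \<sigma> \<in> D}"
  shows "(\<Sum>d\<in>D. tile_part p d c) = c"
  using assms(2)
proof (induction c rule: frag_induction)
  case (one \<sigma>)
  then show ?case using assms(1) by (simp add: tile_part_def)
next
  case (diff a b)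
  then show ?case by (simp add: tile_part_def frag_extend_diff sum_subtractf)
qed (auto simp: tile_part_def)

text \<open>That \<open>z\<close> is a cycle would not suffice here, since preferred lifts from
  different tiles need not match along common faces. When every tile part of the lift is itself a
  cycle, the parts are filled one by one upstairs and the fillings are projected.\<close>

lemma tile_boundary_q_kernel:
  assumes triv: "trivial_group (homology_group (int n) (realization K))"
    and z: "Poly_Mapping.keys z \<subseteq> affine_q n" "tile_boundary_q n z = 0"
  shows "\<exists>w. Poly_Mapping.keys w \<subseteq> affine_q (Suc n) \<and> chain_boundary (Suc n) w = z"
proof -
  define c where "c = frag_extend (\<lambda>\<tau>. frag_of (tile_lift n \<tau>)) z"
  have "Poly_Mapping.keys (frag_extend (\<lambda>\<tau>. frag_of (tile_lift n \<tau>)) z) \<subseteq> affine_simplices n \<and>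
     chain_map n q (frag_extend (\<lambda>\<tau>. frag_of (tile_lift n \<tau>)) z) = z \<and>
     tile_boundary n (frag_extend (\<lambda>\<tau>. frag_of (tile_lift n \<tau>)) z) = tile_boundary_q n z"
    using z(1)
  proof (induction z rule: frag_induction)
    case (one \<tau>)
    then show ?case using tile_lift[of \<tau> n] by (simp add: tile_boundary_q_def)
  next
    case (diff a b)
    then show ?case
      unfolding frag_extend_diff
      by (intro conjI keys_diff_subset) (simp_all add: chain_map_diff tile_boundary_q_diff tile_boundary_diff)
  qed (auto simp: tile_boundary_def tile_boundary_q_def)
  then have c: "Poly_Mapping.keys c \<subseteq> affine_simplices n" "chain_map n q c = z" "tile_boundary n c = 0"
    using z(2) unfolding c_def by auto
  define D where "D = tile n ` Poly_Mapping.keys c"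
  have "\<exists>y. Poly_Mapping.keys y \<subseteq> affine_simplices (Suc n) \<and> chain_boundary (Suc n) y = tile_part n d c" for d
  proof (rule affine_cycle_boundary[OF triv])
    show "Poly_Mapping.keys (tile_part n d c) \<subseteq> affine_simplices n"
      unfolding tile_part_def using c(1) by (intro order_trans[OF keys_frag_extend]) (auto split: if_splits)
    show "chain_boundary n (tile_part n d c) = 0"
      unfolding chain_boundary_tile_part c(3) by simp
  qed
  then obtain y where y: "\<And>d. Poly_Mapping.keys (y d) \<subseteq> affine_simplices (Suc n)"
    "\<And>d. chain_boundary (Suc n) (y d) = tile_part n d c" by metis
  define w where "w = (\<Sum>d\<in>D. y d)"
  have kw: "Poly_Mapping.keys w \<subseteq> affine_simplices (Suc n)"
    unfolding w_def using y(1) keys_sum[of y D] by blast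
  have "chain_boundary (Suc n) w = (\<Sum>d\<in>D. tile_part n d c)"
    unfolding w_def by (simp add: chain_boundary_sum y(2) o_def)
  also have "\<dots> = c" by (rule sum_tile_part) (auto simp: D_def)
  finally have "chain_boundary (Suc n) (chain_map (Suc n) q w) = z"
    using chain_boundary_chain_map[OF affine_chain_singular[OF kw], of q] c(2) by simp
  moreover have "Poly_Mapping.keys (chain_map (Suc n) q w) \<subseteq> affine_q (Suc n)"
    unfolding affine_q_def using keys_chain_map[of "Suc n" q w] kw by auto
  ultimately show ?thesis by blast
qed

section \<open>Generators of the relation lattice\<close>

definition generator :: "nat \<Rightarrow> 'b set \<times> ((nat \<Rightarrow> real) \<Rightarrow> 'a \<Rightarrow> real) \<Rightarrow> ((nat \<Rightarrow> real) \<Rightarrow> ('a \<Rightarrow> real) set)" where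
  "generator p = (\<lambda>(x, e). simplex_map p q (simplex_map p (act (coset_rep x)) e))"

lemma coset_rep_carrier: "x \<in> rcosets H \<Longrightarrow> coset_rep x \<in> carrier G"
  using coset_rep subgroup.rcosets_carrier[OF subH is_group] by blast

lemma generator_affine: "x \<in> rcosets H \<Longrightarrow> e \<in> base_simplices p \<Longrightarrow> generator p (x, e) \<in> affine_q p"
  unfolding generator_def affine_q_def base_simplices_def using affine_simplices_act coset_rep_carrier by auto

text \<open>Every affine simplex is \<open>g e\<close> for a base simplex \<open>e\<close>, and
  replacing \<open>g\<close> by the representative of its coset \<open>H g\<close> does not change
  the projection.\<close>

lemma generator_surj:
  assumes "\<tau> \<in> affine_q p" shows "\<exists>x\<in>rcosets H. \<exists>e\<in>base_simplices p. \<tau> = generator p (x, e)"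
proof -
  obtain \<sigma> where \<sigma>: "\<sigma> \<in> affine_simplices p" "\<tau> = simplex_map p q \<sigma>" using assms by (auto simp: affine_q_def)
  define g where "g = simplex_elt p \<sigma>"
  have g: "g \<in> carrier G" unfolding g_def using simplex_elt[OF \<sigma>(1)] .
  define e where "e = simplex_map p (act (inv g)) \<sigma>"
  have e: "e \<in> affine_simplices p" unfolding e_def using affine_simplices_act \<sigma>(1) g by auto
  have eb: "e \<in> base_simplices p"
    using e simplex_elt_act[of "inv g" \<sigma> p] \<sigma>(1) g unfolding base_simplices_def e_def g_def by auto
  obtain h where h: "h \<in> H" "coset_rep (H #> g) = h \<otimes> g" using coset_rep_mult[OF g] .
  have "simplex_map p (act g) e = \<sigma>"
    unfolding e_def using simplex_map_act_mult[of g "inv g" p \<sigma>] g simplex_map_act_one[OF affine_simplices_singular[OF \<sigma>(1)]] by simp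
  then have "simplex_map p (act (h \<otimes> g)) e = simplex_map p (act h) \<sigma>"
    using simplex_map_act_mult[of h g p e] H_carrier[OF h(1)] g by simp
  then have "generator p (H #> g, e) = \<tau>"
    unfolding generator_def h(2) \<sigma>(2) using simplex_map_q_act[OF h(1) affine_simplices_singular[OF \<sigma>(1)]] h(2) by simp
  then show ?thesis using eb rcosetsI[OF subgroup.subset[OF subH] g] by blast
qed

text \<open>A translation by \<open>H\<close> moves the common label of the faces into the
  transversal. The preferred lifts of the projected faces are then the actual faces of one lifted
  simplex, and the expression becomes a labelled double boundary, which is 0.\<close>

lemma tile_boundary_q_good:
  assumes \<sigma>: "\<sigma> \<in> affine_simplices (Suc n)"
    and good: "\<And>k. k \<le> Suc n \<Longrightarrow> tile n (singular_face (Suc n) k \<sigma>) = d"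
  shows "tile_boundary_q n (chain_boundary (Suc n) (frag_of (simplex_map (Suc n) q \<sigma>))) = 0"
proof -
  have faces: "singular_face (Suc n) k \<sigma> \<in> affine_simplices n" if "k \<le> Suc n" for k using affine_simplices_face[OF \<sigma> that] .
  have dc: "d \<in> carrier G" using good[of 0] tile_carrier[OF faces[of 0]] by simp
  obtain h where h: "h \<in> H" "coset_rep (H #> d) = h \<otimes> d" using coset_rep_mult[OF dc] .
  define \<sigma>' where "\<sigma>' = simplex_map (Suc n) (act h) \<sigma>"
  have \<sigma>s: "singular_simplex (Suc n) (realization K) \<sigma>" using affine_simplices_singular[OF \<sigma>] .
  have \<sigma>': "\<sigma>' \<in> affine_simplices (Suc n)" unfolding \<sigma>'_def using affine_simplices_act[OF H_carrier[OF h(1)] \<sigma>] .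
  have f': "singular_face (Suc n) k \<sigma>' \<in> affine_simplices n" "tile n (singular_face (Suc n) k \<sigma>') = h \<otimes> d"
    if "k \<le> Suc n" for k
    using affine_simplices_face[OF \<sigma>' that] face_act[OF that \<sigma>s, of h] tile_act[OF h(1) faces[OF that]] good[OF that]
    by (auto simp: \<sigma>'_def)
  have tr: "h \<otimes> d \<in> transversal" unfolding transversal_def using h(2)[symmetric] rcosetsI[OF subgroup.subset[OF subH] dc] by auto
  have c: "singular_chain (Suc n) (realization K) (frag_of \<sigma>')"
    using affine_simplices_singular[OF \<sigma>'] by (simp add: singular_chain_of)
  have "frag_of (simplex_map (Suc n) q \<sigma>) = chain_map (Suc n) q (frag_of \<sigma>')"
    unfolding \<sigma>'_def by (simp add: simplex_map_q_act[OF h(1) \<sigma>s])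
  then have eq: "chain_boundary (Suc n) (frag_of (simplex_map (Suc n) q \<sigma>)) = chain_map n q (chain_boundary (Suc n) (frag_of \<sigma>'))"
    using chain_boundary_chain_map[OF c, of q] by simp
  define B where "B = {\<rho> \<in> affine_simplices n. tile n \<rho> = h \<otimes> d}"
  have kB: "Poly_Mapping.keys (chain_boundary (Suc n) (frag_of \<sigma>')) \<subseteq> B"
    using keys_boundary_of[of n \<sigma>'] f' unfolding B_def by blast
  have "tile_boundary_q n (chain_map n q c) = frag_extend (\<lambda>e. frag_of (h \<otimes> d, e)) (chain_boundary n c)"
    if "Poly_Mapping.keys c \<subseteq> B" for c
    using that
  proof (induction c rule: frag_induction)
    case (one \<rho>)
    then have "tile_lift n (simplex_map n q \<rho>) = \<rho>" "tile n \<rho> = h \<otimes> d"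
      using tile_lift_eq[of \<rho> n] tr unfolding B_def by auto
    then show ?case by (simp add: tile_boundary_q_def tile_boundary_def)
  next
    case (diff a b)
    then show ?case by (simp add: chain_map_diff tile_boundary_q_diff chain_boundary_diff frag_extend_diff)
  qed (auto simp: tile_boundary_q_def)
  from this[OF kB] show ?thesis unfolding eq using chain_boundary_boundary[OF c] by simp
qed

text \<open>Among the faces of a base simplex only face 0 can have a nontrivial label
  \<open>s\<close>; a coset is bad if \<open>f\<close> violates the selection equation for one of
  these \<open>s\<close>.\<close>

definition bad_cosets :: "nat \<Rightarrow> 'b set set" where
  "bad_cosets n = {x \<in> rcosets H. \<exists>s\<in>(\<lambda>e. simplex_elt n (singular_face (Suc n) 0 e)) ` base_simplices (Suc n). f x \<noteq> s \<otimes> f (x #> s)}"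

lemma apex_face:
  assumes "\<sigma> \<in> affine_simplices (Suc n)" "1 \<le> k" "k \<le> Suc n"
  shows "apex n (singular_face (Suc n) k \<sigma>) = apex (Suc n) \<sigma>"
proof -
  have "simplical_face k (vertex 0) = vertex (0::nat)" using assms by (simp add: simplical_face_vertex)
  then show ?thesis
    using singular_face_apply[OF vertex_in_standard_simplex[of 0 n], of k \<sigma>] by (simp add: apex_def)
qed

text \<open>With \<open>x = H g\<close>, every face of the translate \<open>g e\<close> other than
  face 0 lies in the tile \<open>g f x\<close>, and face 0 lies in the tile
  \<open>g s f (x s)\<close>. Outside the bad cosets these agree.\<close>

lemma generator_good:
  assumes x: "x \<in> rcosets H" "x \<notin> bad_cosets n" and e: "e \<in> base_simplices (Suc n)"
  shows "tile_boundary_q n (chain_boundary (Suc n) (frag_of (generator (Suc n) (x, e)))) = 0"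
proof -
  define g where "g = coset_rep x"
  have g: "g \<in> carrier G" unfolding g_def using coset_rep_carrier[OF x(1)] .
  have xg: "x = H #> g"
  proof -
    obtain a where a: "a \<in> carrier G" "x = H #> a" using x(1) by (auto simp: RCOSETS_def)
    then show ?thesis using repr_independence[OF _ a(1) subH, of g] coset_rep[OF x(1)] unfolding g_def by simp
  qed
  have ea: "e \<in> affine_simplices (Suc n)" "simplex_elt (Suc n) e = \<one>" using e by (auto simp: base_simplices_def)
  define s where "s = simplex_elt n (singular_face (Suc n) 0 e)"
  have face0: "singular_face (Suc n) k e \<in> affine_simplices n" if "k \<le> Suc n" for k using affine_simplices_face[OF ea(1) that] .
  have s: "s \<in> carrier G" unfolding s_def using simplex_elt face0 by simp
  have fx: "f x = s \<otimes> f (x #> s)"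
    using x e unfolding bad_cosets_def s_def by blast
  have xs: "x #> s = H #> (g \<otimes> s)" unfolding xg using coset_mult_assoc[OF subgroup.subset[OF subH] g s] by simp
  have fc: "f x \<in> carrier G" "f (x #> s) \<in> carrier G" unfolding xs using xg f_carrier g s by auto
  have "tile n (singular_face (Suc n) k (simplex_map (Suc n) (act g) e)) = g \<otimes> f x" if k: "k \<le> Suc n" for k
  proof -
    have "singular_face (Suc n) k (simplex_map (Suc n) (act g) e) = simplex_map n (act g) (singular_face (Suc n) k e)"
      by (rule face_act[OF k affine_simplices_singular[OF ea(1)]])
    then have el: "simplex_elt n (singular_face (Suc n) k (simplex_map (Suc n) (act g) e)) = g \<otimes> simplex_elt n (singular_face (Suc n) k e)"
      using simplex_elt_act[OF g face0[OF k]] by simp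
    show ?thesis
    proof (cases "k = 0")
      case True
      then have "tile n (singular_face (Suc n) k (simplex_map (Suc n) (act g) e)) = (g \<otimes> s) \<otimes> f (H #> (g \<otimes> s))"
        unfolding tile_def el s_def by simp
      also have "\<dots> = g \<otimes> (s \<otimes> f (x #> s))" using xs fc g s by (simp add: m_assoc)
      finally show ?thesis using fx by simp
    next
      case False
      then have "simplex_elt n (singular_face (Suc n) k e) = \<one>"
        using apex_face[OF ea(1) _ k] ea(2) by (simp add: simplex_elt_def)
      then show ?thesis unfolding tile_def el using g xg by simp
    qed
  qed
  then show ?thesis
    unfolding generator_def using tile_boundary_q_good[OF affine_simplices_act[OF g ea(1)]] by (simp add: g_def)
qed

text \<open>The vectors \<open>v i\<close> indexed by bad cosets and base simplices span all
  relations, the other generators giving 0. One factor \<open>n + 2\<close> of the norm bound counts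
  the faces of an \<open>n + 1\<close>-simplex, the other bounds the boundary of each face; the
  factor \<open>2 * exp 1\<close> comes from the lattice estimate.\<close>

lemma torsion_bound:
  assumes fin: "finite (rcosets H)" and n: "n \<ge> 1"
    and triv: "trivial_group (homology_group (int n) (realization K))"
  shows "real (homology_torsion n Y) \<le> ((2 * (real n + 2) ^ 2 * exp 1) ^ card (base_simplices (Suc n))) ^ card (bad_cosets n)"
proof -
  define B where "B = bad_cosets n \<times> base_simplices (Suc n)"
  define v where "v i = tile_boundary_q n (chain_boundary (Suc n) (frag_of (generator (Suc n) i)))" for i
  have finbad: "finite (bad_cosets n)" using fin by (simp add: bad_cosets_def)
  have finB: "finite B" unfolding B_def using finbad base_simplices_finite by simp
  have span: "tile_boundary_q n (chain_boundary (Suc n) w) \<in> frag_span B v"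
    if "Poly_Mapping.keys w \<subseteq> affine_q (Suc n)" for w
    using that
  proof (induction w rule: frag_induction)
    case (one \<tau>)
    then obtain x e where xe: "x \<in> rcosets H" "e \<in> base_simplices (Suc n)" "\<tau> = generator (Suc n) (x, e)"
      using generator_surj by blast
    show ?case
    proof (cases "x \<in> bad_cosets n")
      case True
      then have i: "(x, e) \<in> B" using xe by (simp add: B_def)
      have "(\<Sum>i\<in>B. frag_cmul (if i = (x, e) then 1 else 0) (v i)) = v (x, e)"
        using finB i by (simp add: if_distrib[of "\<lambda>k. frag_cmul k _"] cong: if_cong)
      then have "v (x, e) \<in> frag_span B v" unfolding frag_span_def
        by (intro CollectI exI[of _ "\<lambda>i. if i = (x, e) then 1 else 0"] conjI TrueI) simp
      then show ?thesis unfolding v_def xe(3) .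
    next
      case False
      then show ?thesis using generator_good[OF xe(1) False xe(2)] xe(3) frag_span_0 by simp
    qed
  next
    case (diff a b)
    then show ?case by (simp add: chain_boundary_diff tile_boundary_q_diff frag_span_diff)
  qed (auto simp: tile_boundary_q_def frag_span_0)
  have span': "\<exists>w. Poly_Mapping.keys w \<subseteq> affine_q (Suc n) \<and> u = tile_boundary_q n (chain_boundary (Suc n) w)"
    if us: "u \<in> frag_span B v" for u
  proof -
    obtain m where m: "u = (\<Sum>i\<in>B. frag_cmul (m i) (v i))" using us unfolding frag_span_def by blast
    define w where "w = (\<Sum>i\<in>B. frag_cmul (m i) (frag_of (generator (Suc n) i)))"
    have gen: "generator (Suc n) i \<in> affine_q (Suc n)" if "i \<in> B" for i
      using that generator_affine unfolding B_def bad_cosets_def by auto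
    have "Poly_Mapping.keys (frag_cmul (m i) (frag_of (generator (Suc n) i))) \<subseteq> affine_q (Suc n)" if "i \<in> B" for i
      using gen[OF that] keys_cmul[of "m i" "frag_of (generator (Suc n) i)"] by auto
    then have "Poly_Mapping.keys w \<subseteq> affine_q (Suc n)"
      unfolding w_def using keys_sum[of "\<lambda>i. frag_cmul (m i) (frag_of (generator (Suc n) i))" B] by blast
    moreover have "u = tile_boundary_q n (chain_boundary (Suc n) w)"
      unfolding m w_def v_def using finB
      by (simp add: chain_boundary_sum o_def chain_boundary_cmul tile_boundary_q_sum tile_boundary_q_cmul)
    ultimately show ?thesis by blast
  qed
  have norm: "real_of_int (frag_norm (v i)) \<le> (real n + 2) ^ 2" for i
  proof -
    have tb: "frag_norm (tile_boundary n (frag_of \<sigma>)) \<le> int n + 2" for \<sigma>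
    proof -
      have "frag_norm (tile_boundary n (frag_of \<sigma>)) \<le> 1 * frag_norm (chain_boundary n (frag_of \<sigma>))"
        unfolding tile_boundary_def by (simp only: frag_extend_of) (rule frag_norm_extend, simp add: frag_norm_of)
      also have "\<dots> \<le> int (n - 1) + 2" using frag_norm_boundary[of "n - 1" \<sigma>] n by simp
      finally show ?thesis by linarith
    qed
    have "frag_norm (v i) \<le> (int n + 2) * frag_norm (chain_boundary (Suc n) (frag_of (generator (Suc n) i)))"
      unfolding v_def tile_boundary_q_def by (rule frag_norm_extend) (rule tb)
    also have "\<dots> \<le> (int n + 2) * (int n + 2)" by (intro mult_left_mono frag_norm_boundary) auto
    finally have "real_of_int (frag_norm (v i)) \<le> real_of_int ((int n + 2) * (int n + 2))" by (simp only: of_int_le_iff)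
    then show ?thesis by (simp add: power2_eq_square)
  qed
  define A where "A = homology_group (int n) Y"
  have ex: "\<exists>z. Poly_Mapping.keys z \<subseteq> small_q n \<and> singular_relcycle n Y {} z \<and> t = homologous_rel_set n Y {} z"
    if "t \<in> torsion_elements A" for t
  proof -
    have "t \<in> carrier A" using that by (simp add: torsion_elements_def)
    then obtain z0 where z0: "singular_relcycle n Y {} z0" "t = homologous_rel_set n Y {} z0"
      unfolding A_def carrier_relative_homology_group by blast
    obtain z where z: "Poly_Mapping.keys z \<subseteq> small_q n" "singular_relcycle n Y {} z" "homologous_rel n Y {} z0 z"
      using small_cycle_exists[OF z0(1)] .
    have "homologous_rel n Y {} z0 = homologous_rel n Y {} z" using z(3) homologous_rel_eq by blast
    then show ?thesis using z(1,2) z0(2) by (intro exI[of _ z]) simp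
  qed
  then obtain z where z: "\<And>t. t \<in> torsion_elements A \<Longrightarrow> Poly_Mapping.keys (z t) \<subseteq> small_q n"
    "\<And>t. t \<in> torsion_elements A \<Longrightarrow> singular_relcycle n Y {} (z t)"
    "\<And>t. t \<in> torsion_elements A \<Longrightarrow> t = homologous_rel_set n Y {} (z t)" by metis
  have bd: "chain_boundary n (z t) = 0" if "t \<in> torsion_elements A" for t
    using z(2)[OF that] by (simp add: singular_cycle)
  \<comment> \<open>\<open>z t\<close> is an arbitrary representative, so \<open>u\<close> is not
    claimed to be additive. What matters is that its values lie in the saturation and are distinct
    modulo the span.\<close>
  define u where "u t = tile_boundary_q n (straighten_q n (z t))" for t
  have sat: "u t \<in> frag_sat (frag_span B v)" if t: "t \<in> torsion_elements A" for t
  proof -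
    obtain k :: nat where k: "k > 0" "t [^]\<^bsub>A\<^esub> k = \<one>\<^bsub>A\<^esub>" using t by (auto simp: torsion_elements_def)
    \<comment> \<open>Elements of the homology group are sets of homologous cycles, and the
      \<open>k\<close>-fold multiple of a representative represents the \<open>k\<close>-th
      power.\<close>
    have "frag_cmul (int k) (z t) \<in> t [^]\<^bsub>A\<^esub> k" for k :: nat
    proof (induction k)
      case 0
      then show ?case by (simp add: A_def)
    next
      case (Suc k)
      have "z t \<in> t" using z(3)[OF t] by (metis homologous_rel_refl mem_Collect_eq)
      moreover have "frag_cmul (int (Suc k)) (z t) = frag_cmul (int k) (z t) + z t" by (simp add: frag_cmul_distrib)
      ultimately have "frag_cmul (int (Suc k)) (z t) \<in> t [^]\<^bsub>A\<^esub> k \<otimes>\<^bsub>A\<^esub> t"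
        using Suc unfolding A_def mult_relative_homology_group by blast
      then show ?case by simp
    qed
    then have "frag_cmul (int k) (z t) \<in> \<one>\<^bsub>A\<^esub>" using k(2) by metis
    then have "singular_relboundary n Y {} (frag_cmul (int k) (z t))" by (simp add: A_def)
    then obtain c where c: "singular_chain (Suc n) Y c" "chain_boundary (Suc n) c = frag_cmul (int k) (z t)"
      by (auto simp: singular_boundary)
    have "Poly_Mapping.keys (frag_cmul (int k) (z t)) \<subseteq> small_q n" using z(1)[OF t] keys_cmul by blast
    moreover have "chain_boundary n (frag_cmul (int k) (z t)) = 0" using bd[OF t] by (simp add: chain_boundary_cmul)
    ultimately obtain w where w: "Poly_Mapping.keys w \<subseteq> small_q (Suc n)" "chain_boundary (Suc n) w = frag_cmul (int k) (z t)"
      using small_boundary c by blast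
    have "frag_cmul (int k) (u t) = tile_boundary_q n (straighten_q n (chain_boundary (Suc n) w))"
      unfolding u_def w(2) by (simp add: straighten_q_def frag_extend_cmul tile_boundary_q_cmul)
    also have "\<dots> = tile_boundary_q n (chain_boundary (Suc n) (straighten_q (Suc n) w))"
      by (simp add: chain_boundary_straighten_q[OF w(1)])
    also have "\<dots> \<in> frag_span B v" by (rule span[OF straighten_q_keys[OF w(1)]])
    finally show ?thesis unfolding frag_sat_def using k(1) by (intro CollectI exI[of _ "int k"]) auto
  qed
  have inj: "t = t'" if t: "t \<in> torsion_elements A" "t' \<in> torsion_elements A" and d: "u t - u t' \<in> frag_span B v" for t t'
  proof -
    \<comment> \<open>\<open>u t - u t'\<close> comes from a straight boundary \<open>w\<close>.
      Subtracting that boundary puts the straightening of \<open>y\<close> into the kernel of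
      \<open>tile_boundary_q\<close>, so the difference bounds some \<open>w'\<close>. The
      straightening is homologous to \<open>y\<close> through \<open>w''\<close>, and the three
      fillings add up to one of \<open>y\<close>.\<close>
    define y where "y = z t - z t'"
    have y: "Poly_Mapping.keys y \<subseteq> small_q n" "chain_boundary n y = 0"
      unfolding y_def using z(1)[OF t(1)] z(1)[OF t(2)]
      by (rule keys_diff_subset) (simp add: chain_boundary_diff bd[OF t(1)] bd[OF t(2)])
    obtain w where w: "Poly_Mapping.keys w \<subseteq> affine_q (Suc n)" "u t - u t' = tile_boundary_q n (chain_boundary (Suc n) w)"
      using span'[OF d] by blast
    have wb: "Poly_Mapping.keys (chain_boundary (Suc n) w) \<subseteq> affine_q n"
    proof (rule keys_boundary_subset[OF w(1)])
      fix \<tau> k assume \<tau>: "\<tau> \<in> affine_q (Suc n)" "k \<le> Suc n"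
      then obtain \<sigma> where \<sigma>: "\<sigma> \<in> affine_simplices (Suc n)" "\<tau> = simplex_map (Suc n) q \<sigma>" by (auto simp: affine_q_def)
      have "singular_face (Suc n) k \<tau> = simplex_map n q (singular_face (Suc n) k \<sigma>)"
      proof (rule singular_face_eqI)
        fix x :: "nat \<Rightarrow> real" assume x: "x \<in> standard_simplex n"
        have "simplical_face k x \<in> standard_simplex (Suc n)"
          using simplical_face_in_standard_simplex[of "Suc n" k x] x \<tau> by simp
        then show "\<tau> (simplical_face k x) = simplex_map n q (singular_face (Suc n) k \<sigma>) x"
          using x \<sigma>(2) by (simp add: simplex_map_def singular_face_apply)
      qed (simp add: simplex_map_def)
      then show "singular_face (Suc n) k \<tau> \<in> affine_q n" using affine_simplices_face[OF \<sigma>(1) \<tau>(2)] by (simp add: affine_q_def)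
    qed
    have sy: "straighten_q n y = straighten_q n (z t) - straighten_q n (z t')"
      unfolding y_def by (simp add: straighten_q_def frag_extend_diff)
    have "tile_boundary_q n (straighten_q n y - chain_boundary (Suc n) w) = 0"
      using w(2) unfolding sy u_def by (simp add: tile_boundary_q_diff)
    moreover have "Poly_Mapping.keys (straighten_q n y - chain_boundary (Suc n) w) \<subseteq> affine_q n"
      by (intro keys_diff_subset straighten_q_keys y wb)
    ultimately obtain w' where w': "Poly_Mapping.keys w' \<subseteq> affine_q (Suc n)"
      "chain_boundary (Suc n) w' = straighten_q n y - chain_boundary (Suc n) w"
      using tile_boundary_q_kernel[OF triv] by blast
    obtain p where p: "n = Suc p" using n by (cases n) auto
    obtain w'' where w'': "singular_chain (Suc n) Y w''" "chain_boundary (Suc n) w'' = y - straighten_q n y"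
      using straighten_q_homologous[of y p] y unfolding p by blast
    have sc: "singular_chain (Suc n) Y c" if "Poly_Mapping.keys c \<subseteq> affine_q (Suc n)" for c
      using that singular_simplex_q affine_simplices_singular unfolding singular_chain_def affine_q_def by blast
    have "singular_chain (Suc n) Y (w'' + (w' + w))" using w'' sc[OF w(1)] sc[OF w'(1)] by (intro singular_chain_add)
    moreover have "chain_boundary (Suc n) (w'' + (w' + w)) = y" by (simp add: chain_boundary_add w'' w')
    ultimately have "singular_relboundary n Y {} y" by (auto simp: singular_boundary)
    then have "homologous_rel n Y {} (z t) (z t')" unfolding homologous_rel_def y_def .
    then have "homologous_rel n Y {} (z t) = homologous_rel n Y {} (z t')" using homologous_rel_eq by blast
    then show ?thesis using z(3)[OF t(1)] z(3)[OF t(2)] by simp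
  qed
  let ?C = "2 * (real n + 2) ^ 2 * exp 1"
  have "real (card (torsion_elements A)) \<le> ?C ^ card B"
  \<comment> \<open>For an infinite set \<open>card\<close> is 0, which makes the bound trivial in
    that case.\<close>
  proof (cases "finite (torsion_elements A)")
    case True
    have "inj_on u (torsion_elements A)"
    proof (rule inj_onI)
      fix t t' assume "t \<in> torsion_elements A" "t' \<in> torsion_elements A" "u t = u t'"
      then show "t = t'" using inj frag_span_0[of B v] by simp
    qed
    then have "real (card (torsion_elements A)) = real (card (u ` torsion_elements A))" by (simp add: card_image)
    also have "\<dots> \<le> ?C ^ card B"
    proof (rule card_torsion_classes_le[OF finB _ norm])
      show "1 \<le> (real n + 2) ^ 2" by (rule one_le_power) simp
      show "x = y" if xy: "x \<in> u ` torsion_elements A" "y \<in> u ` torsion_elements A" "x - y \<in> frag_span B v" for x y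
      proof -
        obtain t t' where "t \<in> torsion_elements A" "t' \<in> torsion_elements A" "x = u t" "y = u t'" using xy by blast
        then show ?thesis using inj[of t t'] xy(3) by simp
      qed
    qed (use True sat in auto)
    finally show ?thesis .
  qed auto
  also have "\<dots> = (?C ^ card (base_simplices (Suc n))) ^ card (bad_cosets n)"
    unfolding B_def by (simp add: card_cartesian_product power_mult[symmetric] mult.commute)
  finally show ?thesis unfolding homology_torsion_def A_def .
qed

end

section \<open>Growth of torsion along the chain\<close>

theorem theorem1:
  fixes G :: "'g monoid" and K :: "'v set set" and \<phi> :: "'g \<Rightarrow> 'v \<Rightarrow> 'v"
    and H :: "nat \<Rightarrow> 'g set" and n :: nat
  assumes "group G" and "amenable_group G"
    and "abstract_simplicial_complex K"
    and "simply_connected_space (realization K)"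
    and "simplicial_action G K \<phi>"
    and "acts_freely G K \<phi>"
    and "compact_space (orbit_space G K \<phi> (carrier G))"
    and "n \<ge> 1"
    and "trivial_group (homology_group (int n) (realization K))"
    and "farber_chain G H"
  shows "(\<lambda>i. ln (real (homology_torsion n (orbit_space G K \<phi> (H i))))
                / real (subgroup_index G (H i))) \<longlonglongrightarrow> 0"
proof -
  interpret simplicial_complex K by unfold_locales (rule assms(3))
  interpret group G by (rule assms(1))
  interpret free_simplicial_action K G \<phi> by unfold_locales (rule assms(5,6))+
  interpret cocompact_simplicial_action K G \<phi> by unfold_locales (rule assms(7))
  have sub: "subgroup (H i) G" and finL: "finite (lcosets\<^bsub>G\<^esub> (H i))" for i
    using assms(10) unfolding farber_chain_def subgroup_chain_def by auto
  have fin: "finite (rcosets\<^bsub>G\<^esub> (H i))" for i using card_rcosets(2)[OF sub finL] .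
  have idx: "card (rcosets\<^bsub>G\<^esub> (H i)) = subgroup_index G (H i)" for i using card_rcosets(1)[OF sub] .
  have pos: "real (subgroup_index G (H i)) > 0" for i
  proof -
    have "lcosets\<^bsub>G\<^esub> (H i) \<noteq> {}" by (auto simp: LCOSETS_def)
    then show ?thesis using finL[of i] by (simp add: subgroup_index_def card_gt_0_iff)
  qed
  \<comment> \<open>The steps \<open>s\<close> compared in \<open>bad_cosets\<close>. Both this set
    and the constant \<open>C\<close> are built from base simplices of the action of
    \<open>G\<close>, so they serve all \<open>H i\<close> at once.\<close>
  define S where "S = (\<lambda>e. simplex_elt n (singular_face (Suc n) 0 e)) ` base_simplices (Suc n)"
  have S: "finite S" "S \<subseteq> carrier G"
    unfolding S_def using base_simplices_finite simplex_elt affine_simplices_face[of _ n 0]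
    by (auto simp: base_simplices_def)
  define C where "C = (2 * (real n + 2) ^ 2 * exp 1) ^ card (base_simplices (Suc n))"
  have C: "C \<ge> 1"
  proof -
    have a: "1 \<le> (real n + 2) ^ 2" by (rule one_le_power) simp
    have b: "1 \<le> exp (1::real)" by simp
    have "1 * 1 \<le> (2 * (real n + 2) ^ 2) * exp (1::real)"
      by (rule mult_mono) (use a b in linarith)+
    then show ?thesis unfolding C_def by (intro one_le_power) simp
  qed
  let ?T = "\<lambda>i. real (homology_torsion n (orbit_space G K \<phi> (H i)))"
  let ?N = "\<lambda>i. real (subgroup_index G (H i))"
  show ?thesis
  proof (rule tendstoI)
    fix e :: real assume e: "e > 0"
    \<comment> \<open>The \<open>+ 1\<close> keeps the denominator positive when
      \<open>ln C = 0\<close>, and the 2 makes the final inequality strict.\<close>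
    define e1 where "e1 = e / (2 * (ln C + 1))"
    have lnC: "ln C \<ge> 0" using C by simp
    have e1: "e1 > 0" unfolding e1_def using e lnC by simp
    have "\<forall>\<^sub>F i in sequentially. \<exists>f \<in> rcosets\<^bsub>G\<^esub> (H i) \<rightarrow> carrier G.
       real (card {x \<in> rcosets\<^bsub>G\<^esub> (H i). \<exists>s\<in>S. f x \<noteq> s \<otimes>\<^bsub>G\<^esub> f (x #>\<^bsub>G\<^esub> s)}) \<le> e1 * real (card (rcosets\<^bsub>G\<^esub> (H i)))"
      by (rule farber_equivariant_selection[OF assms(2,10) S e1])
    then show "\<forall>\<^sub>F i in sequentially. dist (ln (?T i) / ?N i) 0 < e"
    proof (rule eventually_mono)
      fix i assume "\<exists>f \<in> rcosets\<^bsub>G\<^esub> (H i) \<rightarrow> carrier G.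
       real (card {x \<in> rcosets\<^bsub>G\<^esub> (H i). \<exists>s\<in>S. f x \<noteq> s \<otimes>\<^bsub>G\<^esub> f (x #>\<^bsub>G\<^esub> s)}) \<le> e1 * real (card (rcosets\<^bsub>G\<^esub> (H i)))"
      then obtain f where sel: "f \<in> rcosets\<^bsub>G\<^esub> (H i) \<rightarrow> carrier G"
        "real (card {x \<in> rcosets\<^bsub>G\<^esub> (H i). \<exists>s\<in>S. f x \<noteq> s \<otimes>\<^bsub>G\<^esub> f (x #>\<^bsub>G\<^esub> s)}) \<le> e1 * ?N i"
        unfolding idx by blast
      interpret simplicial_covering K G \<phi> "H i"
        by (intro simplicial_covering.intro simplicial_covering_axioms.intro
            cocompact_simplicial_action_axioms sub)
      interpret tiled_covering K G \<phi> "H i" f by unfold_locales (rule sel(1))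
      have T: "?T i \<le> C ^ card (bad_cosets n)"
        using torsion_bound[OF fin assms(8,9)] unfolding C_def .
      have bad: "real (card (bad_cosets n)) \<le> e1 * ?N i"
        using sel(2) unfolding bad_cosets_def S_def .
      \<comment> \<open>The argument is a natural number: \<open>ln 0\<close> is 0 by convention,
        and from 1 on the logarithm is nonnegative.\<close>
      have "0 \<le> ln (?T i)" by (cases "homology_torsion n (orbit_space G K \<phi> (H i))") auto
      moreover have "ln (?T i) \<le> real (card (bad_cosets n)) * ln C"
      proof (cases "?T i = 0")
        case True
        then show ?thesis using lnC by simp
      next
        case False
        then have "ln (?T i) \<le> ln (C ^ card (bad_cosets n))" using T by (intro ln_mono) auto
        then show ?thesis using C by (simp add: ln_realpow)
      qed
      moreover have "real (card (bad_cosets n)) * ln C \<le> (e1 * ?N i) * ln C" using bad lnC by (intro mult_right_mono)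
      ultimately have b: "0 \<le> ln (?T i)" "ln (?T i) \<le> (e1 * ln C) * ?N i" by (auto simp: mult_ac)
      have "e1 * ln C < e"
      proof -
        have "e1 * ln C \<le> e1 * (ln C + 1)" using e1 by (intro mult_left_mono) auto
        also have "\<dots> = e / 2" unfolding e1_def using lnC by (simp add: field_simps)
        finally show ?thesis using e by simp
      qed
      moreover have "ln (?T i) / ?N i \<le> e1 * ln C" using b(2) pos[of i] by (simp add: divide_le_eq)
      moreover have "0 \<le> ln (?T i) / ?N i" using b(1) pos[of i] by simp
      ultimately show "dist (ln (?T i) / ?N i) 0 < e" by (simp add: dist_real_def)
    qed
  qed
qed

end
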